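(* Let $\alpha\in(0,1)$, let $\gamma$ be the random environment defined in the context (jumps in $[0,1]$ of an $\alpha$-stable subordinator, in decreasing order), and, given $\gamma$, let $Y$ be a K$(\gamma,0)$-process started at $\infty$. For $t,\theta>0$ let $$\Lambda_t(\theta)=\mathbb P_\infty\big(Y(s)=Y(t)\ \text{ for all } s\in[t,t+\theta t]\,\big|\,\gamma\big).$$ Then almost surely (with respect to $\gamma$), for every $\theta>0$, $$\lim_{t\to0}\Lambda_t(\theta)=\Lambda(\theta),\qquad\text{where}\quad \Lambda(\theta)=\frac{\sin(\pi\alpha)}{\pi}\int_{\frac{\theta}{1+\theta}}^1 s^{-\alpha}(1-s)^{\alpha-1}\,ds .$$
   Context: $\mathbb N^*=\{1,2,\dots\}$ and $\bar{\mathbb N}^*=\{1,2,\dots,\infty\}$ is its one-point compactification. Environment. Let $V_x$, $x\in\mathbb R$, $V_0=0$, be the increasing Lévy process with stationary independent increments given by $\mathbb E[e^{ir(V_{x+x_0}-V_{x_0})}]=\exp\big(\alpha x\int_0^\infty(e^{irw}-1)w^{-1-\alpha}dw\big)$ for $x_0\in\mathbb R$, $x\ge0$. Its Lebesgue–Stieltjes measure $\rho$ is purely atomic: $\rho=\sum_j w_j\delta_{x_j}$ with $\{(x_j,w_j)\}$ a Poisson point process on $\mathbb R\times(0,\infty)$ with density $dx\,\alpha w^{-1-\alpha}dw$. $\gamma=\{\gamma(i),i\in\mathbb N^*\}$ denotes the weights of the atoms of $\rho$ in $[0,1]$ listed in decreasing order. Almost surely $\gamma(i)>0$ for all $i$ and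 $\sum_i\gamma(i)<\infty$. K$(\gamma,0)$-process started at $\infty$, for fixed $\gamma$. Let $(N^{(x)}_t)_{t\ge0}$, $x\in\mathbb N^*$, be i.i.d. Poisson processes of rate 1, with $\sigma^{(x)}_j$ the $j$-th event time of $N^{(x)}$; let $T^{(x)}_i$, $i\ge1$, $x\in\mathbb N^*$, be i.i.d. rate 1 exponentials, independent of the Poisson processes (all independent of $\gamma$). Let $\Gamma(t)=\sum_{x=1}^\infty\gamma(x)\sum_{i=1}^{N^{(x)}_t}T^{(x)}_i$. Then $Y(t)=x$ if $\Gamma(\sigma^{(x)}_j-)\le t<\Gamma(\sigma^{(x)}_j)$ for some $x\in\mathbb N^*$, $1\le j<\infty$, and $Y(t)=\infty$ otherwise. $\mathbb P_\infty(\cdot|\gamma)$ is the law of this process with $\gamma$ fixed. *)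

theory Defs
  imports "HOL-Probability.Probability"
begin

section \<open>The random environment\<close>

text \<open>
  The increasing two-sided Levy process \<open>V\<close> with \<open>V 0 = 0\<close>. Monotonicity and right-continuity
  of the paths (needed for the Lebesgue--Stieltjes measure) are required almost surely.
  Independence of the increments along every nondecreasing infinite sequence of times contains the
  case of finitely many times, by continuing a finite sequence constantly.
\<close>

definition stable_subordinator :: "'a measure \<Rightarrow> real \<Rightarrow> (real \<Rightarrow> 'a \<Rightarrow> real) \<Rightarrow> bool" where
  "stable_subordinator M \<alpha> V \<longleftrightarrow>
     prob_space M \<and>
     (\<forall>x. V x \<in> borel_measurable M) \<and>
     (AE \<omega> in M. V 0 \<omega> = 0 \<and> mono (\<lambda>x. V x \<omega>) \<and>
        (\<forall>x. continuous (at_right x) (\<lambda>y. V y \<omega>))) \<and>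
     (\<forall>x :: nat \<Rightarrow> real. mono x \<longrightarrow>
        prob_space.indep_vars M (\<lambda>_. borel) (\<lambda>k \<omega>. V (x (Suc k)) \<omega> - V (x k) \<omega>) UNIV) \<and>
     (\<forall>x0 x r. 0 \<le> x \<longrightarrow>
        char (distr M borel (\<lambda>\<omega>. V (x + x0) \<omega> - V x0 \<omega>)) r =
        exp (complex_of_real (\<alpha> * x) *
             (LINT w:{0<..}|lborel. (iexp (r * w) - 1) * complex_of_real (w powr (- 1 - \<alpha>)))))"

definition env_measure :: "(real \<Rightarrow> 'a \<Rightarrow> real) \<Rightarrow> 'a \<Rightarrow> real measure" where
  "env_measure V \<omega> = interval_measure (\<lambda>x. V x \<omega>)"

text \<open>
  \<open>g 1 \<ge> g 2 \<ge> \<dots>\<close> lists the weights of the atoms of \<open>\<rho>\<close> in \<open>[0,1]\<close>, each atom occurring exactly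
  once (so equal weights are listed with multiplicity). The value \<open>g 0\<close> is irrelevant.
\<close>

definition decreasing_atom_weights :: "real measure \<Rightarrow> (nat \<Rightarrow> real) \<Rightarrow> bool" where
  "decreasing_atom_weights \<rho> g \<longleftrightarrow>
     antimono_on {1..} g \<and>
     (\<exists>a. bij_betw a {1..} {z \<in> {0..1}. measure \<rho> {z} > 0} \<and>
          (\<forall>i\<ge>1. g i = measure \<rho> {a i}))"

text \<open>
  On the positive integers such a listing is unique if it exists; it exists for almost every
  \<open>\<omega>\<close> when \<open>V\<close> is a stable subordinator.
\<close>

definition env_weights :: "(real \<Rightarrow> 'a \<Rightarrow> real) \<Rightarrow> 'a \<Rightarrow> nat \<Rightarrow> real" where
  "env_weights V \<omega> = (SOME g. decreasing_atom_weights (env_measure V \<omega>) g)"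


section \<open>The driving Poisson processes and exponential variables\<close>

text \<open>
  Only the times \<open>t \<ge> 0\<close> matter. The differences are truncated subtractions on \<open>nat\<close>, which are
  genuine differences almost surely since the paths are nondecreasing.
\<close>

definition poisson_process :: "'b measure \<Rightarrow> real \<Rightarrow> (real \<Rightarrow> 'b \<Rightarrow> nat) \<Rightarrow> bool" where
  "poisson_process P l N \<longleftrightarrow>
     (\<forall>t\<ge>0. N t \<in> measurable P (count_space UNIV)) \<and>
     (AE \<omega> in P. N 0 \<omega> = 0 \<and> mono_on {0..} (\<lambda>t. N t \<omega>) \<and>
        (\<forall>t\<ge>0. continuous (at_right t) (\<lambda>s. real (N s \<omega>)))) \<and>
     (\<forall>t :: nat \<Rightarrow> real. mono t \<longrightarrow> 0 \<le> t 0 \<longrightarrow>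
        prob_space.indep_vars P (\<lambda>_. count_space UNIV) (\<lambda>k \<omega>. N (t (Suc k)) \<omega> - N (t k) \<omega>) UNIV) \<and>
     (\<forall>s t. 0 \<le> s \<longrightarrow> s < t \<longrightarrow>
        distr P (count_space UNIV) (\<lambda>\<omega>. N t \<omega> - N s \<omega>) = measure_pmf (poisson_pmf (l * (t - s))))"

definition process_events :: "'b measure \<Rightarrow> (real \<Rightarrow> 'b \<Rightarrow> nat) \<Rightarrow> 'b set set" where
  "process_events P N = sigma_sets (space P) {N t -` A \<inter> space P | t A. 0 \<le> t}"

definition variable_events :: "'b measure \<Rightarrow> ('b \<Rightarrow> real) \<Rightarrow> 'b set set" where
  "variable_events P X = {X -` A \<inter> space P | A. A \<in> sets borel}"

text \<open>
  The whole processes \<open>N x\<close> and the variables \<open>T x i\<close> (\<open>x, i \<ge> 1\<close>) form a single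
  independent family, indexed by a disjoint sum.
\<close>

definition k_process_driver ::
  "'b measure \<Rightarrow> (nat \<Rightarrow> real \<Rightarrow> 'b \<Rightarrow> nat) \<Rightarrow> (nat \<Rightarrow> nat \<Rightarrow> 'b \<Rightarrow> real) \<Rightarrow> bool" where
  "k_process_driver P N T \<longleftrightarrow>
     prob_space P \<and>
     (\<forall>x\<ge>1. poisson_process P 1 (N x)) \<and>
     (\<forall>x\<ge>1. \<forall>i\<ge>1. distributed P lborel (T x i) (exponential_density 1)) \<and>
     prob_space.indep_sets P
       (case_sum (\<lambda>x. process_events P (N x)) (\<lambda>(x, i). variable_events P (T x i)))
       ({1..} <+> ({1..} \<times> {1..}))"


section \<open>The K-process with weights \<open>g\<close> and second parameter \<open>0\<close>, started at infinity\<close>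

definition event_time :: "(real \<Rightarrow> 'b \<Rightarrow> nat) \<Rightarrow> nat \<Rightarrow> 'b \<Rightarrow> real" where
  "event_time N j \<omega> = Inf {t. 0 \<le> t \<and> j \<le> N t \<omega>}"

definition k_clock ::
  "(nat \<Rightarrow> real) \<Rightarrow> (nat \<Rightarrow> real \<Rightarrow> 'b \<Rightarrow> nat) \<Rightarrow> (nat \<Rightarrow> nat \<Rightarrow> 'b \<Rightarrow> real) \<Rightarrow> 'b \<Rightarrow> real \<Rightarrow> real" where
  "k_clock g N T \<omega> t = (\<Sum>\<^sub>\<infinity>x\<in>{1..}. g x * (\<Sum>i=1..N x t \<omega>. T x i \<omega>))"

definition k_visits ::
  "(nat \<Rightarrow> real) \<Rightarrow> (nat \<Rightarrow> real \<Rightarrow> 'b \<Rightarrow> nat) \<Rightarrow> (nat \<Rightarrow> nat \<Rightarrow> 'b \<Rightarrow> real) \<Rightarrow> 'b \<Rightarrow> real \<Rightarrow> nat \<Rightarrow> bool" where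
  "k_visits g N T \<omega> t x \<longleftrightarrow> x \<ge> 1 \<and>
     (\<exists>j\<ge>1. Lim (at_left (event_time (N x) j \<omega>)) (k_clock g N T \<omega>) \<le> t \<and>
            t < k_clock g N T \<omega> (event_time (N x) j \<omega>))"

text \<open>Almost surely at most one \<open>x\<close> is visited at any given time, so the choice below is unique.\<close>

definition k_process ::
  "(nat \<Rightarrow> real) \<Rightarrow> (nat \<Rightarrow> real \<Rightarrow> 'b \<Rightarrow> nat) \<Rightarrow> (nat \<Rightarrow> nat \<Rightarrow> 'b \<Rightarrow> real) \<Rightarrow> 'b \<Rightarrow> real \<Rightarrow> enat" where
  "k_process g N T \<omega> t =
     (if \<exists>x. k_visits g N T \<omega> t x then enat (THE x. k_visits g N T \<omega> t x) else \<infinity>)"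

text \<open>
  The quenched probability that the process is constant on \<open>[t, t + \<theta> t]\<close>. The completion of \<open>P\<close>
  is used because the event refers to uncountably many times and the path properties of the driving
  processes hold only up to null sets; \<^const>\<open>measure\<close> is \<open>0\<close> on sets outside the sigma-algebra.
\<close>

definition no_jump_prob ::
  "'b measure \<Rightarrow> (nat \<Rightarrow> real \<Rightarrow> 'b \<Rightarrow> nat) \<Rightarrow> (nat \<Rightarrow> nat \<Rightarrow> 'b \<Rightarrow> real) \<Rightarrow>
   (nat \<Rightarrow> real) \<Rightarrow> real \<Rightarrow> real \<Rightarrow> real" where
  "no_jump_prob P N T g t \<theta> =
     measure (completion P)
       {\<omega> \<in> space P. \<forall>s\<in>{t..t + \<theta> * t}. k_process g N T \<omega> s = k_process g N T \<omega> t}"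

definition arcsine_limit :: "real \<Rightarrow> real \<Rightarrow> real" where
  "arcsine_limit \<alpha> \<theta> =
     sin (pi * \<alpha>) / pi *
     (LINT s:{\<theta> / (1 + \<theta>)..1}|lborel. s powr (- \<alpha>) * (1 - s) powr (\<alpha> - 1))"

end

theory Submission
  imports Defs "HOL-Real_Asymp.Real_Asymp"
begin

text \<open>
  Given the weights \<open>g\<close>, the clock of the K-process is a driftless subordinator: for every state \<open>x\<close> it
  jumps at rate 1 by an exponential variable of mean \<open>g x\<close>, and each jump is one visit. The process
  is constant on \<open>[t,t']\<close>, up to a null set, if and only if a single jump of the clock passes over
  this interval: between two visits other visits take place, and the times outside all visits form
  a Lebesgue null set (\<open>constant_iff_single_excursion\<close>). Summing over the visits to \<open>x\<close> that may cover the
  interval, the probability becomes the integral over \<open>r \<le> t\<close> of the Levy tail at \<open>t' - r\<close> with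
  respect to the potential measure of the clock (\<open>straddle_suminf\<close>). The visits to any \<open>x\<close> have the
  same potential measure, because its Laplace transform is always the reciprocal of the Laplace
  exponent \<open>\<psi>\<close> (\<open>laplace_before_suminf\<close>, \<open>laplace_unique\<close>).

  The limit is then that of Dynkin and Lamperti. If the number of weights above \<open>u\<close> is asymptotic to
  \<open>u powr (-\<alpha>)\<close> as \<open>u\<close> tends to 0, then the Levy tail at \<open>y\<close> is asymptotic to \<open>\<Gamma>(1+\<alpha>) y powr (-\<alpha>)\<close> and
  \<open>\<psi>(l)\<close> is asymptotic to \<open>\<Gamma>(1+\<alpha>) \<Gamma>(1-\<alpha>) l powr \<alpha>\<close> for large \<open>l\<close> (\<open>levy_tail_limit\<close>,
  \<open>laplace_exponent_limit\<close>). Hence the rescaled potential measures converge to a multiple of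
  \<open>x powr (\<alpha> - 1) dx\<close>. The Tauberian step (\<open>laplace_continuity\<close>) is reduced to Levy's continuity theorem:
  after the substitution \<open>x \<mapsto> exp (-x)\<close>, Laplace transforms at integers are moments of a law on
  \<open>(0,1]\<close>. Integrating the limit of the rescaled tail against the limit measure gives the arcsine law.

  It remains to see that the environment has the required asymptotics almost surely
  (\<open>AE_regular_weights\<close>). Divide \<open>(0,1]\<close> into dyadic intervals. By Levy's continuity theorem, applied
  after weighting with a function that vanishes at 0, the tail of the law of an increment over a
  time \<open>h\<close> is asymptotic to \<open>h u powr (-\<alpha>)\<close> (\<open>stable_small_time_tail\<close>). So the number of increments above
  \<open>u\<close> has mean close to \<open>u powr (-\<alpha>)\<close> and a variance of at most that order, and on a fine grid it equals the
  number of jumps above \<open>u\<close>, up to jumps of size exactly \<open>u\<close>. Chebyshev's inequality and the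
  Borel--Cantelli lemma along a sequence of \<open>u\<close> with mean number \<open>(k + 1)^2\<close>, together with monotonicity
  in \<open>u\<close>, give the law of large numbers.
\<close>

section \<open>Laplace transforms determine measures on the half-line\<close>

text \<open>
  On \<open>[0,1]\<close> all moments are at most 1, so the Taylor error of the characteristic function is small
  uniformly in the distribution.
\<close>

lemma (in real_distribution) char_moment_expansion:
  assumes unit: "AE x in M. 0 \<le> x \<and> x \<le> 1"
  shows "norm (char M t - (\<Sum>k\<le>n. ((\<i> * t) ^ k / fact k) * expectation (\<lambda>x. x ^ k)))
           \<le> 2 * \<bar>t\<bar> ^ n / fact n"
proof -
  have le_1: "AE x in M. \<bar>x\<bar> ^ k \<le> 1" for k
    using unit by eventually_elim (simp add: power_le_one)
  then have int: "integrable M (\<lambda>x. x ^ k)" for k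
    by (intro integrable_const_bound[where B = 1]) (auto simp: power_abs)
  have "expectation (\<lambda>x. \<bar>x\<bar> ^ n) \<le> expectation (\<lambda>_. 1)"
    by (rule integral_mono_AE)
       (use le_1 int[of n] in \<open>auto simp: power_abs[symmetric]\<close>)
  then have "(2 * \<bar>t\<bar> ^ n / fact n) * expectation (\<lambda>x. \<bar>x\<bar> ^ n) \<le> (2 * \<bar>t\<bar> ^ n / fact n) * 1"
    by (intro mult_left_mono) (use prob_space in auto)
  with char_approx1[of n t, OF int] show ?thesis
    by linarith
qed

text \<open>
  The method of moments on \<open>[0,1]\<close>: there, a finite number of moments determines the characteristic
  function at \<open>t\<close> up to an error that depends on \<open>t\<close> only.
\<close>

lemma char_tendsto_of_moments:
  fixes \<mu> :: "nat \<Rightarrow> real measure"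
  assumes "\<And>n. real_distribution (\<mu> n)" and "real_distribution \<nu>"
    and unit: "\<And>n. AE x in \<mu> n. 0 \<le> x \<and> x \<le> 1" "AE x in \<nu>. 0 \<le> x \<and> x \<le> 1"
    and moments: "\<And>k. (\<lambda>n. LINT x|\<mu> n. x ^ k) \<longlonglongrightarrow> (LINT x|\<nu>. x ^ k)"
  shows "(\<lambda>n. char (\<mu> n) t) \<longlonglongrightarrow> char \<nu> t"
proof (rule metric_LIMSEQ_I)
  fix e :: real assume "0 < e"
  have "(\<lambda>j. 2 * \<bar>t\<bar> ^ j / fact j) \<longlonglongrightarrow> 0"
    using tendsto_mult_right[OF summable_LIMSEQ_zero[OF summable_exp[of "\<bar>t\<bar>"]], of 2]
    by (simp add: divide_inverse mult_ac)
  from order_tendstoD(2)[OF this, of "e / 3"] \<open>0 < e\<close>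
  obtain j where j: "2 * \<bar>t\<bar> ^ j / fact j < e / 3"
    by (auto simp: eventually_sequentially)
  let ?p = "\<lambda>\<kappa>::real measure. (\<Sum>k\<le>j. ((\<i> * t) ^ k / fact k) * complex_of_real (LINT x|\<kappa>. x ^ k))"
  have "(\<lambda>n. ?p (\<mu> n)) \<longlonglongrightarrow> ?p \<nu>"
    by (intro tendsto_intros moments)
  from metric_LIMSEQ_D[OF this, of "e / 3"] \<open>0 < e\<close>
  obtain n0 where n0: "\<And>n. n \<ge> n0 \<Longrightarrow> dist (?p (\<mu> n)) (?p \<nu>) < e / 3" by auto
  have "dist (char (\<mu> n) t) (char \<nu> t) < e" if "n \<ge> n0" for n
  proof -
    have "dist (char (\<mu> n) t) (?p (\<mu> n)) < e / 3" "dist (char \<nu> t) (?p \<nu>) < e / 3"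
      using real_distribution.char_moment_expansion[OF assms(1) unit(1), of n t j]
        real_distribution.char_moment_expansion[OF assms(2) unit(2), of t j] j
      by (auto simp: dist_norm)
    with n0[OF that] show ?thesis
      using dist_triangle_third[of "char (\<mu> n) t" "?p (\<mu> n)" e "?p \<nu>" "char \<nu> t"]
      by (simp only: dist_commute)
  qed
  then show "\<exists>n0. \<forall>n\<ge>n0. dist (char (\<mu> n) t) (char \<nu> t) < e" by blast
qed

text \<open>
  Laplace transforms at integers are moments in disguise. Weighting \<open>\<mu>\<close> by \<open>exp (-x)\<close>, normalising, and
  mapping \<open>x\<close> to \<open>exp (-x)\<close> gives a probability measure on \<open>(0,1]\<close> whose \<open>k\<close>-th moment is a quotient of
  Laplace transforms at \<open>k + 1\<close> and at \<open>1\<close>.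
\<close>

definition exp_tilt :: "real measure \<Rightarrow> real measure" where
  "exp_tilt \<mu> = distr (density \<mu> (\<lambda>x. ennreal (exp (- x)) / (\<integral>\<^sup>+ x. ennreal (exp (- x)) \<partial>\<mu>)))
     borel (\<lambda>x. exp (- x))"

text \<open>
  The total mass may be infinite, as it is for potential measures; only the transforms at
  \<open>1, 2, 3, \<dots>\<close> have to be finite.
\<close>

locale laplace_measure =
  fixes \<mu> :: "real measure" and L :: "nat \<Rightarrow> real"
  assumes sets_mu [measurable_cong]: "sets \<mu> = sets borel"
    and nonneg_AE: "AE x in \<mu>. 0 \<le> x"
    and laplace: "\<And>k. 1 \<le> k \<Longrightarrow> (\<integral>\<^sup>+ x. ennreal (exp (- real k * x)) \<partial>\<mu>) = ennreal (L k)"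
    and L_pos: "\<And>k. 1 \<le> k \<Longrightarrow> 0 < L k"
begin

lemma space_mu: "space \<mu> = UNIV"
  using sets_eq_imp_space_eq[OF sets_mu] by simp

lemma exp_tilt_eq: "exp_tilt \<mu> = distr (density \<mu> (\<lambda>x. ennreal (exp (- x) / L 1))) borel (\<lambda>x. exp (- x))"
  using laplace[of 1] L_pos[of 1] by (simp add: exp_tilt_def divide_ennreal)

lemma nn_integral_exp_tilt:
  assumes [measurable]: "f \<in> borel_measurable borel"
  shows "(\<integral>\<^sup>+ y. f y \<partial>exp_tilt \<mu>) = (\<integral>\<^sup>+ x. ennreal (exp (- x) / L 1) * f (exp (- x)) \<partial>\<mu>)"
  unfolding exp_tilt_eq by (simp add: nn_integral_distr nn_integral_density)

lemma integral_exp_tilt: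
  fixes f :: "real \<Rightarrow> real"
  assumes [measurable]: "f \<in> borel_measurable borel"
  shows "(LINT y|exp_tilt \<mu>. f y) = (LINT x|\<mu>. exp (- x) * f (exp (- x))) / L 1"
  unfolding exp_tilt_eq using L_pos[of 1]
  by (simp add: integral_distr integral_density)

lemma real_distribution_exp_tilt: "real_distribution (exp_tilt \<mu>)"
proof -
  have "emeasure (exp_tilt \<mu>) (space (exp_tilt \<mu>)) = (\<integral>\<^sup>+ y. 1 \<partial>exp_tilt \<mu>)" by simp
  also have "\<dots> = (\<integral>\<^sup>+ x. ennreal (exp (- x) / L 1) \<partial>\<mu>)"
    by (subst nn_integral_exp_tilt) auto
  also have "\<dots> = (\<integral>\<^sup>+ x. ennreal (exp (- x)) / ennreal (L 1) \<partial>\<mu>)"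
    using L_pos[of 1] by (simp add: divide_ennreal)
  also have "\<dots> = (\<integral>\<^sup>+ x. ennreal (exp (- x)) \<partial>\<mu>) / ennreal (L 1)"
    by (rule nn_integral_divide) simp
  also have "\<dots> = 1"
    using laplace[of 1] L_pos[of 1] by (simp add: ennreal_divide_self)
  finally have "prob_space (exp_tilt \<mu>)" by (rule prob_spaceI)
  then interpret prob_space "exp_tilt \<mu>" .
  show ?thesis by unfold_locales (simp_all add: exp_tilt_eq)
qed

lemma exp_tilt_AE: "AE y in exp_tilt \<mu>. 0 < y \<and> y \<le> 1"
  unfolding exp_tilt_eq
  using nonneg_AE by (subst AE_distr_iff; simp add: AE_density) (auto elim!: eventually_mono)

lemma exp_tilt_moment: "(LINT y|exp_tilt \<mu>. y ^ k) = L (Suc k) / L 1"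
proof -
  have "(LINT x|\<mu>. exp (- x) * exp (- x) ^ k) = (LINT x|\<mu>. exp (- real (Suc k) * x))"
    by (intro Bochner_Integration.integral_cong) (auto simp: exp_of_nat_mult[symmetric] exp_add[symmetric] algebra_simps)
  also have "\<dots> = L (Suc k)"
    using L_pos[of "Suc k"] laplace[of "Suc k"] by (subst integral_eq_nn_integral) auto
  finally show ?thesis by (simp add: integral_exp_tilt)
qed

end

lemma char_exp_tilt_tendsto:
  assumes "\<And>n. laplace_measure (\<mu> n) (L n)" and "laplace_measure \<nu> L'"
    and "\<And>k. 1 \<le> k \<Longrightarrow> (\<lambda>n. L n k) \<longlonglongrightarrow> L' k"
  shows "(\<lambda>n. char (exp_tilt (\<mu> n)) t) \<longlonglongrightarrow> char (exp_tilt \<nu>) t"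
proof (rule char_tendsto_of_moments)
  show "(\<lambda>n. LINT x|exp_tilt (\<mu> n). x ^ k) \<longlonglongrightarrow> (LINT x|exp_tilt \<nu>. x ^ k)" for k
    using laplace_measure.exp_tilt_moment[OF assms(1)] laplace_measure.exp_tilt_moment[OF assms(2)]
      laplace_measure.L_pos[OF assms(2), of 1]
    by (auto intro!: tendsto_divide assms(3))
  have "AE x in exp_tilt \<kappa>. 0 \<le> x \<and> x \<le> 1" if "laplace_measure \<kappa> K" for \<kappa> K
    using laplace_measure.exp_tilt_AE[OF that] by eventually_elim simp
  then show "AE x in exp_tilt (\<mu> n). 0 \<le> x \<and> x \<le> 1" "AE x in exp_tilt \<nu>. 0 \<le> x \<and> x \<le> 1" for n
    using assms(1,2) by blast+
qed (use laplace_measure.real_distribution_exp_tilt assms(1,2) in blast)+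

text \<open>
  Equal transforms give equal moments of the tilted measures, and the tilt can be undone because its
  density and its change of variables are invertible.
\<close>

lemma laplace_unique:
  assumes "laplace_measure \<mu> L" "laplace_measure \<nu> L"
  shows "\<mu> = \<nu>"
proof (rule measure_eqI)
  interpret mu: laplace_measure \<mu> L by fact
  interpret nu: laplace_measure \<nu> L by fact
  have "char (exp_tilt \<mu>) t = char (exp_tilt \<nu>) t" for t
    using char_exp_tilt_tendsto[OF assms(1) assms(2), of t] by (simp add: LIMSEQ_const_iff)
  then have eq: "exp_tilt \<mu> = exp_tilt \<nu>"
    by (intro Levy_uniqueness mu.real_distribution_exp_tilt nu.real_distribution_exp_tilt) auto
  show "sets \<mu> = sets \<nu>" by (simp add: mu.sets_mu nu.sets_mu)
  fix A assume "A \<in> sets \<mu>"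
  then have A [measurable]: "A \<in> sets borel" by (simp add: mu.sets_mu)
  have *: "emeasure \<kappa> A = (\<integral>\<^sup>+ y. ennreal (L 1 / y) * indicator {0<..} y * indicator A (- ln y) \<partial>exp_tilt \<kappa>)"
    if "laplace_measure \<kappa> L" for \<kappa>
  proof -
    interpret laplace_measure \<kappa> L by fact
    have [measurable]: "A \<in> sets \<kappa>" by (simp add: sets_mu)
    have "emeasure \<kappa> A = (\<integral>\<^sup>+ x. indicator A x \<partial>\<kappa>)"
      by simp
    also have "\<dots> = (\<integral>\<^sup>+ x. ennreal (exp (- x) / L 1) * (ennreal (L 1 / exp (- x)) *
        indicator {0<..} (exp (- x)) * indicator A (- ln (exp (- x)))) \<partial>\<kappa>)"
      using L_pos[of 1]
      by (intro nn_integral_cong) (auto simp: ennreal_mult[symmetric] split: split_indicator)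
    also have "\<dots> = (\<integral>\<^sup>+ y. ennreal (L 1 / y) * indicator {0<..} y * indicator A (- ln y) \<partial>exp_tilt \<kappa>)"
      by (subst nn_integral_exp_tilt) (auto simp: mult.assoc)
    finally show ?thesis .
  qed
  show "emeasure \<mu> A = emeasure \<nu> A"
    using *[OF assms(1)] *[OF assms(2)] eq by simp
qed

text \<open>
  The Tauberian step: the tilted measures converge weakly, and \<open>exp (-x) * h x\<close> is the tilt density
  times a bounded function.
\<close>

lemma laplace_continuity:
  assumes lm: "\<And>n. laplace_measure (\<mu> n) (L n)" and ln: "laplace_measure \<nu> L'"
    and lim: "\<And>k. 1 \<le> k \<Longrightarrow> (\<lambda>n. L n k) \<longlonglongrightarrow> L' k"
    and h [measurable]: "h \<in> borel_measurable borel"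
    and bounded: "\<And>x. \<bar>h x\<bar> \<le> B" and cont: "AE x in \<nu>. isCont h x"
  shows "(\<lambda>n. LINT x|\<mu> n. exp (- x) * h x) \<longlonglongrightarrow> (LINT x|\<nu>. exp (- x) * h x)"
proof -
  interpret nu: laplace_measure \<nu> L' by fact
  define f where "f y = (if 0 < y then h (- ln y) else 0)" for y :: real
  have [measurable]: "f \<in> borel_measurable borel" unfolding f_def by measurable
  have "AE x in \<nu>. isCont f (exp (- x))"
    using cont
  proof (rule eventually_mono)
    fix x :: real assume "isCont h x"
    then have "isCont (\<lambda>y. h (- ln y)) (exp (- x))"
      by (intro isCont_o2[where g = h and f = "\<lambda>y. - ln y"] continuous_intros) auto
    moreover have "\<forall>\<^sub>F y in nhds (exp (- x)). f y = h (- ln y)"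
      using eventually_nhds_in_open[of "{0<..}" "exp (- x)"] by (auto simp: f_def elim!: eventually_mono)
    ultimately show "isCont f (exp (- x))"
      by (simp add: isCont_cong)
  qed
  moreover have "{y. isCont f y} \<in> sets borel"
    by (rule isCont_borel)
  ultimately have ae: "AE y in exp_tilt \<nu>. isCont f y"
    unfolding nu.exp_tilt_eq
    by (subst AE_distr_iff) (auto simp: AE_density nu.space_mu elim!: eventually_mono)
  have "emeasure (exp_tilt \<nu>) {y. \<not> isCont f y} = 0"
    using ae AE_iff_measurable[of "{y. \<not> isCont f y}" "exp_tilt \<nu>" "isCont f"]
    by (simp add: nu.exp_tilt_eq)
  then have conv: "(\<lambda>n. LINT y|exp_tilt (\<mu> n). f y) \<longlonglongrightarrow> (LINT y|exp_tilt \<nu>. f y)"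
    using order_trans[OF bounded abs_ge_self]
    by (intro weak_conv_imp_bdd_ae_continuous_conv[where B = "\<bar>B\<bar>"]
         levy_continuity laplace_measure.real_distribution_exp_tilt[OF lm]
         nu.real_distribution_exp_tilt char_exp_tilt_tendsto[OF lm ln] lim) (simp_all, simp add: f_def)
  have tilt: "(LINT x|\<kappa>. exp (- x) * h x) = K 1 * (LINT y|exp_tilt \<kappa>. f y)"
    if "laplace_measure \<kappa> K" for \<kappa> K
    using laplace_measure.integral_exp_tilt[OF that, of f] laplace_measure.L_pos[OF that, of 1]
    by (simp add: f_def)
  show ?thesis
    unfolding tilt[OF lm] tilt[OF ln] by (intro tendsto_mult lim conv) auto
qed

section \<open>Weights with regularly varying counts\<close>

lemma nn_integral_Gamma_scaled:
  assumes "0 < a" "0 < c"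
  shows "(\<integral>\<^sup>+ s. indicator {0<..} s * ennreal (s powr (a - 1) * exp (- (c * s))) \<partial>lborel)
           = ennreal (Gamma a * c powr (- a))"
proof -
  have "(\<integral>\<^sup>+ s. indicator {0<..} s * ennreal (s powr (a - 1) * exp (- (c * s))) \<partial>lborel)
      = (\<integral>\<^sup>+ t. ennreal (c powr (- a)) * (ennreal (indicator {0..} t * t powr (a - 1) / exp t)) \<partial>lborel)"
  proof (subst nn_integral_real_affine[where c = "1 / c" and t = 0])
    have "ennreal \<bar>1 / c\<bar> * (indicator {0<..} (0 + 1 / c * t) *
        ennreal ((0 + 1 / c * t) powr (a - 1) * exp (- (c * (0 + 1 / c * t)))))
      = ennreal (c powr (- a)) * ennreal (indicator {0..} t * t powr (a - 1) / exp t)"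
      if "t \<noteq> 0" for t
    proof (cases "0 < t")
      case True
      with assms have "1 / c * ((1 / c * t) powr (a - 1)) = c powr (- a) * t powr (a - 1)"
        by (simp add: powr_divide powr_diff powr_minus field_simps)
      with True assms show ?thesis
        by (simp add: ennreal_mult[symmetric] exp_minus divide_inverse mult.assoc[symmetric])
    qed (use that assms in \<open>simp add: zero_less_divide_iff indicator_def\<close>)
    then have "AE t in lborel. ennreal \<bar>1 / c\<bar> * (indicator {0<..} (0 + 1 / c * t) *
        ennreal ((0 + 1 / c * t) powr (a - 1) * exp (- (c * (0 + 1 / c * t)))))
      = ennreal (c powr (- a)) * ennreal (indicator {0..} t * t powr (a - 1) / exp t)"
      using AE_lborel_singleton[of "0::real"] by (auto elim!: eventually_mono)
    then show "ennreal \<bar>1 / c\<bar> * (\<integral>\<^sup>+ t. indicator {0<..} (0 + 1 / c * t) *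
        ennreal ((0 + 1 / c * t) powr (a - 1) * exp (- (c * (0 + 1 / c * t)))) \<partial>lborel)
      = (\<integral>\<^sup>+ t. ennreal (c powr (- a)) * ennreal (indicator {0..} t * t powr (a - 1) / exp t) \<partial>lborel)"
      by (subst nn_integral_cmult[symmetric]) (auto intro!: nn_integral_cong_AE)
  qed (use assms in auto)
  also have "\<dots> = ennreal (c powr (- a)) * ennreal (Gamma a)"
    using assms by (subst nn_integral_cmult) (auto simp: Gamma_conv_nn_integral_real)
  finally show ?thesis
    using assms by (simp add: ennreal_mult Gamma_real_nonneg mult.commute)
qed

lemma nn_integral_exp_Ioi:
  "0 < c \<Longrightarrow> (\<integral>\<^sup>+ s. indicator {0<..} s * ennreal (exp (- (c * s))) \<partial>lborel) = ennreal (1 / c)"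
proof -
  assume "0 < c"
  have "(\<integral>\<^sup>+ s. indicator {0<..} s * ennreal (exp (- (c * s))) \<partial>lborel)
      = (\<integral>\<^sup>+ s. indicator {0<..} s * ennreal (s powr (1 - 1) * exp (- (c * s))) \<partial>lborel)"
    by (intro nn_integral_cong) (auto split: split_indicator)
  with nn_integral_Gamma_scaled[of 1 c] \<open>0 < c\<close> show ?thesis
    by (simp add: powr_minus divide_inverse)
qed

text \<open>
  What the proof uses of the environment: the number of weights above \<open>u\<close> is asymptotic to
  \<open>u powr (-\<alpha>)\<close>. The definitions below describe the clock, a driftless subordinator that jumps at
  rate 1 by an exponential variable of mean \<open>g x\<close>, for every \<open>x\<close>. Its Levy measure gives
  \<open>{y<..}\<close> the mass \<open>levy_tail y\<close>, and \<open>laplace_exponent\<close> is its Laplace exponent.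
\<close>

locale regular_weights =
  fixes g :: "nat \<Rightarrow> real" and \<alpha> :: real
  assumes alpha: "0 < \<alpha>" "\<alpha> < 1"
    and pos: "\<And>i. 1 \<le> i \<Longrightarrow> 0 < g i"
    and summable: "summable (\<lambda>i. g (Suc i))"
    and finite_above: "\<And>u. 0 < u \<Longrightarrow> finite {i. 1 \<le> i \<and> u < g i}"
    and count_limit: "((\<lambda>u. u powr \<alpha> * card {i. 1 \<le> i \<and> u < g i}) \<longlongrightarrow> 1) (at_right 0)"
begin

definition count_above :: "real \<Rightarrow> ennreal" where
  "count_above u = (\<Sum>i. indicator {u<..} (g (Suc i)))"

definition levy_tail :: "real \<Rightarrow> ennreal" where
  "levy_tail y = (\<Sum>i. ennreal (exp (- (y / g (Suc i)))))"

definition laplace_exponent :: "real \<Rightarrow> ennreal" where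
  "laplace_exponent l = (\<Sum>i. ennreal (l * g (Suc i) / (1 + l * g (Suc i))))"

lemma g_Suc_pos [simp]: "0 < g (Suc i)" "g (Suc i) \<noteq> 0" "0 \<le> g (Suc i)"
  using pos[of "Suc i"] by auto

lemma measurable_count_above [measurable]: "count_above \<in> borel_measurable borel"
proof -
  have "(\<lambda>u. \<Sum>i. indicator {u<..} (g (Suc i)) :: ennreal) = (\<lambda>u. \<Sum>i. indicator {..<g (Suc i)} u)"
    by (auto simp: indicator_def)
  then show ?thesis unfolding count_above_def[abs_def] by simp
qed

lemma measurable_levy_tail [measurable]: "levy_tail \<in> borel_measurable borel"
  unfolding levy_tail_def[abs_def] by measurable

lemma count_above_eq_card:
  assumes "0 < u" shows "count_above u = of_nat (card {i. 1 \<le> i \<and> u < g i})"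
proof -
  have "count_above u = (\<Sum>i. indicator {i. u < g (Suc i)} i)"
    unfolding count_above_def by (intro suminf_cong) (auto simp: indicator_def)
  also have "\<dots> = emeasure (count_space UNIV) {i. u < g (Suc i)}"
    by (subst nn_integral_count_space_nat[symmetric]) (simp add: nn_integral_indicator)
  also have "\<dots> = of_nat (card {i. u < g (Suc i)})"
    using finite_vimageI[OF finite_above[OF assms] inj_Suc] by (simp add: vimage_def)
  also have "card {i. u < g (Suc i)} = card (Suc ` {i. u < g (Suc i)})"
    by (simp add: card_image)
  also have "Suc ` {i. u < g (Suc i)} = {i. 1 \<le> i \<and> u < g i}"
    by (auto simp: Suc_le_eq gr0_conv_Suc)
  finally show ?thesis .
qed

lemma count_above_limit: "((\<lambda>u. ennreal (u powr \<alpha>) * count_above u) \<longlongrightarrow> 1) (at_right 0)"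
proof -
  have "((\<lambda>u. ennreal (u powr \<alpha> * card {i. 1 \<le> i \<and> u < g i})) \<longlongrightarrow> ennreal 1) (at_right 0)"
    by (intro tendsto_ennrealI count_limit)
  moreover have "\<forall>\<^sub>F u in at_right 0. ennreal (u powr \<alpha> * card {i. 1 \<le> i \<and> u < g i}) = ennreal (u powr \<alpha>) * count_above u"
    by (auto simp: eventually_at_right_field count_above_eq_card ennreal_mult ennreal_of_nat_eq_real_of_nat
         intro!: exI[of _ 1])
  ultimately show ?thesis
    using Lim_transform_eventually by fastforce
qed

text \<open>
  Near 0 the scaled count is close to 1, and it vanishes above the largest weight. The bound is the
  dominating function in the limits below.
\<close>

lemma count_above_bound:
  obtains C where "0 \<le> C" "\<And>u. 0 < u \<Longrightarrow> ennreal (u powr \<alpha>) * count_above u \<le> ennreal C"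
proof -
  have "\<forall>\<^sub>F u in at_right 0. u powr \<alpha> * card {i. 1 \<le> i \<and> u < g i} < 2"
    by (rule order_tendstoD(2)[OF count_limit]) simp
  then obtain d :: real where d: "0 < d"
    "\<And>u. 0 < u \<Longrightarrow> u < d \<Longrightarrow> u powr \<alpha> * card {i. 1 \<le> i \<and> u < g i} < 2"
    by (auto simp: eventually_at_right_field)
  define B where "B = Max (insert d (g ` {i. 1 \<le> i \<and> d / 2 < g i}))"
  define C where "C = max 2 (B powr \<alpha> * card {i. 1 \<le> i \<and> d / 2 < g i})"
  have fin: "finite {i. 1 \<le> i \<and> d / 2 < g i}" by (rule finite_above) (use d(1) in simp)
  have B: "d \<le> B" "\<And>i. 1 \<le> i \<Longrightarrow> d / 2 < g i \<Longrightarrow> g i \<le> B"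
    unfolding B_def using fin by auto
  have "u powr \<alpha> * card {i. 1 \<le> i \<and> u < g i} \<le> C" if "0 < u" for u
  proof (cases "u < d")
    case True with d(2)[OF that] show ?thesis unfolding C_def by linarith
  next
    case False
    show ?thesis
    proof (cases "{i. 1 \<le> i \<and> u < g i} = {}")
      case True then show ?thesis unfolding C_def by (simp only: True card.empty)
    next
      case False
      then obtain i where i: "1 \<le> i" "u < g i" by auto
      with \<open>\<not> u < d\<close> d(1) have "u \<le> B" using B(2)[of i] by auto
      moreover have "card {i. 1 \<le> i \<and> u < g i} \<le> card {i. 1 \<le> i \<and> d / 2 < g i}"
        using \<open>\<not> u < d\<close> d(1) by (intro card_mono fin) auto
      ultimately have "u powr \<alpha> * card {i. 1 \<le> i \<and> u < g i} \<le> B powr \<alpha> * card {i. 1 \<le> i \<and> d / 2 < g i}"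
        using that alpha by (intro mult_mono powr_mono2) auto
      then show ?thesis by (simp add: C_def)
    qed
  qed
  then show ?thesis
    using that[of C]
    by (auto simp: C_def count_above_eq_card ennreal_of_nat_eq_real_of_nat ennreal_mult[symmetric] intro!: ennreal_leI)
qed

text \<open>
  Layer-cake formula: \<open>exp (-y/x)\<close> is the mass that the exponential law gives to
  \<open>{s. y / s < x}\<close>.
\<close>

lemma levy_tail_eq:
  assumes "0 < y"
  shows "levy_tail y = (\<integral>\<^sup>+ s. indicator {0<..} s * ennreal (exp (- s)) * count_above (y / s) \<partial>lborel)"
proof -
  have *: "ennreal (exp (- (y / x))) = (\<integral>\<^sup>+ s. indicator {0<..} s * ennreal (exp (- s)) * indicator {y / s<..} x \<partial>lborel)"
    if "0 < x" for x
  proof -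
    have "(\<integral>\<^sup>+ s. indicator {0<..} s * ennreal (exp (- s)) * indicator {y / s<..} x \<partial>lborel)
      = (\<integral>\<^sup>+ s. ennreal (exp (- s)) * indicator {y / x<..} s \<partial>lborel)"
      using assms that
      by (intro nn_integral_cong)
         (auto simp: indicator_def field_simps zero_less_mult_iff dest: less_trans[of 0 y])
    also have "\<dots> = (\<integral>\<^sup>+ s. ennreal (exp (- (y / x))) * (indicator {0<..} s * ennreal (exp (- s))) \<partial>lborel)"
      by (subst nn_integral_real_affine[where c = 1 and t = "y / x"])
         (auto simp: ennreal_mult[symmetric] exp_add[symmetric] indicator_def intro!: nn_integral_cong)
    also have "\<dots> = ennreal (exp (- (y / x)))"
      using nn_integral_exp_Ioi[of 1] by (simp add: nn_integral_cmult)
    finally show ?thesis ..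
  qed
  have [measurable]: "(\<lambda>s. indicator {y / s<..} x :: ennreal) \<in> borel_measurable borel" for x
  proof -
    have "(\<lambda>s. indicator {y / s<..} x :: ennreal) = (\<lambda>s. indicator {s. y / s < x} s)" by (auto simp: indicator_def)
    then show ?thesis by simp
  qed
  show ?thesis
    unfolding levy_tail_def count_above_def *[OF g_Suc_pos(1)]
    by (subst nn_integral_suminf[symmetric]) (auto simp: ennreal_suminf_cmult)
qed

text \<open>
  \<open>l x / (1 + l x)\<close> is the probability that an exponential variable of mean \<open>x\<close> exceeds an
  independent one of mean \<open>1/l\<close>; integrate out the latter, rescaled to mean 1.
\<close>

lemma laplace_exponent_eq:
  assumes "0 < l"
  shows "laplace_exponent l = (\<integral>\<^sup>+ s. indicator {0<..} s * ennreal (exp (- s)) * levy_tail (s / l) \<partial>lborel)"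
proof -
  have *: "ennreal (l * x / (1 + l * x)) = (\<integral>\<^sup>+ s. indicator {0<..} s * ennreal (exp (- s)) * ennreal (exp (- (s / l / x))) \<partial>lborel)"
    if "0 < x" for x
  proof -
    have "0 < 1 + 1 / (l * x)" using that assms by (simp add: add_pos_pos)
    then have "(\<integral>\<^sup>+ s. indicator {0<..} s * ennreal (exp (- ((1 + 1 / (l * x)) * s))) \<partial>lborel) = ennreal (1 / (1 + 1 / (l * x)))"
      by (rule nn_integral_exp_Ioi)
    also have "1 / (1 + 1 / (l * x)) = l * x / (1 + l * x)"
      using that assms by (simp add: field_simps)
    finally show ?thesis
      by (simp add: mult.assoc ennreal_mult[symmetric] exp_add[symmetric] distrib_right)
  qed
  show ?thesis
    unfolding laplace_exponent_def levy_tail_def *[OF g_Suc_pos(1)]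
    by (subst nn_integral_suminf[symmetric]) (auto simp: ennreal_suminf_cmult)
qed

text \<open>
  Both formulas above are averages of a function \<open>F\<close> at \<open>y * s powr b\<close>, for an exponential \<open>s\<close>
  and \<open>b = -1\<close> or \<open>b = 1\<close>. Asymptotics \<open>F u \<sim> c * u powr (-\<alpha>)\<close> pass through such an average and pick up a
  Gamma factor, by dominated convergence. The first average leads from the counts to the Levy tail
  and the second from the Levy tail to the Laplace exponent.
\<close>

lemma exp_mixture_scaled:
  assumes F [measurable]: "F \<in> borel_measurable borel" and y: "0 < y"
  shows "ennreal (y powr \<alpha>) * (\<integral>\<^sup>+ s. indicator {0<..} s * ennreal (exp (- s)) * F (y * s powr b) \<partial>lborel)
    = (\<integral>\<^sup>+ s. indicator {0<..} s * ennreal (s powr (- (\<alpha> * b)) * exp (- s)) * (ennreal ((y * s powr b) powr \<alpha>) * F (y * s powr b)) \<partial>lborel)"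
proof -
  have "ennreal (y powr \<alpha>) * (indicator {0<..} s * ennreal (exp (- s)) * F (y * s powr b))
    = indicator {0<..} s * ennreal (s powr (- (\<alpha> * b)) * exp (- s)) * (ennreal ((y * s powr b) powr \<alpha>) * F (y * s powr b))" for s
  proof (cases "0 < s")
    case True
    have "y powr \<alpha> = s powr (- (\<alpha> * b)) * (y * s powr b) powr \<alpha>"
      using True y by (simp add: powr_mult powr_powr powr_minus mult.commute)
    with True show ?thesis by (simp add: ennreal_mult mult_ac)
  qed simp
  then show ?thesis by (subst nn_integral_cmult[symmetric]) simp_all
qed

lemma nn_integral_exp_mixture_weight:
  assumes "\<bar>b\<bar> \<le> 1"
  shows "(\<integral>\<^sup>+ s. indicator {0<..} s * ennreal (s powr (- (\<alpha> * b)) * exp (- s)) \<partial>lborel) = ennreal (Gamma (1 - \<alpha> * b))"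
proof -
  have "\<alpha> * b \<le> \<alpha> * 1" using assms alpha by (intro mult_left_mono) auto
  then have "\<alpha> * b < 1" using alpha by linarith
  then show ?thesis using nn_integral_Gamma_scaled[of "1 - \<alpha> * b" 1] alpha by simp
qed

lemma exp_mixture_bound:
  assumes F: "F \<in> borel_measurable borel" and b: "\<bar>b\<bar> \<le> 1"
    and C: "0 \<le> C" "\<And>u. 0 < u \<Longrightarrow> ennreal (u powr \<alpha>) * F u \<le> ennreal C" and y: "0 < y"
  shows "ennreal (y powr \<alpha>) * (\<integral>\<^sup>+ s. indicator {0<..} s * ennreal (exp (- s)) * F (y * s powr b) \<partial>lborel)
    \<le> ennreal C * ennreal (Gamma (1 - \<alpha> * b))"
proof -
  have "indicator {0<..} s * ennreal (s powr (- (\<alpha> * b)) * exp (- s)) * (ennreal ((y * s powr b) powr \<alpha>) * F (y * s powr b))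
      \<le> ennreal C * (indicator {0<..} s * ennreal (s powr (- (\<alpha> * b)) * exp (- s)))" for s
    using y unfolding mult.commute[of "ennreal C"]
    by (cases "0 < s") (auto intro!: mult_left_mono C(2))
  then show ?thesis
    unfolding exp_mixture_scaled[OF F y] nn_integral_exp_mixture_weight[OF b, symmetric]
    by (subst nn_integral_cmult[symmetric]) (auto intro!: nn_integral_mono)
qed

lemma at_right_0_sequentiallyI:
  fixes f :: "real \<Rightarrow> 'a::topological_space"
  assumes "\<And>Y. (\<And>n. 0 < Y n) \<Longrightarrow> Y \<longlonglongrightarrow> 0 \<Longrightarrow> (\<lambda>n. f (Y n)) \<longlonglongrightarrow> l"
  shows "(f \<longlongrightarrow> l) (at_right 0)"
  unfolding tendsto_at_iff_sequentially using assms by (auto simp: comp_def)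

lemma exp_mixture_limit:
  assumes F: "F \<in> borel_measurable borel" and b: "\<bar>b\<bar> \<le> 1"
    and C: "0 \<le> C" "\<And>u. 0 < u \<Longrightarrow> ennreal (u powr \<alpha>) * F u \<le> ennreal C"
    and lim: "((\<lambda>u. ennreal (u powr \<alpha>) * F u) \<longlongrightarrow> ennreal c) (at_right 0)"
  shows "((\<lambda>y. ennreal (y powr \<alpha>) * (\<integral>\<^sup>+ s. indicator {0<..} s * ennreal (exp (- s)) * F (y * s powr b) \<partial>lborel))
    \<longlongrightarrow> ennreal c * ennreal (Gamma (1 - \<alpha> * b))) (at_right 0)"
proof (rule at_right_0_sequentiallyI)
  fix Y :: "nat \<Rightarrow> real" assume Y: "\<And>n. 0 < Y n" "Y \<longlonglongrightarrow> 0"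
  define w where "w s = indicator {0<..} s * ennreal (s powr (- (\<alpha> * b)) * exp (- s))" for s :: real
  have [measurable]: "w \<in> borel_measurable lborel" "F \<in> borel_measurable borel"
    using F unfolding w_def[abs_def] by measurable
  have w: "(\<integral>\<^sup>+ s. w s \<partial>lborel) = ennreal (Gamma (1 - \<alpha> * b))"
    unfolding w_def by (rule nn_integral_exp_mixture_weight[OF b])
  have "(\<lambda>n. \<integral>\<^sup>+ s. w s * (ennreal ((Y n * s powr b) powr \<alpha>) * F (Y n * s powr b)) \<partial>lborel)
      \<longlonglongrightarrow> (\<integral>\<^sup>+ s. ennreal c * w s \<partial>lborel)"
  proof (rule nn_integral_dominated_convergence[where w = "\<lambda>s. ennreal C * w s"])
    show "AE s in lborel. w s * (ennreal ((Y n * s powr b) powr \<alpha>) * F (Y n * s powr b)) \<le> ennreal C * w s" for n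
    proof (rule AE_I2)
      fix s
      show "w s * (ennreal ((Y n * s powr b) powr \<alpha>) * F (Y n * s powr b)) \<le> ennreal C * w s"
        using Y(1)[of n] unfolding mult.commute[of "ennreal C"]
        by (cases "0 < s") (auto simp: w_def intro!: mult_left_mono C(2))
    qed
    show "AE s in lborel. (\<lambda>n. w s * (ennreal ((Y n * s powr b) powr \<alpha>) * F (Y n * s powr b))) \<longlonglongrightarrow> ennreal c * w s"
    proof (rule AE_I2)
      fix s
      show "(\<lambda>n. w s * (ennreal ((Y n * s powr b) powr \<alpha>) * F (Y n * s powr b))) \<longlonglongrightarrow> ennreal c * w s"
      proof (cases "0 < s")
        case True
        have "filterlim (\<lambda>n. Y n * s powr b) (at_right 0) sequentially"
          using tendsto_mult_left_zero[OF Y(2), of "s powr b"] Y(1) True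
          by (intro tendsto_imp_filterlim_at_right always_eventually allI mult_pos_pos) auto
        from filterlim_compose[OF lim this] show ?thesis
          unfolding mult.commute[of "ennreal c"] by (intro ennreal_tendsto_cmult) (use True in \<open>auto simp: w_def\<close>)
      qed (simp add: w_def)
    qed
  qed (auto simp: nn_integral_cmult w ennreal_mult_less_top)
  then show "(\<lambda>n. ennreal (Y n powr \<alpha>) * (\<integral>\<^sup>+ s. indicator {0<..} s * ennreal (exp (- s)) * F (Y n * s powr b) \<partial>lborel))
      \<longlonglongrightarrow> ennreal c * ennreal (Gamma (1 - \<alpha> * b))"
    by (simp add: exp_mixture_scaled[OF F Y(1)] w_def[symmetric] nn_integral_cmult w)
qed

lemma levy_tail_mixture:
  "0 < y \<Longrightarrow> levy_tail y = (\<integral>\<^sup>+ s. indicator {0<..} s * ennreal (exp (- s)) * count_above (y * s powr (- 1)) \<partial>lborel)"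
  unfolding levy_tail_eq
  by (intro nn_integral_cong) (auto simp: powr_minus divide_inverse split: split_indicator)

lemma laplace_exponent_mixture:
  "0 < y \<Longrightarrow> laplace_exponent (1 / y) = (\<integral>\<^sup>+ s. indicator {0<..} s * ennreal (exp (- s)) * levy_tail (y * s powr 1) \<partial>lborel)"
  by (subst laplace_exponent_eq) (auto intro!: nn_integral_cong simp: mult.commute split: split_indicator)

lemma levy_tail_bound:
  obtains C where "0 \<le> C" "\<And>y. 0 < y \<Longrightarrow> ennreal (y powr \<alpha>) * levy_tail y \<le> ennreal C"
proof -
  obtain C where C: "0 \<le> C" "\<And>u. 0 < u \<Longrightarrow> ennreal (u powr \<alpha>) * count_above u \<le> ennreal C"
    using count_above_bound by blast
  have "ennreal (y powr \<alpha>) * levy_tail y \<le> ennreal (C * Gamma (1 - \<alpha> * (- 1)))" if "0 < y" for y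
    using exp_mixture_bound[OF measurable_count_above _ C that, of "- 1"] that C(1) alpha
    by (simp add: levy_tail_mixture ennreal_mult Gamma_real_nonneg)
  with C(1) alpha show ?thesis
    by (intro that[of "C * Gamma (1 - \<alpha> * (- 1))"]) (auto simp: Gamma_real_nonneg)
qed

lemma levy_tail_limit:
  "((\<lambda>y. ennreal (y powr \<alpha>) * levy_tail y) \<longlongrightarrow> ennreal (Gamma (1 + \<alpha>))) (at_right 0)"
proof -
  obtain C where C: "0 \<le> C" "\<And>u. 0 < u \<Longrightarrow> ennreal (u powr \<alpha>) * count_above u \<le> ennreal C"
    using count_above_bound by blast
  have "((\<lambda>y. ennreal (y powr \<alpha>) * (\<integral>\<^sup>+ s. indicator {0<..} s * ennreal (exp (- s)) * count_above (y * s powr (- 1)) \<partial>lborel))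
      \<longlongrightarrow> ennreal 1 * ennreal (Gamma (1 - \<alpha> * (- 1)))) (at_right 0)"
    by (rule exp_mixture_limit[OF measurable_count_above _ C]) (use count_above_limit in simp_all)
  moreover have "\<forall>\<^sub>F y in at_right 0. (0::real) < y" by (simp add: eventually_at_right_less)
  then have "\<forall>\<^sub>F y in at_right 0. ennreal (y powr \<alpha>) * (\<integral>\<^sup>+ s. indicator {0<..} s * ennreal (exp (- s)) * count_above (y * s powr (- 1)) \<partial>lborel)
      = ennreal (y powr \<alpha>) * levy_tail y"
    by eventually_elim (simp only: levy_tail_mixture)
  ultimately have "((\<lambda>y. ennreal (y powr \<alpha>) * levy_tail y) \<longlongrightarrow> ennreal 1 * ennreal (Gamma (1 - \<alpha> * (- 1)))) (at_right 0)"
    by (rule Lim_transform_eventually)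
  then show ?thesis by simp
qed

lemma laplace_exponent_limit:
  "((\<lambda>y. ennreal (y powr \<alpha>) * laplace_exponent (1 / y)) \<longlongrightarrow> ennreal (Gamma (1 + \<alpha>) * Gamma (1 - \<alpha>))) (at_right 0)"
proof -
  obtain C where C: "0 \<le> C" "\<And>u. 0 < u \<Longrightarrow> ennreal (u powr \<alpha>) * levy_tail u \<le> ennreal C"
    using levy_tail_bound by blast
  have "((\<lambda>y. ennreal (y powr \<alpha>) * (\<integral>\<^sup>+ s. indicator {0<..} s * ennreal (exp (- s)) * levy_tail (y * s powr 1) \<partial>lborel))
      \<longlongrightarrow> ennreal (Gamma (1 + \<alpha>)) * ennreal (Gamma (1 - \<alpha> * 1))) (at_right 0)"
    by (rule exp_mixture_limit[OF measurable_levy_tail _ C levy_tail_limit]) simp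
  moreover have "\<forall>\<^sub>F y in at_right 0. (0::real) < y" by (simp add: eventually_at_right_less)
  then have "\<forall>\<^sub>F y in at_right 0. ennreal (y powr \<alpha>) * (\<integral>\<^sup>+ s. indicator {0<..} s * ennreal (exp (- s)) * levy_tail (y * s powr 1) \<partial>lborel)
      = ennreal (y powr \<alpha>) * laplace_exponent (1 / y)"
    by eventually_elim (simp only: laplace_exponent_mixture)
  ultimately have "((\<lambda>y. ennreal (y powr \<alpha>) * laplace_exponent (1 / y)) \<longlongrightarrow> ennreal (Gamma (1 + \<alpha>)) * ennreal (Gamma (1 - \<alpha> * 1))) (at_right 0)"
    by (rule Lim_transform_eventually)
  with alpha show ?thesis by (simp add: ennreal_mult Gamma_real_nonneg)
qed

end

section \<open>Paths that grow by jumps\<close>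

text \<open>
  A path that increases by \<open>w p\<close> at time \<open>s p\<close>, has only finitely much growth on bounded time
  intervals, jumps in every time interval, and tends to infinity. Representing its growth by the
  purely atomic measure \<open>mu\<close> makes the standard continuity properties of measures available.
\<close>

locale jump_path =
  fixes I :: "'i set" and s w :: "'i \<Rightarrow> real"
  assumes countable: "countable I"
    and s_pos: "\<And>p. p \<in> I \<Longrightarrow> 0 < s p"
    and s_inj: "inj_on s I"
    and w_pos: "\<And>p. p \<in> I \<Longrightarrow> 0 < w p"
    and finite_mass: "\<And>t. (\<integral>\<^sup>+ p. ennreal (w p) * indicator {..t} (s p) \<partial>count_space I) < \<infinity>"
    and dense: "\<And>a b. 0 \<le> a \<Longrightarrow> a < b \<Longrightarrow> \<exists>p\<in>I. a < s p \<and> s p < b"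
    and unbounded: "\<And>K. \<exists>t. ennreal K < (\<integral>\<^sup>+ p. ennreal (w p) * indicator {..t} (s p) \<partial>count_space I)"
begin

definition mu :: "real measure" where
  "mu = distr (density (count_space I) (\<lambda>p. ennreal (w p))) borel s"

definition level :: "real \<Rightarrow> real" where "level t = measure mu {..t}"

definition level_before :: "'i \<Rightarrow> real" where "level_before p = measure mu {..<s p}"

lemma sets_mu [measurable_cong, simp]: "sets mu = sets borel"
  by (simp add: mu_def)

lemma emeasure_mu:
  "A \<in> sets borel \<Longrightarrow> emeasure mu A = (\<integral>\<^sup>+ p. ennreal (w p) * indicator A (s p) \<partial>count_space I)"
  unfolding mu_def
  by (subst emeasure_distr) (auto simp: emeasure_density indicator_def intro!: nn_integral_cong)

lemma emeasure_mu_finite: "emeasure mu {..t} < \<infinity>" "emeasure mu {..<t} < \<infinity>"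
proof -
  show "emeasure mu {..t} < \<infinity>" using finite_mass[of t] by (simp add: emeasure_mu)
  then show "emeasure mu {..<t} < \<infinity>"
    by (rule le_less_trans[rotated]) (auto intro!: emeasure_mono)
qed

lemma fmeasurable_mu: "{..t} \<in> fmeasurable mu" "{..<t} \<in> fmeasurable mu"
  using emeasure_mu_finite by (auto intro!: fmeasurableI)

lemma emeasure_mu_singleton: assumes "p \<in> I" shows "emeasure mu {s p} = ennreal (w p)"
proof -
  have "emeasure mu {s p} = (\<integral>\<^sup>+ q. ennreal (w p) * indicator {p} q \<partial>count_space I)"
    using s_inj assms by (auto simp: emeasure_mu indicator_def inj_on_def intro!: nn_integral_cong)
  also have "\<dots> = ennreal (w p)" using assms
    by (subst nn_integral_cmult_indicator) auto
  finally show ?thesis .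
qed

lemma emeasure_level: "emeasure mu {..t} = ennreal (level t)"
  unfolding level_def using emeasure_mu_finite[of t] by (intro emeasure_eq_ennreal_measure) auto

lemma level_mono: "a \<le> b \<Longrightarrow> level a \<le> level b"
  unfolding level_def by (intro measure_mono_fmeasurable fmeasurable_mu) auto

lemma level_jump: assumes "p \<in> I" shows "level (s p) = level_before p + w p"
proof -
  have "{s p} \<in> fmeasurable mu"
    using emeasure_mu_singleton[OF assms] by (intro fmeasurableI) auto
  then have "measure mu ({..<s p} \<union> {s p}) = measure mu {..<s p} + measure mu {s p}"
    by (intro measure_Un_AE fmeasurable_mu AE_I2) auto
  moreover have "measure mu {s p} = w p"
    using emeasure_mu_singleton[OF assms] w_pos[OF assms] by (simp add: measure_def)
  moreover have "{..<s p} \<union> {s p} = {..s p}" by auto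
  ultimately show ?thesis by (simp add: level_def level_before_def)
qed

lemma level_le_before: "s p < s q \<Longrightarrow> level (s p) \<le> level_before q"
  unfolding level_def level_before_def by (intro measure_mono_fmeasurable fmeasurable_mu) auto

text \<open>
  Two excursion intervals are never adjacent, because some third jump falls between the two jump
  times.
\<close>

lemma level_less_before:
  assumes "p \<in> I" "s p < s q" shows "level (s p) < level_before q"
proof -
  obtain r where r: "r \<in> I" "s p < s r" "s r < s q"
    using dense[of "s p" "s q"] s_pos[OF assms(1)] assms(2) by auto
  have "level (s p) \<le> level_before r" using r by (intro level_le_before)
  also have "\<dots> < level (s r)" using r w_pos by (simp add: level_jump)
  also have "\<dots> \<le> level_before q" using r by (intro level_le_before)
  finally show ?thesis .
qed

lemma level_nonneg: "0 \<le> level t" "0 \<le> level_before p"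
  by (simp_all add: level_def level_before_def)

lemma level_at_left: "(level \<longlongrightarrow> level_before p) (at_left (s p))"
proof (rule tendsto_at_left_sequentially[of "s p - 1"])
  fix X :: "nat \<Rightarrow> real" assume X: "\<And>n. X n < s p" "incseq X" "X \<longlonglongrightarrow> s p"
  have "(\<lambda>n. emeasure mu {..X n}) \<longlonglongrightarrow> emeasure mu (\<Union>n. {..X n})"
    using X(2) by (intro Lim_emeasure_incseq) (auto simp: incseq_def intro: order_trans)
  also have "(\<Union>n. {..X n}) = {..<s p}"
  proof (intro equalityI subsetI)
    fix y assume "y \<in> {..<s p}"
    then have "\<forall>\<^sub>F n in sequentially. y < X n" by (intro order_tendstoD(1)[OF X(3)]) auto
    then show "y \<in> (\<Union>n. {..X n})" by (auto simp: eventually_sequentially intro: less_imp_le)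
  qed (use X(1) in \<open>auto intro: le_less_trans\<close>)
  finally show "(\<lambda>n. level (X n)) \<longlonglongrightarrow> level_before p"
    unfolding level_def level_before_def measure_def
    using emeasure_mu_finite by (intro tendsto_enn2real) auto
qed auto

definition excursion :: "'i \<Rightarrow> real set" where
  "excursion p = {level_before p..<level (s p)}"

lemma excursion_disjoint:
  assumes "p \<in> I" "q \<in> I" "t \<in> excursion p" "t \<in> excursion q"
  shows "p = q"
proof (rule ccontr)
  assume "p \<noteq> q"
  then have "s p < s q \<or> s q < s p" using assms(1,2) s_inj by (metis inj_onD linorder_neqE)
  then show False
    using assms level_le_before[of p q] level_le_before[of q p] by (auto simp: excursion_def)
qed

lemma excursion_end_uncovered:
  assumes "p \<in> I" "q \<in> I" shows "level (s p) \<notin> excursion q"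
proof
  assume *: "level (s p) \<in> excursion q"
  consider "s q < s p" | "s q = s p" | "s p < s q" by linarith
  then show False
  proof cases
    case 1 with * level_mono[of "s q" "s p"] show False by (auto simp: excursion_def)
  next
    case 2 with * show False by (auto simp: excursion_def)
  next
    case 3 with * level_less_before[OF assms(1) 3] show False by (auto simp: excursion_def)
  qed
qed

text \<open>
  The excursions that end by \<open>level S\<close> have total length \<open>level S\<close> since the path
  increases by jumps only. Hence no interval of positive length stays uncovered.
\<close>

lemma excursions_cover:
  assumes "0 \<le> a" "a < b"
  shows "\<exists>p\<in>I. \<exists>t\<in>{a..b}. t \<in> excursion p"
proof (rule ccontr)
  assume none: "\<not> ?thesis"
  obtain S where "ennreal b < emeasure mu {..S}"
    using unbounded[of b] by (auto simp: emeasure_mu)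
  then have S: "b < level S"
    using assms by (simp add: emeasure_level ennreal_less_iff)
  define J where "J = {p \<in> I. s p \<le> S}"
  have J: "J \<subseteq> I" "countable J" using countable by (auto simp: J_def intro: countable_subset)
  have "disjoint_family_on excursion J"
    unfolding disjoint_family_on_def using J(1) excursion_disjoint by blast
  then have "emeasure lborel (\<Union>p\<in>J. excursion p) = (\<integral>\<^sup>+ p. emeasure lborel (excursion p) \<partial>count_space J)"
    using J(2) by (intro emeasure_UN_countable) (simp_all, simp add: excursion_def)
  also have "\<dots> = (\<integral>\<^sup>+ p. ennreal (w p) \<partial>count_space J)"
    using J w_pos
    by (intro nn_integral_cong) (force simp: excursion_def level_jump subset_eq less_imp_le)
  also have "\<dots> = (\<integral>\<^sup>+ p. ennreal (w p) * indicator {..S} (s p) \<partial>count_space I)"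
  proof -
    have "(\<integral>\<^sup>+ p. ennreal (w p) \<partial>count_space J) = (\<integral>\<^sup>+ p. ennreal (w p) * indicator J p \<partial>count_space UNIV)"
      by (cases "J = UNIV") (simp_all add: nn_integral_restrict_space[symmetric] restrict_count_space)
    also have "\<dots> = (\<integral>\<^sup>+ p. (ennreal (w p) * indicator {..S} (s p)) * indicator I p \<partial>count_space UNIV)"
      by (intro nn_integral_cong) (auto simp: J_def split: split_indicator)
    also have "\<dots> = (\<integral>\<^sup>+ p. ennreal (w p) * indicator {..S} (s p) \<partial>count_space I)"
      by (simp add: nn_integral_restrict_space[symmetric] restrict_count_space)
    finally show ?thesis .
  qed
  also have "\<dots> = ennreal (level S)" by (simp add: emeasure_mu emeasure_level[symmetric])
  finally have total: "emeasure lborel (\<Union>p\<in>J. excursion p) = ennreal (level S)" .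
  have meas: "(\<Union>p\<in>J. excursion p) \<in> sets lborel"
    using J(2) by (auto simp: excursion_def)
  have "excursion p \<subseteq> {0..<level S}" if "p \<in> J" for p
    using level_nonneg(2)[of p] level_mono[of "s p" S] that by (auto simp: excursion_def J_def)
  then have sub: "(\<Union>p\<in>J. excursion p) \<union> {a..b} \<subseteq> {0..level S}"
    using S assms by fastforce
  have "ennreal (level S) + ennreal (b - a) = emeasure lborel ((\<Union>p\<in>J. excursion p) \<union> {a..b})"
    using none J(1) meas assms by (subst plus_emeasure[symmetric]) (auto simp: total)
  also have "\<dots> \<le> emeasure lborel {0..level S}"
    using sub by (intro emeasure_mono) auto
  also have "\<dots> = ennreal (level S)" using level_nonneg(1)[of S] by simp
  finally have "ennreal (level S + (b - a)) \<le> ennreal (level S)"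
    using assms level_nonneg(1)[of S] by simp
  then show False
    using assms level_nonneg(1)[of S] by (subst (asm) ennreal_le_iff) auto
qed

text \<open>
  If \<open>Y\<close> is constant on \<open>[t,t']\<close>, then its value is finite because some point of the interval is covered
  by an excursion. The excursion around \<open>t\<close> cannot end inside the interval, since at its right
  endpoint \<open>Y\<close> would be infinite; so the value \<open>label p\<close> cannot be carried over to another
  excursion with the same label.
\<close>

lemma constant_iff_single_excursion:
  fixes label :: "'i \<Rightarrow> nat" and Y :: "real \<Rightarrow> enat"
  defines "visits t x \<equiv> \<exists>p\<in>I. label p = x \<and> t \<in> excursion p"
  assumes Y: "\<And>t. Y t = (if \<exists>x. visits t x then enat (THE x. visits t x) else \<infinity>)"
    and t: "0 \<le> t" "t < t'"
  shows "(\<forall>u\<in>{t..t'}. Y u = Y t) \<longleftrightarrow> (\<exists>p\<in>I. level_before p \<le> t \<and> t' < level (s p))"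
proof
  have Y_eq: "Y u = enat (label p)" if "p \<in> I" "u \<in> excursion p" for p u
  proof -
    have "visits u x \<longleftrightarrow> x = label p" for x
      unfolding visits_def using that excursion_disjoint[OF that(1) _ that(2)] by blast
    then have "visits u = (\<lambda>x. x = label p)" by auto
    then show ?thesis by (simp add: Y)
  qed
  have Y_inf: "Y u = \<infinity>" if "\<And>p. p \<in> I \<Longrightarrow> u \<notin> excursion p" for u
    using that by (auto simp: Y visits_def)
  {
    assume "\<exists>p\<in>I. level_before p \<le> t \<and> t' < level (s p)"
    then obtain p where p: "p \<in> I" "level_before p \<le> t" "t' < level (s p)" by auto
    then have "Y u = enat (label p)" if "u \<in> {t..t'}" for u
      using that by (intro Y_eq) (auto simp: excursion_def)
    with t show "\<forall>u\<in>{t..t'}. Y u = Y t" by simp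
  next
    assume const: "\<forall>u\<in>{t..t'}. Y u = Y t"
    obtain p u where p: "p \<in> I" "u \<in> {t..t'}" "u \<in> excursion p"
      using excursions_cover[OF t] by auto
    then have "Y t = enat (label p)" using const Y_eq[OF p(1,3)] by metis
    then have "Y t \<noteq> \<infinity>" by simp
    then have "\<not> (\<forall>q\<in>I. t \<notin> excursion q)" using Y_inf[of t] by metis
    then obtain q where q: "q \<in> I" "t \<in> excursion q" by blast
    \<comment> \<open>Otherwise the excursion ends inside \<open>[t,t']\<close>, at a point that no excursion covers.\<close>
    have "t' < level (s q)"
    proof (rule ccontr)
      assume "\<not> t' < level (s q)"
      then have "level (s q) \<in> {t..t'}" using q by (auto simp: excursion_def)
      moreover have "Y (level (s q)) = \<infinity>"
        using excursion_end_uncovered[OF q(1)] by (intro Y_inf) auto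
      ultimately show False using const \<open>Y t \<noteq> \<infinity>\<close> by metis
    qed
    with q show "\<exists>p\<in>I. level_before p \<le> t \<and> t' < level (s p)" by (auto simp: excursion_def)
  }
qed

end

lemma infsum_eq_nn_integral:
  fixes f :: "'i \<Rightarrow> real"
  assumes "\<And>x. x \<in> A \<Longrightarrow> 0 \<le> f x" and fin: "(\<integral>\<^sup>+ x. ennreal (f x) \<partial>count_space A) < \<infinity>"
  shows "infsum f A = enn2real (\<integral>\<^sup>+ x. ennreal (f x) \<partial>count_space A)"
proof -
  have int: "integrable (count_space A) f"
    using assms by (intro integrableI_nonneg) (auto simp: AE_count_space)
  then have "Infinite_Set_Sum.abs_summable_on f A"
    by (simp add: Infinite_Set_Sum.abs_summable_on_def)
  then have "infsum f A = infsetsum f A"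
    by (intro infsetsum_infsum[symmetric]) (simp add: abs_summable_equivalent)
  also have "\<dots> = enn2real (\<integral>\<^sup>+ x. ennreal (f x) \<partial>count_space A)"
    unfolding infsetsum_def using assms by (intro integral_eq_nn_integral) (auto simp: AE_count_space)
  finally show ?thesis .
qed

text \<open>
  A mark \<open>(x, i)\<close> stands for the \<open>i\<close>-th visit to \<open>x\<close>.
\<close>

definition marks :: "(nat \<times> nat) set" where "marks = {1..} \<times> {1..}"

lemma mem_marks [simp]: "(x, i) \<in> marks \<longleftrightarrow> 1 \<le> x \<and> 1 \<le> i"
  by (simp add: marks_def)

text \<open>
  The properties of one realisation of the driver that make the K-process an instance of the
  deterministic picture above. They hold almost surely.
\<close>

locale k_path =
  fixes g :: "nat \<Rightarrow> real" and N :: "nat \<Rightarrow> real \<Rightarrow> 'b \<Rightarrow> nat" and T :: "nat \<Rightarrow> nat \<Rightarrow> 'b \<Rightarrow> real"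
    and \<omega> :: 'b and \<sigma> :: "nat \<times> nat \<Rightarrow> real"
  assumes path: "jump_path marks \<sigma> (\<lambda>(x, i). g x * T x i \<omega>)"
    and event_time: "\<And>x i. 1 \<le> x \<Longrightarrow> 1 \<le> i \<Longrightarrow> event_time (N x) i \<omega> = \<sigma> (x, i)"
    and counts: "\<And>x i t. 1 \<le> x \<Longrightarrow> 1 \<le> i \<Longrightarrow> 0 \<le> t \<Longrightarrow> i \<le> N x t \<omega> \<longleftrightarrow> \<sigma> (x, i) \<le> t"
begin

sublocale jump_path marks \<sigma> "\<lambda>(x, i). g x * T x i \<omega>" by (rule path)

lemma k_clock_eq_level:
  assumes "0 \<le> t" shows "k_clock g N T \<omega> t = level t"
proof -
  let ?f = "\<lambda>p. ennreal (case p of (x, i) \<Rightarrow> g x * T x i \<omega>) * indicator {..t} (\<sigma> p)"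
  have pos: "0 \<le> g x * T x i \<omega>" if "1 \<le> x" "1 \<le> i" for x i
    using w_pos[of "(x, i)"] that by auto
  have inner: "(\<integral>\<^sup>+ i. ?f (x, i) \<partial>count_space {1..}) = ennreal (g x * (\<Sum>i=1..N x t \<omega>. T x i \<omega>))"
    if x: "1 \<le> x" for x
  proof -
    have "(\<integral>\<^sup>+ i. ?f (x, i) \<partial>count_space {1..}) = (\<integral>\<^sup>+ i. ennreal (g x * T x i \<omega>) * indicator {1..N x t \<omega>} i \<partial>count_space {1..})"
      using counts[OF x _ assms] by (intro nn_integral_cong) (auto split: split_indicator)
    also have "\<dots> = (\<Sum>i=1..N x t \<omega>. ennreal (g x * T x i \<omega>))"
      by (subst nn_integral_count_space'[of "{1..N x t \<omega>}"]) auto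
    also have "\<dots> = ennreal (g x * (\<Sum>i=1..N x t \<omega>. T x i \<omega>))"
      using pos[OF x] by (subst sum_ennreal) (auto simp: sum_distrib_left)
    finally show ?thesis .
  qed
  have "ennreal (level t) = (\<integral>\<^sup>+ p. ?f p \<partial>count_space marks)"
    by (simp add: emeasure_level[symmetric] emeasure_mu del: One_nat_def)
  also have "\<dots> = (\<integral>\<^sup>+ p. ?f p \<partial>(count_space {1..} \<Otimes>\<^sub>M count_space {1..}))"
    by (subst pair_measure_countable) (auto simp: marks_def)
  also have "\<dots> = (\<integral>\<^sup>+ x. \<integral>\<^sup>+ i. ?f (x, i) \<partial>count_space {1..} \<partial>count_space {1..})"
    by (rule sigma_finite_measure.nn_integral_fst[symmetric])
       (auto intro!: sigma_finite_measure_count_space_countable simp: pair_measure_countable)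
  also have "\<dots> = (\<integral>\<^sup>+ x. ennreal (g x * (\<Sum>i=1..N x t \<omega>. T x i \<omega>)) \<partial>count_space {1..})"
    by (intro nn_integral_cong) (use inner in auto)
  finally have eq: "(\<integral>\<^sup>+ x. ennreal (g x * (\<Sum>i=1..N x t \<omega>. T x i \<omega>)) \<partial>count_space {1..}) = ennreal (level t)" ..
  have "0 \<le> g x * (\<Sum>i=1..N x t \<omega>. T x i \<omega>)" if "1 \<le> x" for x
    unfolding sum_distrib_left using pos[OF that] by (intro sum_nonneg) auto
  then show ?thesis
    unfolding k_clock_def using eq level_nonneg(1)
    by (subst infsum_eq_nn_integral) auto
qed

lemma k_visits_iff:
  "k_visits g N T \<omega> t x \<longleftrightarrow> (\<exists>p\<in>marks. fst p = x \<and> t \<in> excursion p)"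
proof -
  have "Lim (at_left (\<sigma> p)) (k_clock g N T \<omega>) = level_before p" if "p \<in> marks" for p
  proof (rule tendsto_Lim)
    have "\<forall>\<^sub>F u in at_left (\<sigma> p). level u = k_clock g N T \<omega> u"
      unfolding eventually_at_left_field using s_pos[OF that] k_clock_eq_level
      by (intro exI[of _ 0]) auto
    with level_at_left[of p] show "(k_clock g N T \<omega> \<longlongrightarrow> level_before p) (at_left (\<sigma> p))"
      by (rule Lim_transform_eventually)
  qed simp
  moreover have "k_clock g N T \<omega> (\<sigma> p) = level (\<sigma> p)" if "p \<in> marks" for p
    using s_pos[OF that] by (intro k_clock_eq_level) auto
  ultimately have "(1 \<le> x \<and> (\<exists>j\<ge>1. Lim (at_left (event_time (N x) j \<omega>)) (k_clock g N T \<omega>) \<le> t \<and>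
      t < k_clock g N T \<omega> (event_time (N x) j \<omega>))) \<longleftrightarrow> (\<exists>j. (x, j) \<in> marks \<and> t \<in> excursion (x, j))"
    using event_time[of x] by (auto simp: excursion_def simp del: One_nat_def)
  moreover have "(\<exists>p\<in>marks. fst p = x \<and> t \<in> excursion p) \<longleftrightarrow> (\<exists>j. (x, j) \<in> marks \<and> t \<in> excursion (x, j))"
    by (force simp del: mem_marks)
  ultimately show ?thesis
    unfolding k_visits_def by argo
qed

lemma k_process_constant_iff:
  assumes "0 \<le> t" "t < t'"
  shows "(\<forall>u\<in>{t..t'}. k_process g N T \<omega> u = k_process g N T \<omega> t) \<longleftrightarrow>
    (\<exists>p\<in>marks. level_before p \<le> t \<and> t' < level (\<sigma> p))"
  by (rule constant_iff_single_excursion[where label = fst])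
     (use assms in \<open>simp_all only: k_process_def k_visits_iff\<close>)

end

section \<open>The driving processes\<close>

text \<open>
  The infimum over rational times is measurable with respect to the process, whatever its paths look
  like; on regular paths it agrees with the event time.
\<close>

definition jump_time :: "(real \<Rightarrow> 'b \<Rightarrow> nat) \<Rightarrow> nat \<Rightarrow> 'b \<Rightarrow> real" where
  "jump_time n i \<omega> = enn2real (INF q\<in>{q\<in>\<rat>. 0 \<le> q}. if i \<le> n q \<omega> then ennreal q else \<top>)"

definition counting_path :: "(real \<Rightarrow> nat) \<Rightarrow> bool" where
  "counting_path n \<longleftrightarrow> n 0 = 0 \<and> mono_on {0..} n \<and>
     (\<forall>t\<ge>0. continuous (at_right t) (\<lambda>s. real (n s))) \<and> (\<forall>i. \<exists>m::nat. i \<le> n (real m))"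

lemma counting_path_jump_time:
  assumes n: "counting_path (\<lambda>t. n t \<omega>)" and i: "1 \<le> i"
  shows "event_time n i \<omega> = jump_time n i \<omega>"
    and "0 \<le> t \<Longrightarrow> i \<le> n t \<omega> \<longleftrightarrow> jump_time n i \<omega> \<le> t"
    and "0 < jump_time n i \<omega>"
proof -
  define A where "A = {t. 0 \<le> t \<and> i \<le> n t \<omega>}"
  define m where "m = Inf A"
  obtain k :: nat where "i \<le> n (real k) \<omega>" using n by (auto simp: counting_path_def)
  then have ne: "A \<noteq> {}" by (auto simp: A_def intro!: exI[of _ "real k"])
  have bdd: "bdd_below A" by (auto simp: A_def)
  have up: "t \<in> A" if "s \<in> A" "s \<le> t" for s t
    using that n by (auto simp: A_def counting_path_def mono_on_def intro: order_trans)
  have m0: "0 \<le> m" unfolding m_def using ne by (intro cInf_greatest) (auto simp: A_def)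
  have "((\<lambda>s. real (n s \<omega>)) \<longlongrightarrow> real (n m \<omega>)) (at_right m)"
    using n m0 by (auto simp: counting_path_def continuous_within)
  then have "\<forall>\<^sub>F s in at_right m. real (n s \<omega>) < real (n m \<omega>) + 1"
    by (rule order_tendstoD(2)) simp
  then have "\<forall>\<^sub>F s in at_right m. n s \<omega> \<le> n m \<omega>"
    by eventually_elim linarith
  then obtain b where b: "m < b" "\<And>s. m < s \<Longrightarrow> s < b \<Longrightarrow> n s \<omega> \<le> n m \<omega>"
    by (auto simp: eventually_at_right_field)
  obtain s where s: "s \<in> A" "s < b"
    using cInf_lessD[OF ne, of b] b(1) by (auto simp: m_def)
  have "m \<le> s" unfolding m_def using s(1) bdd by (intro cInf_lower)
  then have "i \<le> n m \<omega>" using s b(2)[of s] by (cases "m = s") (auto simp: A_def intro: order_trans)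
  then have mA: "m \<in> A" using m0 by (simp add: A_def)
  have A_eq: "t \<in> A \<longleftrightarrow> m \<le> t" for t
    using up[OF mA] cInf_lower[OF _ bdd] by (auto simp: m_def)
  have "(INF q\<in>{q\<in>\<rat>. 0 \<le> q}. if i \<le> n q \<omega> then ennreal q else \<top>) = ennreal m"
  proof (rule antisym)
    show "ennreal m \<le> (INF q\<in>{q\<in>\<rat>. 0 \<le> q}. if i \<le> n q \<omega> then ennreal q else \<top>)"
      using A_eq by (intro INF_greatest) (auto simp: A_def intro!: ennreal_leI)
    show "(INF q\<in>{q\<in>\<rat>. 0 \<le> q}. if i \<le> n q \<omega> then ennreal q else \<top>) \<le> ennreal m"
    proof (rule ennreal_le_epsilon)
      fix e :: real assume "0 < e"
      then obtain q where q: "q \<in> \<rat>" "m < q" "q < m + e" using Rats_dense_in_real[of m "m + e"] by auto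
      then have "q \<in> A" by (simp add: A_eq)
      then have "(INF q\<in>{q\<in>\<rat>. 0 \<le> q}. if i \<le> n q \<omega> then ennreal q else \<top>) \<le> ennreal q"
        using q by (intro INF_lower2[of q]) (auto simp: A_def)
      also have "\<dots> \<le> ennreal m + ennreal e"
        using q m0 \<open>0 < e\<close> by (simp add: ennreal_plus[symmetric] ennreal_leI del: ennreal_plus)
      finally show "(INF q\<in>{q\<in>\<rat>. 0 \<le> q}. if i \<le> n q \<omega> then ennreal q else \<top>) \<le> ennreal m + ennreal e" .
    qed
  qed
  then have jt: "jump_time n i \<omega> = m" using m0 by (simp add: jump_time_def)
  then show "event_time n i \<omega> = jump_time n i \<omega>"
    by (simp add: event_time_def m_def A_def)
  show "0 \<le> t \<Longrightarrow> i \<le> n t \<omega> \<longleftrightarrow> jump_time n i \<omega> \<le> t"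
    using A_eq[of t] by (simp add: jt A_def)
  have "0 \<notin> A" using n i by (auto simp: A_def counting_path_def)
  then show "0 < jump_time n i \<omega>" using A_eq[of 0] m0 jt by auto
qed

lemma (in prob_space) AE_not_if_prob_le_null_sequence:
  assumes sets: "{\<omega>\<in>space M. Q \<omega>} \<in> sets M"
    and le: "\<And>n::nat. prob {\<omega>\<in>space M. Q \<omega>} \<le> f n" and lim: "f \<longlonglongrightarrow> 0"
  shows "AE \<omega> in M. \<not> Q \<omega>"
proof -
  have "prob {\<omega>\<in>space M. Q \<omega>} \<le> 0"
    by (rule LIMSEQ_le_const[OF lim]) (use le in blast)
  then have "prob {\<omega>\<in>space M. Q \<omega>} = 0" using measure_nonneg[of M "{\<omega>\<in>space M. Q \<omega>}"] by linarith
  with sets show ?thesis by (intro AE_I[of _ _ "{\<omega>\<in>space M. Q \<omega>}"]) (auto simp: emeasure_eq_measure)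
qed

text \<open>
  Independence is used for groups of sources, a source being one Poisson process or one exponential
  variable. The measurable space \<open>info K\<close> carries the events determined by the sources in \<open>K\<close>, and
  disjoint groups give independent \<open>info\<close> spaces.
\<close>

locale driver =
  fixes P :: "'b measure" and N :: "nat \<Rightarrow> real \<Rightarrow> 'b \<Rightarrow> nat" and T :: "nat \<Rightarrow> nat \<Rightarrow> 'b \<Rightarrow> real"
  assumes driver: "k_process_driver P N T"
begin

sublocale prob_space P
  using driver by (simp add: k_process_driver_def)

definition sources :: "(nat + nat \<times> nat) set" where
  "sources = {1..} <+> ({1..} \<times> {1..})"

definition generators :: "nat + nat \<times> nat \<Rightarrow> 'b set set" where
  "generators = case_sum (\<lambda>x. process_events P (N x)) (\<lambda>(x, i). variable_events P (T x i))"

definition info :: "(nat + nat \<times> nat) set \<Rightarrow> 'b measure" where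
  "info K = sigma (space P) (\<Union>k\<in>K. generators k)"

lemma mem_sources [simp]: "Inl x \<in> sources \<longleftrightarrow> 1 \<le> x" "Inr (x, i) \<in> sources \<longleftrightarrow> 1 \<le> x \<and> 1 \<le> i"
  by (auto simp: sources_def)

lemma indep_generators: "indep_sets generators sources"
  using driver by (simp add: k_process_driver_def generators_def sources_def)

lemma generators_subset: "k \<in> sources \<Longrightarrow> generators k \<subseteq> sets P"
  using indep_generators by (auto simp: indep_sets_def)

lemma Int_stable_generators: "Int_stable (generators k)"
proof (cases k)
  case (Inl x)
  have "{N x t -` A \<inter> space P |t A. 0 \<le> t} \<subseteq> Pow (space P)" by auto
  then interpret sigma_algebra "space P" "process_events P (N x)"
    unfolding process_events_def by (rule sigma_algebra_sigma_sets)
  show ?thesis using Inl by (auto simp: generators_def Int_stable_def)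
next
  case (Inr p)
  show ?thesis
  proof (cases p)
    case (Pair x i)
    have "\<exists>C. (T x i -` A \<inter> space P) \<inter> (T x i -` B \<inter> space P) = T x i -` C \<inter> space P \<and> C \<in> sets borel"
      if "A \<in> sets borel" "B \<in> sets borel" for A B
      using that by (intro exI[of _ "A \<inter> B"]) auto
    then show ?thesis using Inr Pair by (fastforce simp: generators_def variable_events_def Int_stable_def)
  qed
qed

lemma generators_Pow: "generators k \<subseteq> Pow (space P)"
proof (cases k)
  case (Inl x)
  then show ?thesis
    using sigma_sets_into_sp[of "{N x t -` A \<inter> space P |t A. 0 \<le> t}" "space P"]
    by (auto simp: generators_def process_events_def)
qed (auto simp: generators_def variable_events_def)

lemma space_info [simp]: "space (info K) = space P"
  unfolding info_def using generators_Pow by (intro space_measure_of) auto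

lemma sets_info: "sets (info K) = sigma_sets (space P) (\<Union>k\<in>K. generators k)"
  unfolding info_def using generators_Pow by (intro sets_measure_of) auto

lemma sets_info_mono: "K \<subseteq> K' \<Longrightarrow> sets (info K) \<subseteq> sets (info K')"
  unfolding sets_info by (rule sigma_sets_mono') auto

lemma sets_info_subset: "K \<subseteq> sources \<Longrightarrow> sets (info K) \<subseteq> sets P"
  unfolding sets_info using generators_subset by (intro sets.sigma_sets_subset) auto

lemma measurable_info_mono: "f \<in> measurable (info K) M \<Longrightarrow> K \<subseteq> K' \<Longrightarrow> f \<in> measurable (info K') M"
  using sets_info_mono[of K K'] by (auto simp: measurable_def)

lemma measurable_from_info: "f \<in> measurable (info K) M \<Longrightarrow> K \<subseteq> sources \<Longrightarrow> f \<in> measurable P M"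
  using sets_info_subset[of K] by (auto simp: measurable_def)

lemma measurable_N_info:
  assumes "Inl x \<in> K" "0 \<le> t" shows "N x t \<in> measurable (info K) (count_space UNIV)"
proof (rule measurableI)
  fix A :: "nat set"
  have "N x t -` A \<inter> space P \<in> generators (Inl x)"
    using assms unfolding generators_def process_events_def by (auto intro!: sigma_sets.Basic)
  then show "N x t -` A \<inter> space (info K) \<in> sets (info K)"
    using assms unfolding sets_info space_info by (intro sigma_sets.Basic) auto
qed auto

lemma measurable_T_info:
  assumes "Inr (x, i) \<in> K" shows "T x i \<in> borel_measurable (info K)"
proof (rule measurableI)
  fix A :: "real set" assume "A \<in> sets borel"
  then have "T x i -` A \<inter> space P \<in> generators (Inr (x, i))"
    unfolding generators_def variable_events_def by auto
  then show "T x i -` A \<inter> space (info K) \<in> sets (info K)"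
    using assms unfolding sets_info space_info by (intro sigma_sets.Basic) auto
qed auto

lemma indep_info:
  assumes "\<And>j. j \<in> J \<Longrightarrow> K j \<subseteq> sources" "disjoint_family_on K J"
  shows "indep_sets (\<lambda>j. sets (info (K j))) J"
  unfolding sets_info
  by (intro indep_sets_collect_sigma indep_sets_mono_index[OF _ indep_generators] Int_stable_generators)
     (use assms in auto)

lemma indep_vars_info:
  assumes "\<And>j. j \<in> J \<Longrightarrow> K j \<subseteq> sources" "disjoint_family_on K J"
    and X: "\<And>j. j \<in> J \<Longrightarrow> X j \<in> measurable (info (K j)) (M' j)"
  shows "indep_vars M' X J"
  unfolding indep_vars_def2
proof
  show "\<forall>i\<in>J. random_variable (M' i) (X i)"
    using X assms(1) by (auto intro: measurable_from_info)
  show "indep_sets (\<lambda>i. {X i -` A \<inter> space P |A. A \<in> sets (M' i)}) J"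
    by (rule indep_sets_mono_sets[OF indep_info[OF assms(1,2)]])
       (use measurable_sets[OF X] in auto)
qed

lemma nn_integral_prod_info:
  fixes X :: "'j \<Rightarrow> 'b \<Rightarrow> ennreal"
  assumes "finite J" "\<And>j. j \<in> J \<Longrightarrow> K j \<subseteq> sources" "disjoint_family_on K J"
    and X: "\<And>j. j \<in> J \<Longrightarrow> X j \<in> borel_measurable (info (K j))"
  shows "(\<integral>\<^sup>+\<omega>. (\<Prod>j\<in>J. X j \<omega>) \<partial>P) = (\<Prod>j\<in>J. \<integral>\<^sup>+\<omega>. X j \<omega> \<partial>P)"
  using assms by (intro indep_vars_nn_integral indep_vars_info) auto

text \<open>
  A variable that depends on one group of sources can be integrated out separately inside a function
  of that variable and of a disjoint group. The outcome itself, seen through \<open>info K'\<close>, plays the part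
  of the second random variable.
\<close>

lemma nn_integral_freeze:
  assumes K: "K \<subseteq> sources" "K' \<subseteq> sources" "K \<inter> K' = {}"
    and X: "X \<in> measurable (info K) S"
    and f: "case_prod f \<in> borel_measurable (S \<Otimes>\<^sub>M info K')"
  shows "(\<integral>\<^sup>+\<omega>. f (X \<omega>) \<omega> \<partial>P) = (\<integral>\<^sup>+ x. (\<integral>\<^sup>+\<omega>. f x \<omega> \<partial>P) \<partial>distr P S X)"
proof -
  have id: "(\<lambda>\<omega>. \<omega>) \<in> measurable (info K') (info K')" by simp
  have XP [measurable]: "X \<in> measurable P S" by (rule measurable_from_info[OF X K(1)])
  have idP [measurable]: "(\<lambda>\<omega>. \<omega>) \<in> measurable P (info K')" by (rule measurable_from_info[OF id K(2)])
  interpret Q: prob_space "distr P (info K') (\<lambda>\<omega>. \<omega>)" by (rule prob_space_distr) fact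
  interpret X: prob_space "distr P S X" by (rule prob_space_distr) fact
  have "indep_sets (\<lambda>j. sets (info (case_bool K K' j))) UNIV"
    using K by (intro indep_info) (auto simp: disjoint_family_on_def split: bool.splits)
  moreover have "(\<lambda>j. sets (info (case_bool K K' j))) = case_bool (sets (info K)) (sets (info K'))"
    by (auto simp: fun_eq_iff split: bool.splits)
  ultimately have "indep_set (sets (info K)) (sets (info K'))"
    unfolding indep_set_def by simp
  note indep = indep_setD[OF this]
  have prod: "distr P S X \<Otimes>\<^sub>M distr P (info K') (\<lambda>\<omega>. \<omega>) = distr P (S \<Otimes>\<^sub>M info K') (\<lambda>\<omega>. (X \<omega>, \<omega>))"
  proof (rule pair_measure_eqI)
    fix A B assume A: "A \<in> sets (distr P S X)" and B: "B \<in> sets (distr P (info K') (\<lambda>\<omega>. \<omega>))"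
    have B': "B \<in> sets P" "B \<subseteq> space P" using B K(2) sets_info_subset sets.sets_into_space[of B "info K'"] by auto
    have "(\<lambda>\<omega>. (X \<omega>, \<omega>)) -` (A \<times> B) \<inter> space P = (X -` A \<inter> space P) \<inter> B" using B' by auto
    then have "emeasure (distr P (S \<Otimes>\<^sub>M info K') (\<lambda>\<omega>. (X \<omega>, \<omega>))) (A \<times> B) = prob ((X -` A \<inter> space P) \<inter> B)"
      using A B by (subst emeasure_distr) (auto simp: emeasure_eq_measure)
    also have "prob ((X -` A \<inter> space P) \<inter> B) = prob (X -` A \<inter> space P) * prob B"
      using measurable_sets[OF X, of A] A B by (intro indep) auto
    finally show "emeasure (distr P S X) A * emeasure (distr P (info K') (\<lambda>\<omega>. \<omega>)) B =
        emeasure (distr P (S \<Otimes>\<^sub>M info K') (\<lambda>\<omega>. (X \<omega>, \<omega>))) (A \<times> B)"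
      using A B B' by (simp add: emeasure_distr emeasure_eq_measure ennreal_mult Int_absorb2)
  qed (auto intro: X.sigma_finite_measure_axioms Q.sigma_finite_measure_axioms)
  have "(\<integral>\<^sup>+\<omega>. f (X \<omega>) \<omega> \<partial>P) = (\<integral>\<^sup>+ z. case_prod f z \<partial>distr P (S \<Otimes>\<^sub>M info K') (\<lambda>\<omega>. (X \<omega>, \<omega>)))"
    using f by (subst nn_integral_distr) auto
  also have "\<dots> = (\<integral>\<^sup>+ x. (\<integral>\<^sup>+\<omega>. f x \<omega> \<partial>distr P (info K') (\<lambda>\<omega>. \<omega>)) \<partial>distr P S X)"
    unfolding prod[symmetric] using f
    by (subst Q.nn_integral_fst[symmetric]) (auto simp: measurable_cong_sets[OF sets_pair_measure_cong[OF sets_distr sets_distr] refl])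
  also have "\<dots> = (\<integral>\<^sup>+ x. (\<integral>\<^sup>+\<omega>. f x \<omega> \<partial>P) \<partial>distr P S X)"
  proof (rule nn_integral_cong)
    fix x assume "x \<in> space (distr P S X)"
    then have "f x \<in> borel_measurable (info K')"
      using measurable_compose[OF measurable_Pair1' f, of x] by simp
    then show "(\<integral>\<^sup>+\<omega>. f x \<omega> \<partial>distr P (info K') (\<lambda>\<omega>. \<omega>)) = (\<integral>\<^sup>+\<omega>. f x \<omega> \<partial>P)"
      by (subst nn_integral_distr) auto
  qed
  finally show ?thesis .
qed

lemma measurable_jump_time_info [measurable]:
  assumes "Inl x \<in> K" shows "jump_time (N x) i \<in> borel_measurable (info K)"
proof -
  have [measurable]: "(\<lambda>\<omega>. if i \<le> N x q \<omega> then ennreal q else \<top>) \<in> borel_measurable (info K)"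
    if "q \<in> {q\<in>\<rat>. 0 \<le> q}" for q
    using measurable_N_info[OF assms, of q] that by simp
  have "countable {q\<in>\<rat>. 0 \<le> (q::real)}"
    by (rule countable_subset[OF _ countable_rat]) auto
  then have "(\<lambda>\<omega>. INF q\<in>{q\<in>\<rat>. 0 \<le> q}. if i \<le> N x q \<omega> then ennreal q else \<top>) \<in> borel_measurable (info K)"
    by (intro borel_measurable_INF) auto
  then show ?thesis unfolding jump_time_def[abs_def] by measurable
qed

lemma measurable_N [measurable]: "1 \<le> x \<Longrightarrow> 0 \<le> t \<Longrightarrow> N x t \<in> measurable P (count_space UNIV)"
  by (rule measurable_from_info[OF measurable_N_info[of x sources]]) auto

lemma measurable_T [measurable]: "1 \<le> x \<Longrightarrow> 1 \<le> i \<Longrightarrow> T x i \<in> borel_measurable P"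
  by (rule measurable_from_info[OF measurable_T_info[of x i sources]]) auto

lemma measurable_jump_time [measurable]: "1 \<le> x \<Longrightarrow> jump_time (N x) i \<in> borel_measurable P"
  by (rule measurable_from_info[OF measurable_jump_time_info[of x sources]]) auto

lemma poisson: "1 \<le> x \<Longrightarrow> poisson_process P 1 (N x)"
  using driver by (simp add: k_process_driver_def)

lemma prob_increment:
  assumes "1 \<le> x" "0 \<le> s" "s < t"
  shows "prob {\<omega>\<in>space P. N x t \<omega> - N x s \<omega> \<in> A} = measure_pmf.prob (poisson_pmf (t - s)) A"
proof -
  have [measurable]: "N x t \<in> measurable P (count_space UNIV)" "N x s \<in> measurable P (count_space UNIV)"
    using assms by simp_all
  have m: "(\<lambda>\<omega>. N x t \<omega> - N x s \<omega>) \<in> measurable P (count_space UNIV)"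
    by measurable
  have "distr P (count_space UNIV) (\<lambda>\<omega>. N x t \<omega> - N x s \<omega>) = measure_pmf (poisson_pmf (1 * (t - s)))"
    using poisson[OF assms(1)] assms unfolding poisson_process_def by blast
  then have "measure_pmf.prob (poisson_pmf (t - s)) A = measure (distr P (count_space UNIV) (\<lambda>\<omega>. N x t \<omega> - N x s \<omega>)) A"
    by simp
  also have "\<dots> = prob {\<omega>\<in>space P. N x t \<omega> - N x s \<omega> \<in> A}"
    by (subst measure_distr[OF m]) (auto intro!: arg_cong[where f = prob])
  finally show ?thesis ..
qed

lemma prob_count:
  assumes "1 \<le> x" "0 \<le> t"
  shows "prob {\<omega>\<in>space P. N x t \<omega> = n} = t ^ n / fact n * exp (- t)"
proof -
  have N0: "AE \<omega> in P. N x 0 \<omega> = 0"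
    using poisson[OF assms(1)] by (auto simp: poisson_process_def elim!: eventually_mono)
  show ?thesis
  proof (cases "t = 0")
    case True
    have "prob {\<omega>\<in>space P. N x t \<omega> = n} = prob {\<omega>\<in>space P. 0 = n}"
      using N0 assms True by (intro finite_measure_eq_AE) (auto elim!: eventually_mono)
    then show ?thesis using True by (cases n) (auto simp: prob_space)
  next
    case False
    have "prob {\<omega>\<in>space P. N x t \<omega> = n} = prob {\<omega>\<in>space P. N x t \<omega> - N x 0 \<omega> \<in> {n}}"
      using N0 assms by (intro finite_measure_eq_AE) (auto elim!: eventually_mono)
    with False assms show ?thesis
      by (subst (asm) prob_increment) (auto simp: measure_pmf_single)
  qed
qed

lemma prob_count_less:
  assumes "1 \<le> x" "0 \<le> t"
  shows "prob {\<omega>\<in>space P. N x t \<omega> < j} = (\<Sum>n<j. t ^ n / fact n * exp (- t))"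
proof -
  have [measurable]: "N x t \<in> measurable P (count_space UNIV)" using assms by simp
  have "prob {\<omega>\<in>space P. N x t \<omega> < j} = prob (\<Union>n<j. {\<omega>\<in>space P. N x t \<omega> = n})"
    by (intro arg_cong[where f = prob]) auto
  also have "\<dots> = (\<Sum>n<j. prob {\<omega>\<in>space P. N x t \<omega> = n})"
    by (intro finite_measure_finite_Union) (auto simp: disjoint_family_on_def)
  finally show ?thesis using assms by (simp add: prob_count)
qed

text \<open>
  Unboundedness is the only property that is not part of the definition of a Poisson process; it holds
  because \<open>P(N x m < i)\<close> tends to 0 as \<open>m\<close> grows.
\<close>

lemma AE_counting_path:
  assumes x: "1 \<le> x"
  shows "AE \<omega> in P. counting_path (\<lambda>t. N x t \<omega>)"
proof -
  have "AE \<omega> in P. \<exists>m::nat. i \<le> N x (real m) \<omega>" for i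
  proof -
    let ?A = "{\<omega>\<in>space P. \<not> (\<exists>m::nat. i \<le> N x (real m) \<omega>)}"
    have [measurable]: "N x (real m) \<in> measurable P (count_space UNIV)" for m :: nat using x by simp
    have A: "?A \<in> sets P" by measurable
    have "prob ?A \<le> (\<Sum>n<i. real m ^ n / fact n * exp (- real m))" for m :: nat
      using x unfolding prob_count_less[OF x of_nat_0_le_iff, symmetric]
      by (intro finite_measure_mono) (auto simp: not_le)
    moreover have "(\<lambda>m::nat. \<Sum>n<i. real m ^ n / fact n * exp (- real m)) \<longlonglongrightarrow> (\<Sum>n<i. 0)"
    proof (rule tendsto_sum)
      fix n
      have "(\<lambda>m::nat. real m ^ n / exp (real m) * (1 / fact n)) \<longlonglongrightarrow> 0 * (1 / fact n)"
        by (intro tendsto_mult tendsto_const filterlim_compose[OF tendsto_power_div_exp_0 filterlim_real_sequentially])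
      then show "(\<lambda>m::nat. real m ^ n / fact n * exp (- real m)) \<longlonglongrightarrow> 0"
        by (simp add: exp_minus divide_inverse mult_ac)
    qed
    ultimately have "AE \<omega> in P. \<not> \<not> (\<exists>m::nat. i \<le> N x (real m) \<omega>)"
      by (intro AE_not_if_prob_le_null_sequence[OF A]) simp_all
    then show ?thesis by simp
  qed
  then have "AE \<omega> in P. \<forall>i. \<exists>m::nat. i \<le> N x (real m) \<omega>" by (simp add: AE_all_countable)
  moreover have "AE \<omega> in P. N x 0 \<omega> = 0 \<and> mono_on {0..} (\<lambda>t. N x t \<omega>) \<and>
        (\<forall>t\<ge>0. continuous (at_right t) (\<lambda>s. real (N x s \<omega>)))"
    using poisson[OF x] by (simp only: poisson_process_def)
  ultimately show ?thesis by eventually_elim (simp add: counting_path_def)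
qed

end

context driver begin

lemma jump_time_distributed:
  assumes x: "1 \<le> x" and i: "1 \<le> i"
  shows "distributed P lborel (jump_time (N x) i) (erlang_density (i - 1) 1)"
proof (rule erlang_distributedI)
  fix a :: real assume a: "0 \<le> a"
  have [measurable]: "N x a \<in> measurable P (count_space UNIV)" "jump_time (N x) i \<in> borel_measurable P"
    using x a by simp_all
  have "prob {\<omega>\<in>space P. jump_time (N x) i \<omega> \<le> a} = prob {\<omega>\<in>space P. \<not> N x a \<omega> < i}"
  proof (rule finite_measure_eq_AE)
    show "AE \<omega> in P. \<omega> \<in> {\<omega>\<in>space P. jump_time (N x) i \<omega> \<le> a} \<longleftrightarrow> \<omega> \<in> {\<omega>\<in>space P. \<not> N x a \<omega> < i}"
      using AE_counting_path[OF x]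
    proof eventually_elim
      case (elim \<omega>)
      from counting_path_jump_time(2)[where n = "N x" and \<omega> = \<omega>, OF elim i a] show ?case by (auto simp: not_less)
    qed
  qed measurable
  also have "\<dots> = 1 - prob {\<omega>\<in>space P. N x a \<omega> < i}"
    by (subst prob_compl[symmetric]) (auto intro!: arg_cong[where f = prob])
  also have "{..<i} = {..i - 1}" using i by auto
  then have "1 - prob {\<omega>\<in>space P. N x a \<omega> < i} = erlang_CDF (i - 1) 1 a"
    using a x by (simp add: prob_count_less erlang_CDF_def)
  finally show "emeasure P {\<omega>\<in>space P. jump_time (N x) i \<omega> \<le> a} = ennreal (erlang_CDF (i - 1) 1 a)"
    by (simp add: emeasure_eq_measure)
qed (use x in auto)

lemma jump_time_no_atom:
  assumes "1 \<le> x" "1 \<le> i"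
  shows "emeasure P {\<omega>\<in>space P. jump_time (N x) i \<omega> = a} = 0"
proof -
  have "emeasure P {\<omega>\<in>space P. jump_time (N x) i \<omega> = a} = emeasure P (jump_time (N x) i -` {a} \<inter> space P)"
    by (intro arg_cong[where f = "emeasure P"]) auto
  also have "\<dots> = (\<integral>\<^sup>+ s. ennreal (erlang_density (i - 1) 1 s) * indicator {a} s \<partial>lborel)"
    by (rule distributed_emeasure[OF jump_time_distributed[OF assms]]) simp
  also have "\<dots> = 0"
    using AE_lborel_singleton[of a] by (intro nn_integral_zero' ) (auto elim!: eventually_mono)
  finally show ?thesis .
qed

lemma AE_jump_times_distinct:
  assumes "1 \<le> x" "1 \<le> y" "x \<noteq> y" "1 \<le> i" "1 \<le> j"
  shows "AE \<omega> in P. jump_time (N x) i \<omega> \<noteq> jump_time (N y) j \<omega>"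
proof -
  define f :: "real \<Rightarrow> 'b \<Rightarrow> ennreal" where "f a \<omega> = indicator {a} (jump_time (N y) j \<omega>)" for a \<omega>
  have [measurable]: "jump_time (N x) i \<in> borel_measurable P" "jump_time (N y) j \<in> borel_measurable P"
    using assms by simp_all
  have [measurable]: "jump_time (N y) j \<in> borel_measurable (info {Inl y})" by simp
  have "(\<lambda>(a, \<omega>). of_bool (a = jump_time (N y) j \<omega>) :: ennreal) \<in> borel_measurable (borel \<Otimes>\<^sub>M info {Inl y})"
    by measurable
  also have "(\<lambda>(a, \<omega>). of_bool (a = jump_time (N y) j \<omega>) :: ennreal) = case_prod f"
    by (auto simp: f_def fun_eq_iff indicator_def)
  finally have f: "case_prod f \<in> borel_measurable (borel \<Otimes>\<^sub>M info {Inl y})" .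
  have "emeasure P {\<omega>\<in>space P. jump_time (N x) i \<omega> = jump_time (N y) j \<omega>}
     = (\<integral>\<^sup>+\<omega>. indicator {\<omega>\<in>space P. jump_time (N x) i \<omega> = jump_time (N y) j \<omega>} \<omega> \<partial>P)"
    by simp
  also have "\<dots> = (\<integral>\<^sup>+\<omega>. f (jump_time (N x) i \<omega>) \<omega> \<partial>P)"
    by (intro nn_integral_cong) (auto simp: f_def indicator_def)
  also have "\<dots> = (\<integral>\<^sup>+ a. (\<integral>\<^sup>+\<omega>. f a \<omega> \<partial>P) \<partial>distr P borel (jump_time (N x) i))"
    using assms by (intro nn_integral_freeze[where K = "{Inl x}" and K' = "{Inl y}"] f) auto
  also have "\<dots> = (\<integral>\<^sup>+ a. 0 \<partial>distr P borel (jump_time (N x) i))"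
  proof (rule nn_integral_cong)
    fix a
    have "(\<integral>\<^sup>+\<omega>. f a \<omega> \<partial>P) = (\<integral>\<^sup>+\<omega>. indicator {\<omega>\<in>space P. jump_time (N y) j \<omega> = a} \<omega> \<partial>P)"
      by (intro nn_integral_cong) (auto simp: f_def indicator_def)
    then show "(\<integral>\<^sup>+\<omega>. f a \<omega> \<partial>P) = 0" using jump_time_no_atom[OF assms(2,5), of a] by simp
  qed
  finally show ?thesis
    by (intro AE_I[of _ _ "{\<omega>\<in>space P. jump_time (N x) i \<omega> = jump_time (N y) j \<omega>}"]) auto
qed

lemma prob_double_jump:
  assumes "1 \<le> x" "0 \<le> s" "0 < h"
  shows "prob {\<omega>\<in>space P. 2 \<le> N x (s + h) \<omega> - N x s \<omega>} \<le> h\<^sup>2"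
proof -
  have "prob {\<omega>\<in>space P. 2 \<le> N x (s + h) \<omega> - N x s \<omega>} = measure_pmf.prob (poisson_pmf h) {2..}"
    using prob_increment[OF assms(1,2), of "s + h" "{2..}"] assms by simp
  also have "{2..} = (UNIV :: nat set) - {0, 1}" by auto
  also have "measure_pmf.prob (poisson_pmf h) (UNIV - {0, 1}) = 1 - measure_pmf.prob (poisson_pmf h) {0, 1}"
    using measure_pmf.prob_compl[of "{0, 1}" "poisson_pmf h"] by simp
  also have "measure_pmf.prob (poisson_pmf h) {0, 1} = exp (- h) * (1 + h)"
    using assms by (subst measure_measure_pmf_finite) (auto simp: algebra_simps)
  also have "1 - exp (- h) * (1 + h) \<le> h\<^sup>2"
  proof -
    have "(1 - h) * (1 + h) \<le> exp (- h) * (1 + h)"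
      using exp_ge_add_one_self[of "- h"] assms by (intro mult_right_mono) auto
    then show ?thesis by (simp add: algebra_simps power2_eq_square)
  qed
  finally show ?thesis .
qed

text \<open>
  A double jump would produce an increment of at least 2 on one of the \<open>m / h\<close> intervals of
  length \<open>h\<close> that make up \<open>(0, m]\<close>. This has probability at most \<open>m h\<close>, which is arbitrarily small.
\<close>

lemma AE_jump_times_strict:
  assumes x: "1 \<le> x" and i: "1 \<le> i"
  shows "AE \<omega> in P. jump_time (N x) i \<omega> < jump_time (N x) (Suc i) \<omega>"
proof -
  have [measurable]: "jump_time (N x) i \<in> borel_measurable P" "jump_time (N x) (Suc i) \<in> borel_measurable P"
    using x by simp_all
  have "AE \<omega> in P. \<not> (jump_time (N x) i \<omega> = jump_time (N x) (Suc i) \<omega> \<and> jump_time (N x) i \<omega> \<le> real m)" for m :: nat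
  proof -
    let ?A = "{\<omega>\<in>space P. jump_time (N x) i \<omega> = jump_time (N x) (Suc i) \<omega> \<and> jump_time (N x) i \<omega> \<le> real m}"
    have "prob ?A \<le> real m * inverse (real (Suc n))" for n
    proof -
      \<comment> \<open>Mesh size of the grid on \<open>(0, m]\<close>; \<open>D k\<close> is a double jump in its interval number \<open>k\<close>.\<close>
      define h where "h = 1 / real (Suc n)"
      have h: "0 < h" by (simp add: h_def)
      define D where "D k = {\<omega>\<in>space P. 2 \<le> N x (real k * h + h) \<omega> - N x (real k * h) \<omega>}" for k :: nat
      have D: "D k \<in> sets P" for k
      proof -
        have [measurable]: "N x (real k * h + h) \<in> measurable P (count_space UNIV)" "N x (real k * h) \<in> measurable P (count_space UNIV)"
          using x h by simp_all
        show ?thesis unfolding D_def by measurable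
      qed
      have "prob ?A \<le> prob (\<Union>k<m * Suc n. D k)"
      proof (rule finite_measure_mono_AE)
        show "AE \<omega> in P. \<omega> \<in> ?A \<longrightarrow> \<omega> \<in> (\<Union>k<m * Suc n. D k)"
          using AE_counting_path[OF x] AE_space
        proof eventually_elim
          case (elim \<omega>)
          note jt = counting_path_jump_time[where n = "N x" and \<omega> = \<omega>, OF elim(1)]
          show ?case
          proof
            assume A: "\<omega> \<in> ?A"
            define \<sigma> where "\<sigma> = jump_time (N x) i \<omega>"
            have \<sigma>: "0 < \<sigma>" "\<sigma> \<le> real m" "jump_time (N x) (Suc i) \<omega> = \<sigma>"
              using A jt(3)[OF i] by (auto simp: \<sigma>_def)
            define k where "k = nat (\<lceil>\<sigma> / h\<rceil> - 1)"
            have "0 < \<sigma> / h" using \<sigma> h by simp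
            then have "real k = of_int \<lceil>\<sigma> / h\<rceil> - 1"
              unfolding k_def by (subst of_nat_nat) linarith+
            then have k: "real k < \<sigma> / h" "\<sigma> / h \<le> real k + 1" by linarith+
            then have kh: "real k * h < \<sigma>" "\<sigma> \<le> real k * h + h" using h by (auto simp: field_simps)
            have "real k * h < real m" using kh \<sigma> by simp
            then have "real k < real (m * Suc n)" by (simp add: h_def field_simps)
            then have "k < m * Suc n" by (simp only: of_nat_less_iff)
            moreover have "\<not> i \<le> N x (real k * h) \<omega>"
              using jt(2)[OF i, of "real k * h"] kh h by (simp add: \<sigma>_def)
            moreover have "Suc i \<le> N x (real k * h + h) \<omega>"
              using jt(2)[of "Suc i" "real k * h + h"] kh h \<sigma> by simp
            ultimately show "\<omega> \<in> (\<Union>k<m * Suc n. D k)"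
              using elim(2) by (auto simp: D_def intro!: bexI[of _ k])
          qed
        qed
      qed (use D in auto)
      also have "\<dots> \<le> (\<Sum>k<m * Suc n. prob (D k))"
        using D by (intro finite_measure_subadditive_finite) auto
      also have "\<dots> \<le> (\<Sum>k<m * Suc n. h\<^sup>2)"
        unfolding D_def using x h by (intro sum_mono prob_double_jump) auto
      also have "\<dots> = real m * (real (Suc n) * h\<^sup>2)"
        by (simp only: sum_constant card_lessThan of_nat_mult mult.assoc)
      also have "real (Suc n) * h\<^sup>2 = inverse (real (Suc n))"
        by (simp add: h_def power2_eq_square field_simps del: of_nat_Suc)
      finally show ?thesis .
    qed
    moreover have "(\<lambda>n. real m * inverse (real (Suc n))) \<longlonglongrightarrow> real m * 0"
      by (intro tendsto_intros LIMSEQ_inverse_real_of_nat)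
    ultimately show ?thesis by (intro AE_not_if_prob_le_null_sequence) simp_all
  qed
  then have "AE \<omega> in P. \<forall>m::nat. \<not> (jump_time (N x) i \<omega> = jump_time (N x) (Suc i) \<omega> \<and> jump_time (N x) i \<omega> \<le> real m)"
    unfolding AE_all_countable by blast
  then show ?thesis
    using AE_counting_path[OF x]
  proof eventually_elim
    case (elim \<omega>)
    note jt = counting_path_jump_time[where n = "N x" and \<omega> = \<omega>, OF elim(2)]
    have "jump_time (N x) i \<omega> \<noteq> jump_time (N x) (Suc i) \<omega>"
      using elim(1) real_arch_simple[of "jump_time (N x) i \<omega>"] by auto
    moreover have "jump_time (N x) i \<omega> \<le> jump_time (N x) (Suc i) \<omega>"
      using jt(2)[OF i, of "jump_time (N x) (Suc i) \<omega>"] jt(2)[of "Suc i" "jump_time (N x) (Suc i) \<omega>"] jt(3)[of "Suc i"]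
      by auto
    ultimately show ?case by simp
  qed
qed

text \<open>
  The processes with index at most \<open>n\<close> are all constant on \<open>(a, b]\<close> with probability
  \<open>exp (-(b - a)) ^ n\<close>.
\<close>

lemma AE_some_jump_between:
  assumes "0 \<le> a" "a < b"
  shows "AE \<omega> in P. \<exists>x\<ge>1. N x b \<omega> - N x a \<omega> \<noteq> 0"
proof -
  let ?A = "\<lambda>n. {\<omega>\<in>space P. \<forall>x\<in>{1..n}. N x b \<omega> - N x a \<omega> = 0}"
  let ?B = "{\<omega>\<in>space P. \<forall>x\<in>{1..}. N x b \<omega> - N x a \<omega> = 0}"
  have [measurable]: "N x b \<in> measurable P (count_space UNIV)" "N x a \<in> measurable P (count_space UNIV)" if "x \<in> {1..}" for x
    using assms that by auto
  have m: "(\<lambda>\<omega>. of_bool (N x b \<omega> - N x a \<omega> = 0) :: ennreal) \<in> borel_measurable (info {Inl x})" for x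
  proof -
    have [measurable]: "N x b \<in> measurable (info {Inl x}) (count_space UNIV)" "N x a \<in> measurable (info {Inl x}) (count_space UNIV)"
      using assms by (auto intro!: measurable_N_info)
    show ?thesis by measurable
  qed
  have B: "?B \<in> sets P" by measurable
  have A: "?A n \<in> sets P" for n by measurable
  have "emeasure P (?A n) = ennreal (exp (- (b - a)) ^ n)" for n
  proof -
    have "emeasure P (?A n) = (\<integral>\<^sup>+\<omega>. indicator (?A n) \<omega> \<partial>P)"
      using A by simp
    also have "\<dots> = (\<integral>\<^sup>+\<omega>. (\<Prod>x\<in>{1..n}. of_bool (N x b \<omega> - N x a \<omega> = 0)) \<partial>P)"
      by (intro nn_integral_cong) (auto simp: indicator_def)
    also have "\<dots> = (\<Prod>x\<in>{1..n}. \<integral>\<^sup>+\<omega>. of_bool (N x b \<omega> - N x a \<omega> = 0) \<partial>P)"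
      by (rule nn_integral_prod_info[where K = "\<lambda>x. {Inl x}"]) (use m in \<open>auto simp: disjoint_family_on_def\<close>)
    also have "\<dots> = (\<Prod>x\<in>{1..n}. ennreal (exp (- (b - a))))"
    proof (rule prod.cong)
      fix x assume x: "x \<in> {1..n}"
      have [measurable]: "N x b \<in> measurable P (count_space UNIV)" "N x a \<in> measurable P (count_space UNIV)"
        using assms x by simp_all
      have "(\<integral>\<^sup>+\<omega>. of_bool (N x b \<omega> - N x a \<omega> = 0) \<partial>P) = (\<integral>\<^sup>+\<omega>. indicator {\<omega>\<in>space P. N x b \<omega> - N x a \<omega> = 0} \<omega> \<partial>P)"
        by (intro nn_integral_cong) (auto simp: indicator_def)
      also have "\<dots> = emeasure P {\<omega>\<in>space P. N x b \<omega> - N x a \<omega> = 0}"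
        by (rule nn_integral_indicator) measurable
      also have "\<dots> = prob {\<omega>\<in>space P. N x b \<omega> - N x a \<omega> \<in> {0}}"
        by (simp add: emeasure_eq_measure)
      also have "prob {\<omega>\<in>space P. N x b \<omega> - N x a \<omega> \<in> {0}} = exp (- (b - a))"
        using x assms by (subst prob_increment) (auto simp: measure_pmf_single)
      finally show "(\<integral>\<^sup>+\<omega>. of_bool (N x b \<omega> - N x a \<omega> = 0) \<partial>P) = ennreal (exp (- (b - a)))" .
    qed simp
    finally show ?thesis by (simp add: ennreal_power)
  qed
  then have "prob (?A n) = exp (- (b - a)) ^ n" for n by (simp add: measure_def)
  moreover have "prob ?B \<le> prob (?A n)" for n
    using A by (intro finite_measure_mono) auto
  moreover have "(\<lambda>n. exp (- (b - a)) ^ n) \<longlonglongrightarrow> 0"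
    using assms by (intro LIMSEQ_realpow_zero) auto
  ultimately have "AE \<omega> in P. \<not> (\<forall>x\<in>{1..}. N x b \<omega> - N x a \<omega> = 0)"
    using B by (intro AE_not_if_prob_le_null_sequence) simp_all
  then show ?thesis by eventually_elim auto
qed

lemma T_distributed: "1 \<le> x \<Longrightarrow> 1 \<le> i \<Longrightarrow> distributed P lborel (T x i) (exponential_density 1)"
  using driver by (simp add: k_process_driver_def)

lemma prob_T_greater:
  assumes "1 \<le> x" "1 \<le> i" "0 \<le> a"
  shows "prob {\<omega>\<in>space P. a < T x i \<omega>} = exp (- a)"
  using exponential_distributedD_gt[OF T_distributed[OF assms(1,2)] assms(3)] by simp

lemma AE_T_pos: assumes "1 \<le> x" "1 \<le> i" shows "AE \<omega> in P. 0 < T x i \<omega>"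
proof -
  have [measurable]: "T x i \<in> borel_measurable P" using assms by simp
  have "prob {\<omega>\<in>space P. 0 < T x i \<omega>} = 1" using prob_T_greater[OF assms, of 0] by simp
  then show ?thesis by (subst (asm) prob_Collect_eq_1) auto
qed

lemma laplace_T:
  assumes "1 \<le> x" "1 \<le> i" "0 \<le> v"
  shows "(\<integral>\<^sup>+\<omega>. ennreal (exp (- (v * T x i \<omega>))) \<partial>P) = ennreal (1 / (1 + v))"
proof -
  have "(\<integral>\<^sup>+\<omega>. ennreal (exp (- (v * T x i \<omega>))) \<partial>P) = (\<integral>\<^sup>+ s. ennreal (exponential_density 1 s) * ennreal (exp (- (v * s))) \<partial>lborel)"
    by (rule distributed_nn_integral[OF T_distributed[OF assms(1,2)], symmetric]) simp
  also have "\<dots> = (\<integral>\<^sup>+ s. indicator {0<..} s * ennreal (exp (- ((1 + v) * s))) \<partial>lborel)"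
    using AE_lborel_singleton[of "0::real"]
    by (intro nn_integral_cong_AE)
       (auto elim!: eventually_mono simp: exponential_density_def ennreal_mult[symmetric] exp_add[symmetric] algebra_simps indicator_def)
  finally show ?thesis using assms by (simp add: nn_integral_exp_Ioi)
qed

end

section \<open>Laplace transforms of the clock\<close>

text \<open>
  The function \<open>exp (-l z)\<close> on extended nonnegative numbers, so that Laplace transforms of infinite sums
  can be computed before the sums are known to be finite.
\<close>

definition lap :: "real \<Rightarrow> ennreal \<Rightarrow> ennreal" where
  "lap l z = (if z = \<top> then 0 else ennreal (exp (- (l * enn2real z))))"

lemma measurable_lap [measurable]: "lap l \<in> borel_measurable borel"
  unfolding lap_def[abs_def] by measurable

lemma lap_ennreal: "0 \<le> a \<Longrightarrow> lap l (ennreal a) = ennreal (exp (- (l * a)))"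
  by (simp add: lap_def)

lemma lap_0 [simp]: "lap l 0 = 1"
  by (simp add: lap_def)

lemma lap_le_1: "0 \<le> l \<Longrightarrow> lap l z \<le> 1"
  by (simp add: lap_def)

lemma lap_add: "lap l (a + b) = lap l a * lap l b"
  by (cases a; cases b) (auto simp: lap_def ennreal_plus[symmetric] ennreal_mult[symmetric] exp_add[symmetric] algebra_simps simp del: ennreal_plus)

lemma lap_sum: "lap l (\<Sum>i\<in>F. f i) = (\<Prod>i\<in>F. lap l (f i))"
  by (induction F rule: infinite_finite_induct) (auto simp: lap_add)

lemma lap_suminf:
  assumes "0 < l" shows "(\<lambda>n. \<Prod>i<n. lap l (f i)) \<longlonglongrightarrow> lap l (\<Sum>i. f i)"
proof -
  have lim: "(\<lambda>n. \<Sum>i<n. f i) \<longlonglongrightarrow> (\<Sum>i. f i)"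
    by (rule summable_LIMSEQ) simp
  have "(\<lambda>n. lap l (\<Sum>i<n. f i)) \<longlonglongrightarrow> lap l (\<Sum>i. f i)"
  proof (cases "(\<Sum>i. f i) = \<top>")
    case False
    have "(\<Sum>i<n. f i) \<noteq> \<top>" for n
    proof
      assume "(\<Sum>i<n. f i) = \<top>"
      moreover have "(\<Sum>i<n. f i) \<le> (\<Sum>i. f i)" by (intro sum_le_suminf) auto
      ultimately show False using False by (metis top_unique)
    qed
    moreover have "(\<lambda>n. enn2real (\<Sum>i<n. f i)) \<longlonglongrightarrow> enn2real (\<Sum>i. f i)"
      using lim False by (intro tendsto_enn2real) (auto simp: less_top)
    ultimately show ?thesis
      using False by (auto simp: lap_def intro!: tendsto_intros)
  next
    case True
    show ?thesis
    proof (cases "\<exists>n0. (\<Sum>i<n0. f i) = \<top>")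
      case True
      then obtain n0 where "(\<Sum>i<n0. f i) = \<top>" by auto
      then have "(\<Sum>i<n. f i) = \<top>" if "n0 \<le> n" for n
        using sum_mono2[of "{..<n}" "{..<n0}" f] that by (auto simp: top_unique)
      then have "\<forall>\<^sub>F n in sequentially. lap l (\<Sum>i<n. f i) = lap l (\<Sum>i. f i)"
        unfolding eventually_sequentially \<open>(\<Sum>i. f i) = \<top>\<close> by metis
      then show ?thesis by (rule tendsto_eventually)
    next
      case False
      define r where "r n = enn2real (\<Sum>i<n. f i)" for n
      have r: "(\<Sum>i<n. f i) = ennreal (r n)" for n
        using False by (simp add: r_def less_top)
      have "(\<lambda>n. ennreal (r n)) \<longlonglongrightarrow> \<top>" using lim True by (simp add: r)
      then have "filterlim r at_top sequentially" by (simp add: ennreal_tendsto_top_eq_at_top)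
      then have "filterlim (\<lambda>n. l * r n) at_top sequentially"
        using assms by (intro filterlim_tendsto_pos_mult_at_top[OF tendsto_const])
      then have "(\<lambda>n. exp (- (l * r n))) \<longlonglongrightarrow> 0"
        by (intro filterlim_compose[OF exp_at_bot] filterlim_compose[OF filterlim_uminus_at_bot_at_top])
      then have "(\<lambda>n. ennreal (exp (- (l * r n)))) \<longlonglongrightarrow> ennreal 0" by (intro tendsto_ennrealI)
      moreover have "0 \<le> r n" for n by (simp add: r_def)
      ultimately show ?thesis using True by (simp add: r lap_ennreal) (simp add: lap_def)
    qed
  qed
  then show ?thesis by (simp add: lap_sum)
qed

context driver begin

text \<open>
  The time spent at \<open>y\<close>, up to the factor \<open>g y\<close>, when the driving processes have run up to \<open>s\<close>. The
  sum over all visits, cut off by indicators, is jointly measurable in \<open>s\<close> and the outcome.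
\<close>

definition local_clock :: "nat \<Rightarrow> real \<Rightarrow> 'b \<Rightarrow> ennreal" where
  "local_clock y s \<omega> = (\<Sum>i. ennreal (T y (Suc i) \<omega>) * indicator {..s} (jump_time (N y) (Suc i) \<omega>))"

definition group :: "nat \<Rightarrow> (nat + nat \<times> nat) set" where
  "group y = insert (Inl y) (Inr ` ({y} \<times> {1..}))"

lemma group_subset: "1 \<le> y \<Longrightarrow> group y \<subseteq> sources"
  by (auto simp: group_def)

lemma group_disjoint: "x \<noteq> y \<Longrightarrow> group x \<inter> group y = {}"
  by (auto simp: group_def)

lemma measurable_local_clock:
  assumes "group y \<subseteq> K"
  shows "(\<lambda>(s, \<omega>). local_clock y s \<omega>) \<in> borel_measurable (borel \<Otimes>\<^sub>M info K)"
proof -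
  have [measurable]: "T y (Suc i) \<in> borel_measurable (info K)" "jump_time (N y) (Suc i) \<in> borel_measurable (info K)" for i
    using assms by (auto intro!: measurable_T_info measurable_jump_time_info simp: group_def)
  have "(\<lambda>(s, \<omega>). local_clock y s \<omega>) = (\<lambda>z. \<Sum>i. ennreal (T y (Suc i) (snd z)) * of_bool (jump_time (N y) (Suc i) (snd z) \<le> fst z))"
    by (auto simp: local_clock_def fun_eq_iff indicator_def)
  also have "\<dots> \<in> borel_measurable (borel \<Otimes>\<^sub>M info K)" by measurable
  finally show ?thesis .
qed

lemma measurable_local_clock_at [measurable]:
  assumes "group y \<subseteq> K"
  shows "local_clock y s \<in> borel_measurable (info K)"
  using measurable_compose[OF measurable_Pair1'[of s borel "info K"] measurable_local_clock[OF assms]] by simp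

lemma AE_local_clock:
  assumes "1 \<le> y"
  shows "AE \<omega> in P. \<forall>s\<ge>0. local_clock y s \<omega> = ennreal (\<Sum>i=1..N y s \<omega>. T y i \<omega>)"
proof -
  have "AE \<omega> in P. \<forall>i. 0 < T y (Suc i) \<omega>"
    using assms by (simp add: AE_all_countable AE_T_pos)
  then show ?thesis using AE_counting_path[OF assms]
  proof eventually_elim
    case (elim \<omega>)
    show ?case
    proof (intro allI impI)
      fix s :: real assume s: "0 \<le> s"
      have "indicator {..s} (jump_time (N y) (Suc i) \<omega>) = (indicator {..<N y s \<omega>} i :: ennreal)" for i
        using counting_path_jump_time(2)[where n = "N y" and \<omega> = \<omega>, OF elim(2) _ s, of "Suc i"]
        by (auto simp: indicator_def)
      then have "local_clock y s \<omega> = (\<Sum>i. ennreal (T y (Suc i) \<omega>) * indicator {..<N y s \<omega>} i)"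
        by (simp add: local_clock_def)
      also have "\<dots> = (\<Sum>i<N y s \<omega>. ennreal (T y (Suc i) \<omega>))"
        by (subst suminf_finite[of "{..<N y s \<omega>}"]) auto
      also have "\<dots> = ennreal (\<Sum>i<N y s \<omega>. T y (Suc i) \<omega>)"
        using elim(1) by (intro sum_ennreal) (auto intro: less_imp_le)
      also have "(\<Sum>i<N y s \<omega>. T y (Suc i) \<omega>) = (\<Sum>i=1..N y s \<omega>. T y i \<omega>)"
        by (simp add: sum.atLeast1_atMost_eq)
      finally show "local_clock y s \<omega> = ennreal (\<Sum>i=1..N y s \<omega>. T y i \<omega>)" .
    qed
  qed
qed

text \<open>
  A compound Poisson computation: given \<open>n\<close> visits, the transform is the \<open>n\<close>-th power of that of
  one exponential variable, and the number of visits is Poisson.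
\<close>

lemma laplace_local_clock:
  assumes y: "1 \<le> y" and s: "0 \<le> s" and lc: "0 \<le> l" "0 \<le> c"
  shows "(\<integral>\<^sup>+\<omega>. lap l (ennreal c * local_clock y s \<omega>) \<partial>P) = ennreal (exp (- (s * (l * c / (1 + l * c)))))"
proof -
  define v where "v = l * c"
  have v: "0 \<le> v" using lc by (simp add: v_def)
  define X where "X n j \<omega> = (if j = 0 then of_bool (N y s \<omega> = n) else ennreal (exp (- (v * T y j \<omega>))))" for n j :: nat and \<omega>
  define K where "K j = (if j = 0 then {Inl y} else {Inr (y, j)})" for j :: nat
  have X: "X n j \<in> borel_measurable (info (K j))" for n j
  proof -
    have [measurable]: "N y s \<in> measurable (info {Inl y}) (count_space UNIV)"
      using s by (auto intro: measurable_N_info)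
    have [measurable]: "T y j \<in> borel_measurable (info {Inr (y, j)})" by (auto intro: measurable_T_info)
    show ?thesis by (cases "j = 0") (simp_all add: X_def[abs_def] K_def)
  qed
  have K: "K j \<subseteq> sources" for j using y by (auto simp: K_def)
  have XP: "X n j \<in> borel_measurable P" for n j by (rule measurable_from_info[OF X K])
  \<comment> \<open>Split according to the number \<open>n\<close> of visits; only one summand is nonzero.\<close>
  have "AE \<omega> in P. \<forall>i. 0 < T y (Suc i) \<omega>"
    using y by (simp add: AE_all_countable AE_T_pos)
  then have "AE \<omega> in P. lap l (ennreal c * local_clock y s \<omega>) = (\<Sum>n. \<Prod>j\<in>{0..n}. X n j \<omega>)"
    using AE_local_clock[OF y]
  proof eventually_elim
    case (elim \<omega>)
    have T: "0 \<le> T y i \<omega>" if "1 \<le> i" for i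
      using that elim(1)[rule_format, of "i - 1"] by simp
    have "0 \<le> (\<Sum>i=1..N y s \<omega>. T y i \<omega>)" by (intro sum_nonneg T) auto
    then have "lap l (ennreal c * local_clock y s \<omega>) = lap l (ennreal (c * (\<Sum>i=1..N y s \<omega>. T y i \<omega>)))"
      using elim(2) s lc by (simp add: ennreal_mult)
    also have "\<dots> = ennreal (exp (- (v * (\<Sum>i=1..N y s \<omega>. T y i \<omega>))))"
      using lc T by (subst lap_ennreal) (auto intro!: mult_nonneg_nonneg sum_nonneg simp: v_def mult.assoc)
    also have "\<dots> = (\<Prod>i\<in>{1..N y s \<omega>}. ennreal (exp (- (v * T y i \<omega>))))"
      by (subst prod_ennreal) (auto simp: exp_sum[symmetric] sum_distrib_left sum_negf)
    finally have eq: "lap l (ennreal c * local_clock y s \<omega>) = (\<Prod>i\<in>{1..N y s \<omega>}. ennreal (exp (- (v * T y i \<omega>))))" .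
    have "(\<Prod>j\<in>{0..n}. X n j \<omega>) = of_bool (N y s \<omega> = n) * (\<Prod>i\<in>{1..n}. ennreal (exp (- (v * T y i \<omega>))))" for n
      by (subst prod.atLeast_Suc_atMost) (auto simp: X_def intro!: prod.cong)
    then have "(\<Sum>n. \<Prod>j\<in>{0..n}. X n j \<omega>) = (\<Sum>n\<in>{N y s \<omega>}. of_bool (N y s \<omega> = n) * (\<Prod>i\<in>{1..n}. ennreal (exp (- (v * T y i \<omega>)))))"
      by (subst suminf_finite[of "{N y s \<omega>}"]) auto
    with eq show ?case by simp
  qed
  then have "(\<integral>\<^sup>+\<omega>. lap l (ennreal c * local_clock y s \<omega>) \<partial>P) = (\<integral>\<^sup>+\<omega>. (\<Sum>n. \<Prod>j\<in>{0..n}. X n j \<omega>) \<partial>P)"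
    by (rule nn_integral_cong_AE)
  also have "\<dots> = (\<Sum>n. \<integral>\<^sup>+\<omega>. (\<Prod>j\<in>{0..n}. X n j \<omega>) \<partial>P)"
    using XP by (intro nn_integral_suminf) auto
  also have "\<dots> = (\<Sum>n. ennreal (exp (- s) * ((s / (1 + v)) ^ n /\<^sub>R fact n)))"
  proof (rule suminf_cong)
    fix n
    have "(\<integral>\<^sup>+\<omega>. (\<Prod>j\<in>{0..n}. X n j \<omega>) \<partial>P) = (\<Prod>j\<in>{0..n}. \<integral>\<^sup>+\<omega>. X n j \<omega> \<partial>P)"
      by (rule nn_integral_prod_info[where K = K])
         (use X K in \<open>auto simp: K_def disjoint_family_on_def\<close>)
    also have "\<dots> = (\<integral>\<^sup>+\<omega>. X n 0 \<omega> \<partial>P) * (\<Prod>j\<in>{1..n}. \<integral>\<^sup>+\<omega>. X n j \<omega> \<partial>P)"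
      by (subst prod.atLeast_Suc_atMost) auto
    also have "(\<Prod>j\<in>{1..n}. \<integral>\<^sup>+\<omega>. X n j \<omega> \<partial>P) = (\<Prod>j\<in>{1..n}. ennreal (1 / (1 + v)))"
      using y v by (intro prod.cong) (auto simp: X_def laplace_T)
    also have "(\<integral>\<^sup>+\<omega>. X n 0 \<omega> \<partial>P) = (\<integral>\<^sup>+\<omega>. indicator {\<omega>\<in>space P. N y s \<omega> = n} \<omega> \<partial>P)"
      by (intro nn_integral_cong) (auto simp: X_def indicator_def)
    also have "\<dots> = emeasure P {\<omega>\<in>space P. N y s \<omega> = n}"
    proof (rule nn_integral_indicator)
      have [measurable]: "N y s \<in> measurable P (count_space UNIV)" using y s by simp
      show "{\<omega>\<in>space P. N y s \<omega> = n} \<in> sets P" by measurable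
    qed
    also have "\<dots> = ennreal (s ^ n / fact n * exp (- s))"
      using y s by (simp add: emeasure_eq_measure prob_count)
    finally show "(\<integral>\<^sup>+\<omega>. (\<Prod>j\<in>{0..n}. X n j \<omega>) \<partial>P) = ennreal (exp (- s) * ((s / (1 + v)) ^ n /\<^sub>R fact n))"
      using v s by (simp add: ennreal_power ennreal_mult[symmetric] power_divide field_simps)
  qed
  also have "\<dots> = ennreal (\<Sum>n. exp (- s) * ((s / (1 + v)) ^ n /\<^sub>R fact n))"
    using v s by (intro suminf_ennreal2 summable_mult summable_exp_generic) auto
  also have "(\<Sum>n. exp (- s) * ((s / (1 + v)) ^ n /\<^sub>R fact n)) = exp (- s) * exp (s / (1 + v))"
    unfolding suminf_mult[OF summable_exp_generic] by (simp add: exp_def)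
  also have "\<dots> = exp (- (s * (v / (1 + v))))"
  proof -
    have "- s + s / (1 + v) = - (s * (v / (1 + v)))" using v by (simp add: field_simps)
    then show ?thesis by (simp only: exp_add[symmetric])
  qed
  finally show ?thesis by (simp add: v_def)
qed

end

text \<open>
  For \<open>x \<ge> 1\<close>, \<open>rest_clock x\<close> is the clock without the contribution of \<open>x\<close>, which is independent of
  everything that happens at \<open>x\<close>; since 0 is not a state, \<open>rest_clock 0\<close> is the full clock.
  \<open>before x m\<close> is the value of the clock just before the visit number \<open>m + 1\<close> to \<open>x\<close>: the first \<open>m\<close>
  visits to \<open>x\<close>, and the rest of the clock at the jump time. The Laplace exponent of
  \<open>rest_clock x\<close> is \<open>rest_exponent x\<close>.
\<close>

locale k_setup = driver P N T + regular_weights g \<alpha>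
  for P :: "'b measure" and N T and g :: "nat \<Rightarrow> real" and \<alpha> :: real
begin

definition rest_clock :: "nat \<Rightarrow> real \<Rightarrow> 'b \<Rightarrow> ennreal" where
  "rest_clock x s \<omega> = (\<Sum>i. if Suc i = x then 0 else ennreal (g (Suc i)) * local_clock (Suc i) s \<omega>)"

definition rest_group :: "nat \<Rightarrow> (nat + nat \<times> nat) set" where
  "rest_group x = (\<Union>y\<in>{1..} - {x}. group y)"

definition rest_exponent :: "nat \<Rightarrow> real \<Rightarrow> real" where
  "rest_exponent x l = (\<Sum>i. if Suc i = x then 0 else l * g (Suc i) / (1 + l * g (Suc i)))"

definition before :: "nat \<Rightarrow> nat \<Rightarrow> 'b \<Rightarrow> ennreal" where
  "before x m \<omega> = (\<Sum>i<m. ennreal (g x * T x (Suc i) \<omega>)) + rest_clock x (jump_time (N x) (Suc m) \<omega>) \<omega>"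

lemma rest_group_subset: "rest_group x \<subseteq> sources"
  using group_subset by (auto simp: rest_group_def)

lemma measurable_rest_clock:
  assumes "rest_group x \<subseteq> K"
  shows "(\<lambda>(s, \<omega>). rest_clock x s \<omega>) \<in> borel_measurable (borel \<Otimes>\<^sub>M info K)"
proof -
  have [measurable]: "(\<lambda>z. if Suc i = x then 0 else ennreal (g (Suc i)) * (case z of (s, \<omega>) \<Rightarrow> local_clock (Suc i) s \<omega>))
      \<in> borel_measurable (borel \<Otimes>\<^sub>M info K)" for i
  proof (cases "Suc i = x")
    case False
    then have "group (Suc i) \<subseteq> K" using assms by (auto simp: rest_group_def)
    from measurable_local_clock[OF this] False show ?thesis by simp
  qed simp
  have eq: "(\<lambda>(s, \<omega>). rest_clock x s \<omega>) = (\<lambda>z. \<Sum>i. if Suc i = x then 0 else ennreal (g (Suc i)) * (case z of (s, \<omega>) \<Rightarrow> local_clock (Suc i) s \<omega>))"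
    by (auto simp: fun_eq_iff rest_clock_def)
  show ?thesis
    unfolding eq by measurable
qed

lemma measurable_rest_clock_at:
  "rest_clock x s \<in> borel_measurable (info (rest_group x))"
  using measurable_compose[OF measurable_Pair1'[of s borel "info (rest_group x)"] measurable_rest_clock[of x "rest_group x"]] by simp

lemma measurable_rest_clock_P: "rest_clock x s \<in> borel_measurable P"
  by (rule measurable_from_info[OF measurable_rest_clock_at rest_group_subset])

lemma exponent_summand: "0 \<le> l \<Longrightarrow> 0 \<le> l * g (Suc i) / (1 + l * g (Suc i))"
  "0 \<le> l \<Longrightarrow> l * g (Suc i) / (1 + l * g (Suc i)) \<le> l * g (Suc i)"
proof -
  assume l: "0 \<le> l"
  then have *: "0 \<le> l * g (Suc i)" by (intro mult_nonneg_nonneg) auto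
  then show "0 \<le> l * g (Suc i) / (1 + l * g (Suc i))" by simp
  from * have "l * g (Suc i) * 1 \<le> l * g (Suc i) * (1 + l * g (Suc i))" by (intro mult_left_mono) auto
  with * show "l * g (Suc i) / (1 + l * g (Suc i)) \<le> l * g (Suc i)" by (simp add: divide_le_eq)
qed

lemma summable_exponent: "0 \<le> l \<Longrightarrow> Series.summable (\<lambda>i. l * g (Suc i) / (1 + l * g (Suc i)))"
  using exponent_summand
  by (intro summable_comparison_test'[OF summable_mult[OF summable, of l], of 0]) auto

lemma summable_rest_exponent:
  "0 \<le> l \<Longrightarrow> Series.summable (\<lambda>i. if Suc i = x then 0 else l * g (Suc i) / (1 + l * g (Suc i)))"
  using exponent_summand
  by (intro summable_comparison_test'[OF summable_exponent, of _ 0]) auto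

lemma rest_exponent_nonneg: "0 \<le> l \<Longrightarrow> 0 \<le> rest_exponent x l"
  unfolding rest_exponent_def using exponent_summand by (intro suminf_nonneg summable_rest_exponent) auto

lemma rest_exponent_0: "rest_exponent 0 l = (\<Sum>i. l * g (Suc i) / (1 + l * g (Suc i)))"
  by (simp add: rest_exponent_def)

lemma rest_exponent_0_pos: "0 < l \<Longrightarrow> 0 < rest_exponent 0 l"
  unfolding rest_exponent_0 using summable_exponent[of l]
  by (intro suminf_pos) (auto intro!: divide_pos_pos mult_pos_pos add_pos_pos)

lemma rest_exponent_0_le: "0 \<le> l \<Longrightarrow> rest_exponent 0 l \<le> l * (\<Sum>i. g (Suc i))"
  unfolding rest_exponent_0 suminf_mult[OF summable, symmetric]
  by (intro suminf_le exponent_summand summable_exponent summable_mult summable)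

lemma laplace_exponent_eq_rest: "0 \<le> l \<Longrightarrow> laplace_exponent l = ennreal (rest_exponent 0 l)"
  unfolding laplace_exponent_def rest_exponent_0
  using exponent_summand by (intro suminf_ennreal2 summable_exponent) auto

lemma rest_exponent_split:
  assumes "1 \<le> x" "0 \<le> l"
  shows "rest_exponent 0 l = rest_exponent x l + l * g x / (1 + l * g x)"
proof -
  have "(\<lambda>i. (if Suc i = x then 0 else l * g (Suc i) / (1 + l * g (Suc i))) + (if i = x - 1 then l * g (Suc i) / (1 + l * g (Suc i)) else 0))
     sums (rest_exponent x l + l * g (Suc (x - 1)) / (1 + l * g (Suc (x - 1))))"
    unfolding rest_exponent_def
    by (intro sums_add summable_sums summable_rest_exponent assms sums_single)
  moreover have "(if Suc i = x then 0 else l * g (Suc i) / (1 + l * g (Suc i))) + (if i = x - 1 then l * g (Suc i) / (1 + l * g (Suc i)) else 0)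
     = l * g (Suc i) / (1 + l * g (Suc i))" for i
    using assms by auto
  ultimately show ?thesis
    using assms by (simp add: rest_exponent_0 sums_unique[symmetric])
qed

lemma laplace_rest_clock:
  assumes l: "0 < l" and s: "0 \<le> s"
  shows "(\<integral>\<^sup>+\<omega>. lap l (rest_clock x s \<omega>) \<partial>P) = ennreal (exp (- (s * rest_exponent x l)))"
proof -
  define F where "F i \<omega> = (if Suc i = x then 0 else ennreal (g (Suc i)) * local_clock (Suc i) s \<omega>)" for i \<omega>
  define c where "c i = (if Suc i = x then 0 else l * g (Suc i) / (1 + l * g (Suc i)))" for i
  have F: "F i \<in> borel_measurable (info (group (Suc i)))" for i
  proof -
    have [measurable]: "local_clock (Suc i) s \<in> borel_measurable (info (group (Suc i)))" by simp
    show ?thesis by (cases "Suc i = x") (simp_all add: F_def[abs_def])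
  qed
  have FP [measurable]: "F i \<in> borel_measurable P" for i by (rule measurable_from_info[OF F group_subset]) simp
  have LF: "(\<lambda>\<omega>. lap l (F i \<omega>)) \<in> borel_measurable (info (group (Suc i)))" for i
    using F by (rule measurable_compose) measurable
  have "(\<lambda>n. \<integral>\<^sup>+\<omega>. (\<Prod>i<n. lap l (F i \<omega>)) \<partial>P) \<longlonglongrightarrow> (\<integral>\<^sup>+\<omega>. lap l (rest_clock x s \<omega>) \<partial>P)"
  proof (rule nn_integral_dominated_convergence[where w = "\<lambda>_. 1"])
    show "AE \<omega> in P. (\<Prod>i<n. lap l (F i \<omega>)) \<le> 1" for n
      using l by (intro always_eventually allI prod_le_1) (auto simp: lap_le_1)
    show "AE \<omega> in P. (\<lambda>n. \<Prod>i<n. lap l (F i \<omega>)) \<longlonglongrightarrow> lap l (rest_clock x s \<omega>)"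
      using lap_suminf[OF l] by (auto simp: rest_clock_def F_def)
    have [measurable]: "rest_clock x s \<in> borel_measurable P" by (rule measurable_rest_clock_P)
    show "(\<lambda>\<omega>. lap l (rest_clock x s \<omega>)) \<in> borel_measurable P" by measurable
  qed (auto simp: emeasure_space_1)
  moreover have "(\<integral>\<^sup>+\<omega>. (\<Prod>i<n. lap l (F i \<omega>)) \<partial>P) = ennreal (exp (- (s * (\<Sum>i<n. c i))))" for n
  proof -
    have "(\<integral>\<^sup>+\<omega>. (\<Prod>i<n. lap l (F i \<omega>)) \<partial>P) = (\<Prod>i<n. \<integral>\<^sup>+\<omega>. lap l (F i \<omega>) \<partial>P)"
      using LF by (intro nn_integral_prod_info[where K = "\<lambda>i. group (Suc i)"])
        (auto simp: disjoint_family_on_def group_subset group_disjoint)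
    also have "\<dots> = (\<Prod>i<n. ennreal (exp (- (s * c i))))"
    proof (rule prod.cong)
      fix i
      show "(\<integral>\<^sup>+\<omega>. lap l (F i \<omega>) \<partial>P) = ennreal (exp (- (s * c i)))"
        using laplace_local_clock[of "Suc i" s l "g (Suc i)"] s l
        by (simp add: F_def c_def emeasure_space_1)
    qed simp
    also have "\<dots> = ennreal (exp (- (s * (\<Sum>i<n. c i))))"
      by (subst prod_ennreal) (auto simp: exp_sum[symmetric] sum_distrib_left sum_negf)
    finally show ?thesis .
  qed
  moreover have "(\<lambda>n. \<Sum>i<n. c i) \<longlonglongrightarrow> rest_exponent x l"
    unfolding c_def rest_exponent_def using l by (intro summable_LIMSEQ summable_rest_exponent) auto
  then have "(\<lambda>n. ennreal (exp (- (s * (\<Sum>i<n. c i))))) \<longlonglongrightarrow> ennreal (exp (- (s * rest_exponent x l)))"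
    by (intro tendsto_intros)
  ultimately show ?thesis by (simp add: LIMSEQ_unique)
qed

lemma local_clock_mono: "s \<le> s' \<Longrightarrow> local_clock y s \<omega> \<le> local_clock y s' \<omega>"
  unfolding local_clock_def by (intro suminf_le) (auto simp: indicator_def)

lemma rest_clock_mono: "s \<le> s' \<Longrightarrow> rest_clock x s \<omega> \<le> rest_clock 0 s' \<omega>"
  unfolding rest_clock_def by (intro suminf_le) (auto intro!: mult_left_mono local_clock_mono)

text \<open>
  The Laplace transform \<open>exp (-s \<psi>(l))\<close> is at most \<open>P(clock < \<infinity>)\<close>, and it tends to 1 as \<open>l\<close>
  tends to 0 because \<open>\<psi>(l)\<close> is at most \<open>l\<close> times the sum of the weights.
\<close>

lemma AE_clock_finite: "AE \<omega> in P. \<forall>s. rest_clock x s \<omega> < \<top>"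
proof -
  have "AE \<omega> in P. rest_clock 0 (real n) \<omega> < \<top>" for n
  proof -
    have [measurable]: "rest_clock 0 (real n) \<in> borel_measurable P" by (rule measurable_rest_clock_P)
    let ?A = "{\<omega>\<in>space P. rest_clock 0 (real n) \<omega> < \<top>}"
    \<comment> \<open>The transform at \<open>l = 1 / (k + 1)\<close>, which is at most the indicator of finiteness.\<close>
    have "ennreal (exp (- (real n * (inverse (real (Suc k)) * (\<Sum>i. g (Suc i)))))) \<le> ennreal (prob ?A)" for k
    proof -
      let ?l = "inverse (real (Suc k))"
      have "ennreal (exp (- (real n * (?l * (\<Sum>i. g (Suc i)))))) \<le> ennreal (exp (- (real n * rest_exponent 0 ?l)))"
        using rest_exponent_0_le[of ?l] by (intro ennreal_leI) (auto intro!: mult_left_mono)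
      also have "\<dots> = (\<integral>\<^sup>+\<omega>. lap ?l (rest_clock 0 (real n) \<omega>) \<partial>P)"
        by (subst laplace_rest_clock) auto
      also have "\<dots> \<le> (\<integral>\<^sup>+\<omega>. indicator ?A \<omega> \<partial>P)"
        by (intro nn_integral_mono) (auto simp: indicator_def lap_le_1 lap_def[of _ \<top>] less_top[symmetric])
      also have "\<dots> = ennreal (prob ?A)"
        by (subst nn_integral_indicator) (auto simp: emeasure_eq_measure)
      finally show ?thesis .
    qed
    then have "exp (- (real n * (inverse (real (Suc k)) * (\<Sum>i. g (Suc i))))) \<le> prob ?A" for k
      by (simp del: of_nat_Suc)
    moreover have "(\<lambda>k. exp (- (real n * (inverse (real (Suc k)) * (\<Sum>i. g (Suc i)))))) \<longlonglongrightarrow> exp (- (real n * (0 * (\<Sum>i. g (Suc i)))))"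
      by (intro tendsto_intros LIMSEQ_inverse_real_of_nat)
    ultimately have "exp (- (real n * (0 * (\<Sum>i. g (Suc i))))) \<le> prob ?A"
      by (intro LIMSEQ_le_const2[of _ _ "prob ?A"]) auto
    then have "prob ?A = 1" using prob_le_1[of ?A] by simp
    then show ?thesis by (subst (asm) prob_Collect_eq_1) auto
  qed
  then have "AE \<omega> in P. \<forall>n::nat. rest_clock 0 (real n) \<omega> < \<top>" unfolding AE_all_countable by blast
  then show ?thesis
  proof eventually_elim
    case (elim \<omega>)
    show ?case
    proof
      fix s
      obtain n :: nat where "s \<le> real n" using real_arch_simple by blast
      from rest_clock_mono[OF this, of x \<omega>] elim show "rest_clock x s \<omega> < \<top>"
        by (auto intro: le_less_trans)
    qed
  qed
qed

text \<open>
  Markov's inequality for \<open>exp (-clock)\<close>, whose mean decays geometrically in time.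
\<close>

lemma AE_clock_unbounded: "AE \<omega> in P. \<forall>K::real. \<exists>s. ennreal K < rest_clock 0 s \<omega>"
proof -
  have "AE \<omega> in P. \<exists>n::nat. ennreal (real K) < rest_clock 0 (real n) \<omega>" for K :: nat
  proof -
    let ?A = "{\<omega>\<in>space P. \<not> (\<exists>n::nat. ennreal (real K) < rest_clock 0 (real n) \<omega>)}"
    have [measurable]: "rest_clock 0 (real n) \<in> borel_measurable P" for n by (rule measurable_rest_clock_P)
    have A: "?A \<in> sets P" by measurable
    have le: "prob ?A \<le> exp (real K) * exp (- rest_exponent 0 1) ^ n" for n
    proof -
      have "indicator ?A \<omega> \<le> ennreal (exp (real K)) * lap 1 (rest_clock 0 (real n) \<omega>)" for \<omega>
      proof (cases "\<omega> \<in> ?A")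
        case True
        then have "rest_clock 0 (real n) \<omega> \<le> ennreal (real K)" by (auto simp: not_less)
        then obtain r where r: "rest_clock 0 (real n) \<omega> = ennreal r" "0 \<le> r" "r \<le> real K"
          by (cases "rest_clock 0 (real n) \<omega>") (auto simp: ennreal_le_iff top_unique)
        then have "1 \<le> ennreal (exp (real K) * exp (- r))"
          by (simp add: exp_add[symmetric])
        then show ?thesis using True r by (simp add: lap_ennreal ennreal_mult)
      qed simp
      then have "(\<integral>\<^sup>+\<omega>. indicator ?A \<omega> \<partial>P) \<le> (\<integral>\<^sup>+\<omega>. ennreal (exp (real K)) * lap 1 (rest_clock 0 (real n) \<omega>) \<partial>P)"
        by (intro nn_integral_mono) blast
      also have "\<dots> = ennreal (exp (real K)) * ennreal (exp (- (real n * rest_exponent 0 1)))"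
        by (subst nn_integral_cmult) (auto simp: laplace_rest_clock)
      finally have "ennreal (prob ?A) \<le> ennreal (exp (real K) * exp (- (real n * rest_exponent 0 1)))"
        using A by (simp add: emeasure_eq_measure ennreal_mult)
      then show ?thesis
        by (subst (asm) ennreal_le_iff) (auto simp: exp_of_nat_mult[symmetric])
    qed
    have "(\<lambda>n. exp (real K) * exp (- rest_exponent 0 1) ^ n) \<longlonglongrightarrow> exp (real K) * 0"
      using rest_exponent_0_pos[of 1] by (intro tendsto_mult tendsto_const LIMSEQ_realpow_zero) auto
    then have lim: "(\<lambda>n. exp (real K) * exp (- rest_exponent 0 1) ^ n) \<longlonglongrightarrow> 0" by (simp only: mult_zero_right)
    have "AE \<omega> in P. \<not> \<not> (\<exists>n::nat. ennreal (real K) < rest_clock 0 (real n) \<omega>)"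
      by (rule AE_not_if_prob_le_null_sequence[OF A le lim])
    then show ?thesis by simp
  qed
  then have "AE \<omega> in P. \<forall>K::nat. \<exists>n::nat. ennreal (real K) < rest_clock 0 (real n) \<omega>" unfolding AE_all_countable by blast
  then show ?thesis
  proof eventually_elim
    case (elim \<omega>)
    show ?case
    proof
      fix K :: real
      obtain k :: nat where "K \<le> real k" using real_arch_simple by blast
      then have "ennreal K \<le> ennreal (real k)" by (rule ennreal_leI)
      with elim show "\<exists>s. ennreal K < rest_clock 0 s \<omega>" by (meson le_less_trans)
    qed
  qed
qed

end

section \<open>The potential measure of the clock\<close>

context k_setup begin

lemma measurable_before_info:
  assumes "insert (Inl x) (rest_group x) \<subseteq> K" "\<And>i. i < m \<Longrightarrow> Inr (x, Suc i) \<in> K"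
  shows "before x m \<in> borel_measurable (info K)"
proof -
  have "jump_time (N x) (Suc m) \<in> borel_measurable (info K)"
    using assms(1) by (intro measurable_jump_time_info) auto
  then have "(\<lambda>\<omega>. (jump_time (N x) (Suc m) \<omega>, \<omega>)) \<in> measurable (info K) (borel \<Otimes>\<^sub>M info K)" by simp
  from measurable_compose[OF this measurable_rest_clock[of x K]] assms(1)
  have [measurable]: "(\<lambda>\<omega>. rest_clock x (jump_time (N x) (Suc m) \<omega>) \<omega>) \<in> borel_measurable (info K)" by simp
  have [measurable]: "T x (Suc i) \<in> borel_measurable (info K)" if "i \<in> {..<m}" for i
    using assms(2) that by (intro measurable_T_info) auto
  show ?thesis unfolding before_def[abs_def] by measurable
qed

definition before_group :: "nat \<Rightarrow> nat \<Rightarrow> (nat + nat \<times> nat) set" where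
  "before_group x m = insert (Inl x) (rest_group x) \<union> (\<lambda>i. Inr (x, Suc i)) ` {..<m}"

lemma before_group_subset: "1 \<le> x \<Longrightarrow> before_group x m \<subseteq> sources"
  using rest_group_subset by (auto simp: before_group_def)

lemma measurable_before: "before x m \<in> borel_measurable (info (before_group x m))"
  by (rule measurable_before_info) (auto simp: before_group_def)

lemma measurable_before_P [measurable]: "1 \<le> x \<Longrightarrow> before x m \<in> borel_measurable P"
  by (rule measurable_from_info[OF measurable_before before_group_subset])

lemma laplace_erlang:
  assumes "0 \<le> q"
  shows "(\<integral>\<^sup>+ s. ennreal (erlang_density m 1 s) * ennreal (exp (- (s * q))) \<partial>lborel) = ennreal ((1 / (1 + q)) ^ Suc m)"
proof -
  have "(\<integral>\<^sup>+ s. ennreal (erlang_density m 1 s) * ennreal (exp (- (s * q))) \<partial>lborel)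
    = (\<integral>\<^sup>+ s. ennreal (1 / fact m) * (indicator {0<..} s * ennreal (s powr (real (Suc m) - 1) * exp (- ((1 + q) * s)))) \<partial>lborel)"
  proof (rule nn_integral_cong_AE)
    show "AE s in lborel. ennreal (erlang_density m 1 s) * ennreal (exp (- (s * q))) =
       ennreal (1 / fact m) * (indicator {0<..} s * ennreal (s powr (real (Suc m) - 1) * exp (- ((1 + q) * s))))"
      using AE_lborel_singleton[of "0::real"]
    proof eventually_elim
      case (elim s)
      show ?case
      proof (cases "0 < s")
        case True
        then have "erlang_density m 1 s * exp (- (s * q)) = 1 / fact m * (s powr (real (Suc m) - 1) * exp (- ((1 + q) * s)))"
          by (simp add: erlang_density_def powr_realpow exp_add[symmetric] algebra_simps)
        with True show ?thesis by (simp add: ennreal_mult'[symmetric])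
      qed (use elim in \<open>simp add: erlang_density_def\<close>)
    qed
  qed
  also have "\<dots> = ennreal (1 / fact m) * ennreal (Gamma (real (Suc m)) * (1 + q) powr (- real (Suc m)))"
    using assms by (subst nn_integral_cmult, simp, subst nn_integral_Gamma_scaled) auto
  also have "\<dots> = ennreal ((1 / (1 + q)) ^ Suc m)"
  proof -
    have "Gamma (real (Suc m)) = fact m" using Gamma_fact[of m, where 'a = real] by simp
    moreover have "(1 + q) powr (- real (Suc m)) = (1 / (1 + q)) ^ Suc m"
      using assms by (simp only: powr_minus powr_realpow power_one_over) (simp add: powr_realpow field_simps)
    ultimately show ?thesis by (simp add: ennreal_mult'[symmetric] del: power_Suc of_nat_Suc)
  qed
  finally show ?thesis .
qed

lemma jump_time_nonneg: "0 \<le> jump_time n i \<omega>"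
  by (simp add: jump_time_def)

lemma laplace_rest_clock_at_jump:
  assumes x: "1 \<le> x" and l: "0 < l"
  shows "(\<integral>\<^sup>+\<omega>. lap l (rest_clock x (jump_time (N x) (Suc m) \<omega>) \<omega>) \<partial>P) = ennreal ((1 / (1 + rest_exponent x l)) ^ Suc m)"
proof -
  have f: "(\<lambda>(s, \<omega>). lap l (rest_clock x s \<omega>)) \<in> borel_measurable (borel \<Otimes>\<^sub>M info (rest_group x))"
    using measurable_compose[OF measurable_rest_clock[of x "rest_group x"] measurable_lap[of l]] by (simp add: split_beta')
  have "(\<integral>\<^sup>+\<omega>. lap l (rest_clock x (jump_time (N x) (Suc m) \<omega>) \<omega>) \<partial>P)
    = (\<integral>\<^sup>+ s. (\<integral>\<^sup>+\<omega>. lap l (rest_clock x s \<omega>) \<partial>P) \<partial>distr P borel (jump_time (N x) (Suc m)))"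
    using x rest_group_subset
    by (intro nn_integral_freeze[where K = "{Inl x}" and K' = "rest_group x"] f)
       (auto simp: rest_group_def group_def)
  also have "\<dots> = (\<integral>\<^sup>+ s. ennreal (exp (- (s * rest_exponent x l))) \<partial>distr P borel (jump_time (N x) (Suc m)))"
  proof (rule nn_integral_cong_AE)
    have "AE s in distr P borel (jump_time (N x) (Suc m)). 0 \<le> s"
      using x by (subst AE_distr_iff) (auto simp: jump_time_nonneg)
    then show "AE s in distr P borel (jump_time (N x) (Suc m)).
        (\<integral>\<^sup>+\<omega>. lap l (rest_clock x s \<omega>) \<partial>P) = ennreal (exp (- (s * rest_exponent x l)))"
      by eventually_elim (rule laplace_rest_clock[OF l])
  qed
  also have "\<dots> = (\<integral>\<^sup>+\<omega>. ennreal (exp (- (jump_time (N x) (Suc m) \<omega> * rest_exponent x l))) \<partial>P)"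
    using x by (subst nn_integral_distr) auto
  also have "\<dots> = (\<integral>\<^sup>+ s. ennreal (erlang_density m 1 s) * ennreal (exp (- (s * rest_exponent x l))) \<partial>lborel)"
    using jump_time_distributed[OF x, of "Suc m"]
    by (subst distributed_nn_integral[of P lborel "jump_time (N x) (Suc m)"]) auto
  also have "\<dots> = ennreal ((1 / (1 + rest_exponent x l)) ^ Suc m)"
    using l by (intro laplace_erlang rest_exponent_nonneg) simp
  finally show ?thesis .
qed

text \<open>
  The time of the visit number \<open>m + 1\<close> has an Erlang law and is independent of the rest of the clock.
\<close>

lemma laplace_before:
  assumes x: "1 \<le> x" and l: "0 < l"
  shows "(\<integral>\<^sup>+\<omega>. lap l (before x m \<omega>) \<partial>P) = ennreal ((1 / (1 + l * g x)) ^ m * (1 / (1 + rest_exponent x l)) ^ Suc m)"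
proof -
  define X where "X i = (\<lambda>\<omega>. if i = 0 then lap l (rest_clock x (jump_time (N x) (Suc m) \<omega>) \<omega>) else lap l (ennreal (g x * T x i \<omega>)))" for i :: nat
  define K where "K i = (if i = 0 then before_group x 0 else {Inr (x, i)})" for i :: nat
  have X: "X i \<in> borel_measurable (info (K i))" for i
  proof (cases "i = 0")
    case True
    have "jump_time (N x) (Suc m) \<in> borel_measurable (info (before_group x 0))"
      by (intro measurable_jump_time_info) (auto simp: before_group_def)
    then have "(\<lambda>\<omega>. (jump_time (N x) (Suc m) \<omega>, \<omega>)) \<in> measurable (info (before_group x 0)) (borel \<Otimes>\<^sub>M info (before_group x 0))" by simp
    from measurable_compose[OF this measurable_rest_clock[of x "before_group x 0"]]
    have [measurable]: "(\<lambda>\<omega>. rest_clock x (jump_time (N x) (Suc m) \<omega>) \<omega>) \<in> borel_measurable (info (before_group x 0))"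
      by (auto simp: before_group_def)
    show ?thesis using True by (simp add: X_def K_def)
  next
    case False
    have [measurable]: "T x i \<in> borel_measurable (info {Inr (x, i)})" by (intro measurable_T_info) simp
    show ?thesis using False by (simp add: X_def K_def)
  qed
  have "(\<integral>\<^sup>+\<omega>. lap l (before x m \<omega>) \<partial>P) = (\<integral>\<^sup>+\<omega>. (\<Prod>i<Suc m. X i \<omega>) \<partial>P)"
    unfolding before_def lap_add lap_sum prod.lessThan_Suc_shift
    by (simp add: X_def mult.commute)
  also have "\<dots> = (\<Prod>i<Suc m. \<integral>\<^sup>+\<omega>. X i \<omega> \<partial>P)"
  proof (rule nn_integral_prod_info[where K = K])
    show "disjoint_family_on K {..<Suc m}"
      by (auto simp: disjoint_family_on_def K_def before_group_def rest_group_def group_def split: if_splits)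
    show "K i \<subseteq> sources" for i using x before_group_subset[OF x] by (auto simp: K_def)
  qed (use X in auto)
  also have "\<dots> = (\<integral>\<^sup>+\<omega>. X 0 \<omega> \<partial>P) * (\<Prod>i<m. \<integral>\<^sup>+\<omega>. X (Suc i) \<omega> \<partial>P)"
    by (simp add: prod.lessThan_Suc_shift del: prod.lessThan_Suc)
  also have "(\<integral>\<^sup>+\<omega>. X 0 \<omega> \<partial>P) = ennreal ((1 / (1 + rest_exponent x l)) ^ Suc m)"
    unfolding X_def using laplace_rest_clock_at_jump[OF x l, of m] by simp
  also have "(\<Prod>i<m. \<integral>\<^sup>+\<omega>. X (Suc i) \<omega> \<partial>P) = (\<Prod>i<m. ennreal (1 / (1 + l * g x)))"
  proof (rule prod.cong)
    fix i
    have "(\<integral>\<^sup>+\<omega>. X (Suc i) \<omega> \<partial>P) = (\<integral>\<^sup>+\<omega>. ennreal (exp (- (l * g x * T x (Suc i) \<omega>))) \<partial>P)"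
    proof (rule nn_integral_cong_AE)
      have "AE \<omega> in P. 0 < T x (Suc i) \<omega>" using x by (intro AE_T_pos) auto
      then show "AE \<omega> in P. X (Suc i) \<omega> = ennreal (exp (- (l * g x * T x (Suc i) \<omega>)))"
        by eventually_elim (use pos[OF x] in \<open>simp add: X_def lap_ennreal mult.assoc\<close>)
    qed
    also have "\<dots> = ennreal (1 / (1 + l * g x))"
      using x l pos[OF x] by (intro laplace_T) auto
    finally show "(\<integral>\<^sup>+\<omega>. X (Suc i) \<omega> \<partial>P) = ennreal (1 / (1 + l * g x))" .
  qed simp
  also have "ennreal ((1 / (1 + rest_exponent x l)) ^ Suc m) * (\<Prod>i<m. ennreal (1 / (1 + l * g x)))
      = ennreal ((1 / (1 + l * g x)) ^ m * (1 / (1 + rest_exponent x l)) ^ Suc m)"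
    using x l pos[OF x] rest_exponent_nonneg[of l x]
    by (simp add: ennreal_power ennreal_mult[symmetric] mult.commute del: power_Suc)
  finally show ?thesis .
qed

text \<open>
  The geometric series collapses: whatever \<open>x\<close> is, summing over all visits to \<open>x\<close> gives the Laplace
  transform of the potential measure of the clock. This is the compensation formula for the visits to
  \<open>x\<close>, which occur at rate 1 of the driving time.
\<close>

lemma laplace_before_suminf:
  assumes x: "1 \<le> x" and l: "0 < l"
  shows "(\<Sum>m. \<integral>\<^sup>+\<omega>. lap l (before x m \<omega>) \<partial>P) = ennreal (1 / rest_exponent 0 l)"
proof -
  define a where "a = 1 / (1 + l * g x)"
  define b where "b = 1 / (1 + rest_exponent x l)"
  define u where "u = l * g x"
  have u: "0 < u" using l pos[OF x] by (simp add: u_def)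
  have q: "0 \<le> rest_exponent x l" using l by (simp add: rest_exponent_nonneg)
  have a: "0 < a" "a < 1" and b: "0 < b" "b \<le> 1" using u q by (auto simp: a_def b_def u_def)
  have "a * b < 1 * 1" using a b by (intro mult_less_le_imp_less) auto
  then have ab: "norm (a * b) < 1" using a b by simp
  have "(\<Sum>m. \<integral>\<^sup>+\<omega>. lap l (before x m \<omega>) \<partial>P) = (\<Sum>m. ennreal (b * (a * b) ^ m))"
    unfolding laplace_before[OF x l] by (intro suminf_cong) (simp add: a_def b_def power_mult_distrib mult_ac power_divide)
  also have "\<dots> = ennreal (\<Sum>m. b * (a * b) ^ m)"
    using a b ab by (intro suminf_ennreal2 summable_mult summable_geometric) auto
  also have "(\<Sum>m. b * (a * b) ^ m) = b * (1 / (1 - a * b))"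
    using ab by (subst suminf_mult) (auto simp: suminf_geometric summable_geometric)
  also have "\<dots> = 1 / rest_exponent 0 l"
  proof -
    have "1 - a * b = ((1 + u) * (1 + rest_exponent x l) - 1) * (a * b)"
    proof -
      define D where "D = (1 + u) * (1 + rest_exponent x l)"
      have "0 < D" using u q by (simp add: D_def)
      moreover have "a * b = 1 / D" by (simp add: a_def b_def u_def[symmetric] D_def)
      ultimately show ?thesis by (simp add: D_def[symmetric] field_simps)
    qed
    moreover have "((1 + u) * (1 + rest_exponent x l) - 1) * a = rest_exponent 0 l"
      unfolding rest_exponent_split[OF x less_imp_le[OF l]] u_def[symmetric] a_def
      using u by (simp add: field_simps)
    ultimately have "1 - a * b = rest_exponent 0 l * b" by (simp add: mult.assoc)
    then show ?thesis using b by simp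
  qed
  finally show ?thesis .
qed

lemma AE_before_finite: "1 \<le> x \<Longrightarrow> AE \<omega> in P. \<forall>m. before x m \<omega> < \<top>"
  using AE_clock_finite[of x] by (auto simp: before_def elim!: eventually_mono)

text \<open>
  The expected number of visits to \<open>x\<close> that start in a given set of times.
\<close>

definition potential :: "nat \<Rightarrow> real measure" where
  "potential x = distr (count_space UNIV \<Otimes>\<^sub>M P) borel (\<lambda>(m, \<omega>). enn2real (before x m \<omega>))"

lemma measurable_before_pair:
  assumes "1 \<le> x"
  shows "(\<lambda>(m, \<omega>). enn2real (before x m \<omega>)) \<in> borel_measurable (count_space (UNIV :: nat set) \<Otimes>\<^sub>M P)"
  using assms by (intro measurable_pair_measure_countable1) auto

lemma nn_integral_potential:
  assumes x: "1 \<le> x" and [measurable]: "f \<in> borel_measurable borel"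
  shows "(\<integral>\<^sup>+ r. f r \<partial>potential x) = (\<Sum>m. \<integral>\<^sup>+\<omega>. f (enn2real (before x m \<omega>)) \<partial>P)"
proof -
  note [measurable] = measurable_before_pair[OF x]
  have "(\<integral>\<^sup>+ r. f r \<partial>potential x) = (\<integral>\<^sup>+ z. f (case z of (m, \<omega>) \<Rightarrow> enn2real (before x m \<omega>)) \<partial>(count_space UNIV \<Otimes>\<^sub>M P))"
    unfolding potential_def by (subst nn_integral_distr) auto
  also have "\<dots> = (\<integral>\<^sup>+ m. \<integral>\<^sup>+\<omega>. f (enn2real (before x m \<omega>)) \<partial>P \<partial>count_space UNIV)"
    by (subst nn_integral_fst[symmetric]) auto
  finally show ?thesis by (simp add: nn_integral_count_space_nat)
qed

lemma laplace_potential: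
  assumes x: "1 \<le> x" and l: "0 < l"
  shows "(\<integral>\<^sup>+ r. ennreal (exp (- (l * r))) \<partial>potential x) = ennreal (1 / rest_exponent 0 l)"
proof -
  have "(\<integral>\<^sup>+ r. ennreal (exp (- (l * r))) \<partial>potential x) = (\<Sum>m. \<integral>\<^sup>+\<omega>. ennreal (exp (- (l * enn2real (before x m \<omega>)))) \<partial>P)"
    by (rule nn_integral_potential[OF x]) simp
  also have "\<dots> = (\<Sum>m. \<integral>\<^sup>+\<omega>. lap l (before x m \<omega>) \<partial>P)"
  proof (intro suminf_cong nn_integral_cong_AE)
    fix m
    show "AE \<omega> in P. ennreal (exp (- (l * enn2real (before x m \<omega>)))) = lap l (before x m \<omega>)"
      using AE_before_finite[OF x] by eventually_elim (simp add: lap_def less_top)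
  qed
  also have "\<dots> = ennreal (1 / rest_exponent 0 l)"
    by (rule laplace_before_suminf[OF x l])
  finally show ?thesis .
qed

lemma sets_potential [simp, measurable_cong]: "sets (potential x) = sets borel"
  by (simp add: potential_def)

lemma laplace_measure_potential:
  assumes x: "1 \<le> x"
  shows "laplace_measure (potential x) (\<lambda>k. 1 / rest_exponent 0 (real k))"
proof
  show "AE r in potential x. 0 \<le> r"
    unfolding potential_def using measurable_before_pair[OF x]
    by (subst AE_distr_iff) (auto intro!: AE_I2)
  fix k :: nat assume "1 \<le> k"
  then show "0 < 1 / rest_exponent 0 (real k)"
    "(\<integral>\<^sup>+ r. ennreal (exp (- real k * r)) \<partial>potential x) = ennreal (1 / rest_exponent 0 (real k))"
    using laplace_potential[OF x, of "real k"] by (simp_all add: rest_exponent_0_pos)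
qed simp

lemma potential_eq: "1 \<le> x \<Longrightarrow> potential x = potential 1"
  by (rule laplace_unique[OF laplace_measure_potential laplace_measure_potential]) auto

text \<open>
  The holding time is independent of the starting time of the visit, and exponential with mean \<open>g x\<close>.
\<close>

lemma emeasure_straddle:
  assumes x: "1 \<le> x" and t: "t \<le> t'"
  shows "emeasure P {\<omega>\<in>space P. enn2real (before x m \<omega>) \<le> t \<and> t' < enn2real (before x m \<omega>) + g x * T x (Suc m) \<omega>}
    = (\<integral>\<^sup>+\<omega>. indicator {..t} (enn2real (before x m \<omega>)) * ennreal (exp (- ((t' - enn2real (before x m \<omega>)) / g x))) \<partial>P)"
proof -
  define f :: "real \<Rightarrow> 'b \<Rightarrow> ennreal" where "f r \<omega> = of_bool (r \<le> t \<and> t' < r + g x * T x (Suc m) \<omega>)" for r \<omega>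
  let ?X = "\<lambda>\<omega>. enn2real (before x m \<omega>)"
  have [measurable]: "T x (Suc m) \<in> borel_measurable (info {Inr (x, Suc m)})" by (intro measurable_T_info) simp
  have f: "case_prod f \<in> borel_measurable (borel \<Otimes>\<^sub>M info {Inr (x, Suc m)})"
    unfolding f_def by measurable
  have X: "?X \<in> borel_measurable (info (before_group x m))"
    using measurable_before[of x m] by measurable
  have [measurable]: "before x m \<in> borel_measurable P" "T x (Suc m) \<in> borel_measurable P" using x by simp_all
  have "emeasure P {\<omega>\<in>space P. ?X \<omega> \<le> t \<and> t' < ?X \<omega> + g x * T x (Suc m) \<omega>}
    = (\<integral>\<^sup>+\<omega>. indicator {\<omega>\<in>space P. ?X \<omega> \<le> t \<and> t' < ?X \<omega> + g x * T x (Suc m) \<omega>} \<omega> \<partial>P)"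
    by (intro nn_integral_indicator[symmetric]) measurable
  also have "\<dots> = (\<integral>\<^sup>+\<omega>. f (?X \<omega>) \<omega> \<partial>P)"
    by (intro nn_integral_cong) (auto simp: f_def indicator_def)
  also have "\<dots> = (\<integral>\<^sup>+ r. (\<integral>\<^sup>+\<omega>. f r \<omega> \<partial>P) \<partial>distr P borel ?X)"
    using x before_group_subset[OF x, of m]
    by (intro nn_integral_freeze[where K = "before_group x m" and K' = "{Inr (x, Suc m)}"] f X)
       (auto simp: before_group_def rest_group_def group_def)
  also have "\<dots> = (\<integral>\<^sup>+ r. indicator {..t} r * ennreal (exp (- ((t' - r) / g x))) \<partial>distr P borel ?X)"
  proof (rule nn_integral_cong)
    fix r
    show "(\<integral>\<^sup>+\<omega>. f r \<omega> \<partial>P) = indicator {..t} r * ennreal (exp (- ((t' - r) / g x)))"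
    proof (cases "r \<le> t")
      case True
      have "(\<integral>\<^sup>+\<omega>. f r \<omega> \<partial>P) = (\<integral>\<^sup>+\<omega>. indicator {\<omega>\<in>space P. (t' - r) / g x < T x (Suc m) \<omega>} \<omega> \<partial>P)"
        using True pos[OF x] by (intro nn_integral_cong) (auto simp: f_def indicator_def field_simps)
      also have "\<dots> = emeasure P {\<omega>\<in>space P. (t' - r) / g x < T x (Suc m) \<omega>}"
        by (rule nn_integral_indicator) measurable
      also have "\<dots> = ennreal (exp (- ((t' - r) / g x)))"
        using True t x pos[OF x] by (simp add: emeasure_eq_measure prob_T_greater)
      finally show ?thesis using True by simp
    qed (simp add: f_def)
  qed
  also have "\<dots> = (\<integral>\<^sup>+\<omega>. indicator {..t} (?X \<omega>) * ennreal (exp (- ((t' - ?X \<omega>) / g x))) \<partial>P)"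
    by (subst nn_integral_distr) auto
  finally show ?thesis .
qed

text \<open>
  Since the potential measure is the same for all \<open>x\<close>, the sum over \<open>x\<close> can be taken inside the
  integral, where it builds up the Levy tail.
\<close>

lemma straddle_suminf:
  assumes t: "t \<le> t'"
  shows "(\<Sum>i. \<Sum>m. emeasure P {\<omega>\<in>space P. enn2real (before (Suc i) m \<omega>) \<le> t \<and>
        t' < enn2real (before (Suc i) m \<omega>) + g (Suc i) * T (Suc i) (Suc m) \<omega>})
    = (\<integral>\<^sup>+ r. indicator {..t} r * levy_tail (t' - r) \<partial>potential 1)"
proof -
  have "(\<Sum>m. emeasure P {\<omega>\<in>space P. enn2real (before (Suc i) m \<omega>) \<le> t \<and>
        t' < enn2real (before (Suc i) m \<omega>) + g (Suc i) * T (Suc i) (Suc m) \<omega>})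
     = (\<integral>\<^sup>+ r. indicator {..t} r * ennreal (exp (- ((t' - r) / g (Suc i)))) \<partial>potential 1)" for i
    unfolding emeasure_straddle[OF _ t, of "Suc i", simplified]
    by (subst potential_eq[of "Suc i", symmetric], simp, subst nn_integral_potential) auto
  then have "(\<Sum>i. \<Sum>m. emeasure P {\<omega>\<in>space P. enn2real (before (Suc i) m \<omega>) \<le> t \<and>
        t' < enn2real (before (Suc i) m \<omega>) + g (Suc i) * T (Suc i) (Suc m) \<omega>})
     = (\<Sum>i. \<integral>\<^sup>+ r. indicator {..t} r * ennreal (exp (- ((t' - r) / g (Suc i)))) \<partial>potential 1)"
    by simp
  also have "\<dots> = (\<integral>\<^sup>+ r. (\<Sum>i. indicator {..t} r * ennreal (exp (- ((t' - r) / g (Suc i))))) \<partial>potential 1)"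
    by (intro nn_integral_suminf[symmetric]) (auto simp: potential_def)
  finally show ?thesis
    by (simp add: levy_tail_def ennreal_suminf_cmult)
qed

end

section \<open>The probability that one jump straddles an interval\<close>

lemma nn_integral_marks:
  fixes f :: "nat \<times> nat \<Rightarrow> ennreal"
  shows "(\<integral>\<^sup>+ p. f p \<partial>count_space marks) = (\<Sum>x. \<Sum>i. f (Suc x, Suc i))"
proof -
  have "bij_betw (\<lambda>(x, i). (Suc x, Suc i)) UNIV marks"
    by (rule bij_betw_byWitness[where f' = "\<lambda>(x, i). (x - 1, i - 1)"]) (auto simp: marks_def)
  then have "(\<integral>\<^sup>+ p. f p \<partial>count_space marks) = (\<integral>\<^sup>+ p. f (case p of (x, i) \<Rightarrow> (Suc x, Suc i)) \<partial>count_space UNIV)"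
    by (simp add: nn_integral_bij_count_space)
  also have "\<dots> = (\<integral>\<^sup>+ x. \<integral>\<^sup>+ i. f (Suc x, Suc i) \<partial>count_space UNIV \<partial>count_space UNIV)"
    by (subst nn_integral_fst_count_space[symmetric]) simp
  finally show ?thesis by (simp add: nn_integral_count_space_nat)
qed

lemma measure_completion_eq_AE:
  assumes E': "E' \<in> sets M" and E: "E \<subseteq> space M" and ae: "AE x in M. x \<in> E \<longleftrightarrow> x \<in> E'"
  shows "measure (completion M) E = measure M E'"
proof -
  obtain Z where Z: "{x \<in> space M. \<not> (x \<in> E \<longleftrightarrow> x \<in> E')} \<subseteq> Z" "Z \<in> null_sets M"
    using ae by (auto elim!: AE_E intro!: null_setsI)
  have "E \<inter> Z \<in> null_sets (completion M)"
    using Z(2) by (intro null_sets_completion_subset[of "E \<inter> Z" Z]) (auto intro: null_sets_completionI)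
  then have "(E' - Z) \<union> (E \<inter> Z) \<in> sets (completion M)"
    using E' Z(2) by (intro sets.Un null_setsD2[of "E \<inter> Z"] sets_completionI_sets sets.Diff) auto
  also have "(E' - Z) \<union> (E \<inter> Z) = E"
    using Z(1) E sets.sets_into_space[OF E'] by blast
  finally have "E \<in> sets (completion M)" .
  then have "measure (completion M) E = measure (completion M) E'"
    using E' AE_completion[OF ae] by (intro measure_eq_AE) auto
  then show ?thesis using E' by simp
qed

context k_setup begin

text \<open>
  The almost sure properties of the driver that the path analysis needs. All indices start at
  \<open>Suc 0\<close>, which keeps the quantifiers free of side conditions.
\<close>

definition regular :: "'b \<Rightarrow> bool" where
  "regular \<omega> \<longleftrightarrow>
     (\<forall>x. counting_path (\<lambda>t. N (Suc x) t \<omega>)) \<and>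
     (\<forall>x i. 0 < T (Suc x) (Suc i) \<omega>) \<and>
     (\<forall>x i. jump_time (N (Suc x)) (Suc i) \<omega> < jump_time (N (Suc x)) (Suc (Suc i)) \<omega>) \<and>
     (\<forall>x y i j. x \<noteq> y \<longrightarrow> jump_time (N (Suc x)) (Suc i) \<omega> \<noteq> jump_time (N (Suc y)) (Suc j) \<omega>) \<and>
     (\<forall>a\<in>\<rat>. \<forall>b\<in>\<rat>. 0 \<le> a \<longrightarrow> a < b \<longrightarrow> (\<exists>x\<ge>1. N x b \<omega> - N x a \<omega> \<noteq> 0)) \<and>
     (\<forall>s. rest_clock 0 s \<omega> < \<top>) \<and>
     (\<forall>K::real. \<exists>s. ennreal K < rest_clock 0 s \<omega>)"

lemma AE_regular: "AE \<omega> in P. regular \<omega>"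
  unfolding regular_def
proof (intro AE_conjI)
  show "AE \<omega> in P. \<forall>x. counting_path (\<lambda>t. N (Suc x) t \<omega>)"
    unfolding AE_all_countable by (auto intro: AE_counting_path)
  show "AE \<omega> in P. \<forall>x i. 0 < T (Suc x) (Suc i) \<omega>"
    unfolding AE_all_countable by (auto intro: AE_T_pos)
  show "AE \<omega> in P. \<forall>x i. jump_time (N (Suc x)) (Suc i) \<omega> < jump_time (N (Suc x)) (Suc (Suc i)) \<omega>"
    unfolding AE_all_countable by (auto intro: AE_jump_times_strict)
  show "AE \<omega> in P. \<forall>x y i j. x \<noteq> y \<longrightarrow> jump_time (N (Suc x)) (Suc i) \<omega> \<noteq> jump_time (N (Suc y)) (Suc j) \<omega>"
    unfolding AE_all_countable by (intro allI AE_impI AE_jump_times_distinct) auto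
  show "AE \<omega> in P. \<forall>a\<in>\<rat>. \<forall>b\<in>\<rat>. 0 \<le> a \<longrightarrow> a < b \<longrightarrow> (\<exists>x\<ge>1. N x b \<omega> - N x a \<omega> \<noteq> 0)"
    unfolding AE_ball_countable[OF countable_rat] by (intro ballI AE_impI AE_some_jump_between)
qed (use AE_clock_finite AE_clock_unbounded in auto)

lemma regularD:
  assumes "regular \<omega>" "1 \<le> x" "1 \<le> i"
  shows "counting_path (\<lambda>t. N x t \<omega>)" "0 < T x i \<omega>"
    "jump_time (N x) i \<omega> < jump_time (N x) (Suc i) \<omega>"
    "1 \<le> y \<Longrightarrow> 1 \<le> j \<Longrightarrow> x \<noteq> y \<Longrightarrow> jump_time (N x) i \<omega> \<noteq> jump_time (N y) j \<omega>"
  using assms by (cases x; cases i; cases y; cases j; force simp: regular_def)+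

lemma regular_jump_time_less:
  assumes "regular \<omega>" "1 \<le> x"
  shows "jump_time (N x) (Suc i) \<omega> < jump_time (N x) (Suc j) \<omega> \<longleftrightarrow> i < j"
proof -
  have "strict_mono (\<lambda>i. jump_time (N x) (Suc i) \<omega>)"
    using regularD(3)[OF assms] by (intro strict_mono_Suc_iff[THEN iffD2] allI) simp
  from strict_mono_less[OF this, of i j] show ?thesis .
qed

definition jump :: "'b \<Rightarrow> nat \<times> nat \<Rightarrow> real" where
  "jump \<omega> = (\<lambda>(x, i). jump_time (N x) i \<omega>)"

lemma suminf_marks_eq_clock:
  assumes "regular \<omega>"
  shows "(\<integral>\<^sup>+ p. ennreal (case p of (x, i) \<Rightarrow> g x * T x i \<omega>) * indicator {..t} (jump \<omega> p) \<partial>count_space marks) = rest_clock 0 t \<omega>"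
  unfolding nn_integral_marks rest_clock_def local_clock_def jump_def
  by (simp add: ennreal_mult' mult.assoc)

lemma k_path_regular:
  assumes \<omega>: "regular \<omega>"
  shows "k_path g N T \<omega> (jump \<omega>)"
proof
  have cp: "counting_path (\<lambda>t. N x t \<omega>)" if "1 \<le> x" for x
    using regularD(1)[OF \<omega> that, of 1] by simp
  note jt = counting_path_jump_time[where n = "N x" and \<omega> = \<omega> for x, OF cp]
  show "event_time (N x) i \<omega> = jump \<omega> (x, i)" if "1 \<le> x" "1 \<le> i" for x i
    using jt(1)[OF that] by (simp add: jump_def)
  show counts: "i \<le> N x t \<omega> \<longleftrightarrow> jump \<omega> (x, i) \<le> t" if "1 \<le> x" "1 \<le> i" "0 \<le> t" for x i t
    using jt(2)[OF that] by (simp add: jump_def)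
  show "countable marks" by simp
  show "0 < jump \<omega> p" if "p \<in> marks" for p
    using that jt(3) by (auto simp: jump_def marks_def)
  show "inj_on (jump \<omega>) marks"
  proof (rule inj_onI)
    fix p q assume p: "p \<in> marks" and q: "q \<in> marks" and eq: "jump \<omega> p = jump \<omega> q"
    obtain x i where pp: "p = (x, Suc i)" "1 \<le> x" using p by (cases p; cases "snd p") auto
    obtain y j where qq: "q = (y, Suc j)" "1 \<le> y" using q by (cases q; cases "snd q") auto
    have eq': "jump_time (N x) (Suc i) \<omega> = jump_time (N y) (Suc j) \<omega>"
      using eq by (simp add: jump_def pp qq)
    have "x = y"
    proof (rule ccontr)
      assume "x \<noteq> y"
      then have "jump_time (N x) (Suc i) \<omega> \<noteq> jump_time (N y) (Suc j) \<omega>"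
        using regularD(4)[OF \<omega> pp(2), of "Suc i" y "Suc j"] qq(2) by simp
      with eq' show False by simp
    qed
    moreover have "i = j"
      using regular_jump_time_less[OF \<omega> pp(2), of i j] regular_jump_time_less[OF \<omega> pp(2), of j i] eq' \<open>x = y\<close>
      by (cases i j rule: linorder_cases) auto
    ultimately show "p = q" by (simp add: pp qq)
  qed
  show "0 < (case p of (x, i) \<Rightarrow> g x * T x i \<omega>)" if "p \<in> marks" for p
    using that regularD(2)[OF \<omega>] pos by (auto simp: marks_def)
  show "(\<integral>\<^sup>+ p. ennreal (case p of (x, i) \<Rightarrow> g x * T x i \<omega>) * indicator {..t} (jump \<omega> p) \<partial>count_space marks) < \<infinity>" for t
    using \<omega> by (simp add: suminf_marks_eq_clock regular_def)
  show "\<exists>t. ennreal K < (\<integral>\<^sup>+ p. ennreal (case p of (x, i) \<Rightarrow> g x * T x i \<omega>) * indicator {..t} (jump \<omega> p) \<partial>count_space marks)" for K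
    using \<omega> by (simp add: suminf_marks_eq_clock regular_def)
  show "\<exists>p\<in>marks. a < jump \<omega> p \<and> jump \<omega> p < b" if ab: "0 \<le> a" "a < b" for a b
  proof -
    obtain a' where a': "a' \<in> \<rat>" "a < a'" "a' < b" using Rats_dense_in_real[OF ab(2)] by auto
    obtain b' where b': "b' \<in> \<rat>" "a' < b'" "b' < b" using Rats_dense_in_real[OF a'(3)] by auto
    have "\<exists>x\<ge>1. N x b' \<omega> - N x a' \<omega> \<noteq> 0"
      using \<omega> a' b' ab unfolding regular_def by (meson less_imp_le order_trans)
    then obtain x where x: "1 \<le> x" "N x b' \<omega> - N x a' \<omega> \<noteq> 0" by auto
    define i where "i = N x b' \<omega>"
    have i: "1 \<le> i" "i \<le> N x b' \<omega>" "\<not> i \<le> N x a' \<omega>" using x(2) by (auto simp: i_def)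
    have "jump \<omega> (x, i) \<le> b'" "\<not> jump \<omega> (x, i) \<le> a'"
      using counts[OF x(1) i(1), of b'] counts[OF x(1) i(1), of a'] i a' b' ab by auto
    with x i a' b' show ?thesis by (intro bexI[of _ "(x, i)"]) auto
  qed
qed

text \<open>
  Simultaneous jumps do not occur, so the visits that start before the visit number \<open>m + 1\<close> to \<open>x\<close> are
  the first \<open>m\<close> visits to \<open>x\<close> and the visits to other states up to that time.
\<close>

lemma level_before_regular:
  assumes \<omega>: "regular \<omega>" and x: "1 \<le> x"
  shows "jump_path.level_before marks (jump \<omega>) (\<lambda>(x, i). g x * T x i \<omega>) (x, Suc m) = enn2real (before x m \<omega>)"
proof -
  interpret k_path g N T \<omega> "jump \<omega>" by (rule k_path_regular[OF \<omega>])
  let ?S = "jump_time (N x) (Suc m) \<omega>"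
  define own where "own = (\<Sum>i<m. ennreal (g x * T x (Suc i) \<omega>))"
  have x': "Suc (x - 1) = x" using x by simp
  have summand: "(\<Sum>i. ennreal (g (Suc y) * T (Suc y) (Suc i) \<omega>) * indicator {..<?S} (jump_time (N (Suc y)) (Suc i) \<omega>))
      = (if y = x - 1 then own else 0) + (if Suc y = x then 0 else ennreal (g (Suc y)) * local_clock (Suc y) ?S \<omega>)" for y
  proof (cases "Suc y = x")
    case True
    have "(\<Sum>i. ennreal (g x * T x (Suc i) \<omega>) * indicator {..<?S} (jump_time (N x) (Suc i) \<omega>))
       = (\<Sum>i. ennreal (g x * T x (Suc i) \<omega>) * indicator {..<m} i)"
      using regular_jump_time_less[OF \<omega> x] by (intro suminf_cong) (auto simp: indicator_def)
    also have "\<dots> = own"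
      unfolding own_def by (subst suminf_finite[of "{..<m}"]) auto
    finally show ?thesis using True x by auto
  next
    case False
    have distinct: "jump_time (N (Suc y)) (Suc i) \<omega> \<noteq> ?S" for i
      using regularD(4)[OF \<omega>, of "Suc y" "Suc i" x "Suc m"] False x by simp
    have "(\<Sum>i. ennreal (g (Suc y) * T (Suc y) (Suc i) \<omega>) * indicator {..<?S} (jump_time (N (Suc y)) (Suc i) \<omega>))
      = (\<Sum>i. ennreal (g (Suc y)) * (ennreal (T (Suc y) (Suc i) \<omega>) * indicator {..?S} (jump_time (N (Suc y)) (Suc i) \<omega>)))"
    proof (rule suminf_cong)
      fix i
      have "indicator {..<?S} (jump_time (N (Suc y)) (Suc i) \<omega>) = (indicator {..?S} (jump_time (N (Suc y)) (Suc i) \<omega>) :: ennreal)"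
        using distinct[of i] by (auto simp: indicator_def)
      then show "ennreal (g (Suc y) * T (Suc y) (Suc i) \<omega>) * indicator {..<?S} (jump_time (N (Suc y)) (Suc i) \<omega>)
        = ennreal (g (Suc y)) * (ennreal (T (Suc y) (Suc i) \<omega>) * indicator {..?S} (jump_time (N (Suc y)) (Suc i) \<omega>))"
        by (simp add: ennreal_mult' mult.assoc)
    qed
    also have "\<dots> = ennreal (g (Suc y)) * local_clock (Suc y) ?S \<omega>"
      by (simp add: local_clock_def)
    finally show ?thesis using False x' by auto
  qed
  have "emeasure mu {..<jump \<omega> (x, Suc m)} = (\<Sum>y. \<Sum>i. ennreal (g (Suc y) * T (Suc y) (Suc i) \<omega>) * indicator {..<?S} (jump_time (N (Suc y)) (Suc i) \<omega>))"
    by (simp add: emeasure_mu nn_integral_marks) (simp add: jump_def)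
  also have "\<dots> = (\<Sum>y. (if y = x - 1 then own else 0)) + rest_clock x ?S \<omega>"
    unfolding summand rest_clock_def by (intro suminf_add[symmetric]) auto
  also have "(\<Sum>y. (if y = x - 1 then own else 0)) = own"
    by (subst suminf_finite[of "{x - 1}"]) auto
  finally have "emeasure mu {..<jump \<omega> (x, Suc m)} = before x m \<omega>"
    by (simp add: own_def before_def)
  then show ?thesis by (simp add: level_before_def measure_def)
qed

definition straddle :: "real \<Rightarrow> real \<Rightarrow> nat \<Rightarrow> nat \<Rightarrow> 'b set" where
  "straddle t t' i m = {\<omega>\<in>space P. enn2real (before (Suc i) m \<omega>) \<le> t \<and>
     t' < enn2real (before (Suc i) m \<omega>) + g (Suc i) * T (Suc i) (Suc m) \<omega>}"

lemma straddle_sets [measurable]: "straddle t t' i m \<in> sets P"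
proof -
  have [measurable]: "before (Suc i) m \<in> borel_measurable P" "T (Suc i) (Suc m) \<in> borel_measurable P" by simp_all
  show ?thesis unfolding straddle_def by measurable
qed

lemma constant_iff_straddle:
  assumes \<omega>: "regular \<omega>" "\<omega> \<in> space P" and t: "0 \<le> t" "t < t'"
  shows "(\<forall>u\<in>{t..t'}. k_process g N T \<omega> u = k_process g N T \<omega> t) \<longleftrightarrow> (\<exists>i m. \<omega> \<in> straddle t t' i m)"
    and "\<omega> \<in> straddle t t' i m \<Longrightarrow> \<omega> \<in> straddle t t' j n \<Longrightarrow> i = j \<and> m = n"
proof -
  interpret k_path g N T \<omega> "jump \<omega>" by (rule k_path_regular[OF \<omega>(1)])
  have iff: "\<omega> \<in> straddle t t' i m \<longleftrightarrow> level_before (Suc i, Suc m) \<le> t \<and> t' < level (jump \<omega> (Suc i, Suc m))" for i m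
  proof -
    have "(Suc i, Suc m) \<in> marks" by simp
    from level_jump[OF this] show ?thesis
      using \<omega>(2) level_before_regular[OF \<omega>(1), of "Suc i" m] by (simp add: straddle_def)
  qed
  have "(\<exists>p\<in>marks. level_before p \<le> t \<and> t' < level (jump \<omega> p)) \<longleftrightarrow> (\<exists>i m. \<omega> \<in> straddle t t' i m)"
    unfolding iff
  proof
    assume "\<exists>p\<in>marks. level_before p \<le> t \<and> t' < level (jump \<omega> p)"
    then obtain p where p: "p \<in> marks" "level_before p \<le> t" "t' < level (jump \<omega> p)" by blast
    then have "p = (Suc (fst p - 1), Suc (snd p - 1))" by (cases p) auto
    then obtain i m where "p = (Suc i, Suc m)" by blast
    with p show "\<exists>i m. level_before (Suc i, Suc m) \<le> t \<and> t' < level (jump \<omega> (Suc i, Suc m))" by blast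
  next
    assume "\<exists>i m. level_before (Suc i, Suc m) \<le> t \<and> t' < level (jump \<omega> (Suc i, Suc m))"
    moreover have "(Suc i, Suc m) \<in> marks" for i m by simp
    ultimately show "\<exists>p\<in>marks. level_before p \<le> t \<and> t' < level (jump \<omega> p)" by blast
  qed
  then show "(\<forall>u\<in>{t..t'}. k_process g N T \<omega> u = k_process g N T \<omega> t) \<longleftrightarrow> (\<exists>i m. \<omega> \<in> straddle t t' i m)"
    by (simp only: k_process_constant_iff[OF t])
  show "i = j \<and> m = n" if "\<omega> \<in> straddle t t' i m" "\<omega> \<in> straddle t t' j n"
  proof -
    have "(Suc i, Suc m) = (Suc j, Suc n)"
      by (rule excursion_disjoint[of _ _ t]) (use that t in \<open>auto simp: iff excursion_def\<close>)
    then show ?thesis by simp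
  qed
qed

text \<open>
  The events that a particular visit covers \<open>[t, t + \<theta> t]\<close> are disjoint, so that their probabilities
  add up.
\<close>

lemma no_jump_prob_eq:
  assumes "0 < t" "0 < \<theta>"
  shows "ennreal (no_jump_prob P N T g t \<theta>) = (\<integral>\<^sup>+ r. indicator {..t} r * levy_tail (t + \<theta> * t - r) \<partial>potential 1)"
proof -
  have t: "0 \<le> t" "t < t + \<theta> * t" using assms by auto
  let ?t' = "t + \<theta> * t"
  let ?E' = "\<Union>i. \<Union>m. straddle t ?t' i m"
  have "no_jump_prob P N T g t \<theta> = measure P ?E'"
    unfolding no_jump_prob_def
  proof (rule measure_completion_eq_AE)
    show "AE \<omega> in P. \<omega> \<in> {\<omega> \<in> space P. \<forall>s\<in>{t..?t'}. k_process g N T \<omega> s = k_process g N T \<omega> t} \<longleftrightarrow> \<omega> \<in> ?E'"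
      using AE_regular AE_space
    proof eventually_elim
      case (elim \<omega>)
      from constant_iff_straddle(1)[OF elim t] elim(2) show ?case by auto
    qed
  qed auto
  then have "ennreal (no_jump_prob P N T g t \<theta>) = (\<integral>\<^sup>+\<omega>. indicator ?E' \<omega> \<partial>P)"
    by (simp add: emeasure_eq_measure)
  also have "\<dots> = (\<integral>\<^sup>+\<omega>. (\<Sum>i. \<Sum>m. indicator (straddle t ?t' i m) \<omega>) \<partial>P)"
  proof (rule nn_integral_cong_AE)
    show "AE \<omega> in P. indicator ?E' \<omega> = (\<Sum>i. \<Sum>m. indicator (straddle t ?t' i m) \<omega> :: ennreal)"
      using AE_regular AE_space
    proof eventually_elim
      case (elim \<omega>)
      show ?case
      proof (cases "\<exists>i m. \<omega> \<in> straddle t ?t' i m")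
        case True
        then obtain i m where im: "\<omega> \<in> straddle t ?t' i m" by auto
        have eq: "indicator (straddle t ?t' j n) \<omega> = (if j = i then if n = m then 1 else 0 else 0 :: ennreal)" for j n
        proof (cases "j = i \<and> n = m")
          case False
          then have "\<omega> \<notin> straddle t ?t' j n" using constant_iff_straddle(2)[OF elim t im, of j n] by blast
          then have "indicator (straddle t ?t' j n) \<omega> = (0 :: ennreal)" by (rule indicator_simps)
          with False show ?thesis by presburger
        qed (use im in \<open>simp only: if_True indicator_simps simp_thms\<close>)
        have "(\<Sum>n. if n = m then 1 else 0 :: ennreal) = 1"
          by (subst suminf_finite[of "{m}"]) auto
        then have inner: "(\<Sum>n. if j = i then if n = m then 1 else 0 else 0 :: ennreal) = (if j = i then 1 else 0)" for j
          by (cases "j = i") (simp_all only: if_True if_False suminf_zero simp_thms)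
        have outer: "(\<Sum>j. if j = i then 1 else 0 :: ennreal) = 1"
          by (subst suminf_finite[of "{i}"]) auto
        have "\<omega> \<in> ?E'" using im by blast
        then show ?thesis unfolding eq inner outer by (rule indicator_simps)
      qed (auto simp: indicator_def)
    qed
  qed
  also have "\<dots> = (\<Sum>i. \<Sum>m. emeasure P (straddle t ?t' i m))"
    by (simp add: nn_integral_suminf)
  also have "\<dots> = (\<integral>\<^sup>+ r. indicator {..t} r * levy_tail (?t' - r) \<partial>potential 1)"
    unfolding straddle_def by (rule straddle_suminf) (use t in simp)
  finally show ?thesis .
qed

end

section \<open>The Dynkin--Lamperti limit\<close>

context k_setup begin

text \<open>
  The potential measure seen at scale \<open>y\<close>, with mass renormalised so that it converges.
\<close>

definition scaled_potential :: "real \<Rightarrow> real measure" where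
  "scaled_potential y = density (distr (potential 1) borel (\<lambda>r. r / y)) (\<lambda>_. ennreal (y powr (- \<alpha>)))"

lemma nn_integral_scaled_potential:
  assumes [measurable]: "f \<in> borel_measurable borel"
  shows "(\<integral>\<^sup>+ x. f x \<partial>scaled_potential y) = ennreal (y powr (- \<alpha>)) * (\<integral>\<^sup>+ r. f (r / y) \<partial>potential 1)"
proof -
  show ?thesis
    unfolding scaled_potential_def
    by (simp add: nn_integral_density nn_integral_distr nn_integral_cmult)
qed

lemma laplace_measure_scaled_potential:
  assumes y: "0 < y"
  shows "laplace_measure (scaled_potential y) (\<lambda>k. y powr (- \<alpha>) / rest_exponent 0 (real k / y))"
proof
  interpret pot: laplace_measure "potential 1" "\<lambda>k. 1 / rest_exponent 0 (real k)"
    by (rule laplace_measure_potential) simp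
  show "sets (scaled_potential y) = sets borel" by (simp add: scaled_potential_def)
  show "AE r in scaled_potential y. 0 \<le> r"
    unfolding scaled_potential_def using pot.nonneg_AE y
    by (auto simp: AE_density AE_distr_iff elim!: eventually_mono)
  fix k :: nat assume k: "1 \<le> k"
  then have l: "0 < real k / y" using y by simp
  show "0 < y powr (- \<alpha>) / rest_exponent 0 (real k / y)" using rest_exponent_0_pos[OF l] y by simp
  have "(\<integral>\<^sup>+ x. ennreal (exp (- real k * x)) \<partial>scaled_potential y)
     = ennreal (y powr (- \<alpha>)) * (\<integral>\<^sup>+ r. ennreal (exp (- (real k / y * r))) \<partial>potential 1)"
    by (subst nn_integral_scaled_potential) auto
  also have "\<dots> = ennreal (y powr (- \<alpha>) / rest_exponent 0 (real k / y))"
    using rest_exponent_0_pos[OF l] by (subst laplace_potential[OF order_refl l]) (simp add: ennreal_mult[symmetric])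
  finally show "(\<integral>\<^sup>+ x. ennreal (exp (- real k * x)) \<partial>scaled_potential y) = ennreal (y powr (- \<alpha>) / rest_exponent 0 (real k / y))" .
qed

definition scaling_constant :: real where
  "scaling_constant = Gamma (1 + \<alpha>) * Gamma (1 - \<alpha>)"

lemma scaling_constant_pos: "0 < scaling_constant"
  unfolding scaling_constant_def using alpha by (intro mult_pos_pos Gamma_real_pos) auto

lemma exponent_limit:
  assumes Y: "\<And>n. 0 < Y n" "Y \<longlonglongrightarrow> 0" and k: "0 < k"
  shows "(\<lambda>n. Y n powr (- \<alpha>) / rest_exponent 0 (k / Y n)) \<longlonglongrightarrow> k powr (- \<alpha>) / scaling_constant"
proof -
  have pos': "0 < rest_exponent 0 (k / Y n)" for n using rest_exponent_0_pos Y(1) k by simp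
  have "filterlim (\<lambda>n. Y n / k) (at_right 0) sequentially"
    using tendsto_divide_zero[OF Y(2), of k] Y(1) k
    by (intro tendsto_imp_filterlim_at_right always_eventually allI divide_pos_pos)
  from filterlim_compose[OF laplace_exponent_limit this]
  have "(\<lambda>n. ennreal ((Y n / k) powr \<alpha>) * laplace_exponent (1 / (Y n / k))) \<longlonglongrightarrow> ennreal scaling_constant"
    by (simp add: scaling_constant_def)
  also have "(\<lambda>n. ennreal ((Y n / k) powr \<alpha>) * laplace_exponent (1 / (Y n / k)))
      = (\<lambda>n. ennreal ((Y n / k) powr \<alpha> * rest_exponent 0 (k / Y n)))"
    using Y(1) k pos' by (auto simp: laplace_exponent_eq_rest ennreal_mult less_imp_le)
  finally have "(\<lambda>n. (Y n / k) powr \<alpha> * rest_exponent 0 (k / Y n)) \<longlonglongrightarrow> scaling_constant"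
    using pos' scaling_constant_pos by (subst (asm) tendsto_ennreal_iff) (auto simp: less_imp_le)
  then have lim: "(\<lambda>n. k powr (- \<alpha>) * inverse ((Y n / k) powr \<alpha> * rest_exponent 0 (k / Y n))) \<longlonglongrightarrow> k powr (- \<alpha>) * inverse scaling_constant"
    using scaling_constant_pos by (intro tendsto_mult tendsto_const tendsto_inverse) auto
  have eq: "k powr (- \<alpha>) * inverse ((Y n / k) powr \<alpha> * rest_exponent 0 (k / Y n)) = Y n powr (- \<alpha>) / rest_exponent 0 (k / Y n)" for n
  proof -
    have "(Y n / k) powr \<alpha> = Y n powr \<alpha> / k powr \<alpha>" using k Y(1)[of n] by (simp add: powr_divide)
    then show ?thesis using k Y(1)[of n] by (simp add: powr_minus divide_inverse)
  qed
  from lim show ?thesis unfolding eq by (simp add: divide_inverse)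
qed

text \<open>
  The potential measure of a stable subordinator, whose Laplace transform is
  \<open>k powr (-\<alpha>) / scaling_constant\<close>.
\<close>

definition stable_potential :: "real measure" where
  "stable_potential = density lborel (\<lambda>r. indicator {0<..} r * ennreal (r powr (\<alpha> - 1) / (scaling_constant * Gamma \<alpha>)))"

lemma Gamma_alpha_pos: "0 < Gamma \<alpha>"
  using alpha by (intro Gamma_real_pos) auto

lemma laplace_measure_stable_potential:
  "laplace_measure stable_potential (\<lambda>k. real k powr (- \<alpha>) / scaling_constant)"
proof
  show "sets stable_potential = sets borel" by (simp add: stable_potential_def)
  show "AE r in stable_potential. 0 \<le> r"
    unfolding stable_potential_def by (subst AE_density) (auto simp: indicator_def)
  fix k :: nat assume k: "1 \<le> k"
  show "0 < real k powr (- \<alpha>) / scaling_constant" using k scaling_constant_pos by simp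
  have "(\<integral>\<^sup>+ x. ennreal (exp (- real k * x)) \<partial>stable_potential)
     = (\<integral>\<^sup>+ x. ennreal (1 / (scaling_constant * Gamma \<alpha>)) * (indicator {0<..} x * ennreal (x powr (\<alpha> - 1) * exp (- (real k * x)))) \<partial>lborel)"
    unfolding stable_potential_def using scaling_constant_pos Gamma_alpha_pos
    by (subst nn_integral_density)
       (auto intro!: nn_integral_cong simp: ennreal_mult[symmetric] indicator_def divide_inverse mult_ac)
  also have "\<dots> = ennreal (1 / (scaling_constant * Gamma \<alpha>)) * ennreal (Gamma \<alpha> * real k powr (- \<alpha>))"
    using alpha k by (subst nn_integral_cmult, simp, subst nn_integral_Gamma_scaled) auto
  also have "\<dots> = ennreal (real k powr (- \<alpha>) / scaling_constant)"
    using scaling_constant_pos Gamma_alpha_pos by (subst ennreal_mult[symmetric]) (auto simp: field_simps)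
  finally show "(\<integral>\<^sup>+ x. ennreal (exp (- real k * x)) \<partial>stable_potential) = ennreal (real k powr (- \<alpha>) / scaling_constant)" .
qed

text \<open>
  Euler's reflection formula turns the Gamma factors into the constant of the arcsine law.
\<close>

lemma scaling_constant_reflection: "Gamma (1 + \<alpha>) / (scaling_constant * Gamma \<alpha>) = sin (pi * \<alpha>) / pi"
proof -
  have "complex_of_real (Gamma \<alpha> * Gamma (1 - \<alpha>)) = Gamma (complex_of_real \<alpha>) * Gamma (1 - complex_of_real \<alpha>)"
    by (simp add: Gamma_complex_of_real[symmetric])
  also have "\<dots> = complex_of_real (pi / sin (pi * \<alpha>))"
    by (simp add: Gamma_reflection_complex sin_of_real[symmetric])
  finally have "Gamma \<alpha> * Gamma (1 - \<alpha>) = pi / sin (pi * \<alpha>)" by (simp only: of_real_eq_iff)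
  then have "1 / (Gamma (1 - \<alpha>) * Gamma \<alpha>) = sin (pi * \<alpha>) / pi" by (simp add: mult.commute)
  moreover have "0 < Gamma (1 + \<alpha>)" using alpha by (intro Gamma_real_pos) auto
  ultimately show ?thesis by (simp add: scaling_constant_def mult.assoc)
qed

text \<open>
  The limit of the rescaled Levy tail, as a function of the rescaled starting time \<open>x\<close> of the
  visit that covers the interval.
\<close>

definition test_function :: "real \<Rightarrow> real \<Rightarrow> real" where
  "test_function \<theta> x = indicator {0..1} x * (Gamma (1 + \<alpha>) * (1 + \<theta> - x) powr (- \<alpha>))"

text \<open>Substitute \<open>x = (1 + \<theta>) * (1 - s)\<close>.\<close>

lemma arcsine_limit_eq:
  assumes \<theta>: "0 < \<theta>"
  shows "(LINT x|stable_potential. test_function \<theta> x) = arcsine_limit \<alpha> \<theta>"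
proof -
  have "(LINT s:{\<theta> / (1 + \<theta>)..1}|lborel. s powr (- \<alpha>) * (1 - s) powr (\<alpha> - 1))
     = \<bar>- (1 / (1 + \<theta>))\<bar> *\<^sub>R (LINT x|lborel. indicat_real {\<theta> / (1 + \<theta>)..1} (1 + - (1 / (1 + \<theta>)) * x) *\<^sub>R
         ((1 + - (1 / (1 + \<theta>)) * x) powr (- \<alpha>) * (1 - (1 + - (1 / (1 + \<theta>)) * x)) powr (\<alpha> - 1)))"
    unfolding set_lebesgue_integral_def using \<theta> by (intro lborel_integral_real_affine) auto
  also have "\<dots> = (LINT x|lborel. indicat_real {0..1} x * (x powr (\<alpha> - 1) * (1 + \<theta> - x) powr (- \<alpha>)))"
  proof (subst integral_scaleR_right[symmetric], intro Bochner_Integration.integral_cong refl)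
    fix x :: real
    define u where "u = 1 + \<theta>"
    have u: "1 < u" "\<theta> = u - 1" using \<theta> by (simp_all add: u_def)
    have ind: "1 + - (1 / (1 + \<theta>)) * x \<in> {\<theta> / (1 + \<theta>)..1} \<longleftrightarrow> x \<in> {0..1}"
      using u by (auto simp: field_simps)
    show "\<bar>- (1 / (1 + \<theta>))\<bar> *\<^sub>R indicat_real {\<theta> / (1 + \<theta>)..1} (1 + - (1 / (1 + \<theta>)) * x) *\<^sub>R
         ((1 + - (1 / (1 + \<theta>)) * x) powr (- \<alpha>) * (1 - (1 + - (1 / (1 + \<theta>)) * x)) powr (\<alpha> - 1))
      = indicat_real {0..1} x * (x powr (\<alpha> - 1) * (1 + \<theta> - x) powr (- \<alpha>))"
    proof (cases "x \<in> {0..1}")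
      case True
      have a: "1 - x / u = (u - x) / u" using u by (simp add: field_simps)
      have b: "1 - (u - x) / u = x / u" using u by (simp add: field_simps)
      have "1 / u * (((u - x) / u) powr (- \<alpha>) * (x / u) powr (\<alpha> - 1)) = x powr (\<alpha> - 1) * (u - x) powr (- \<alpha>)"
        using u True by (simp add: powr_divide powr_diff powr_minus field_simps)
      then show ?thesis using True ind u by (simp add: a b u_def[symmetric])
    qed (use ind in simp)
  qed
  finally have lhs: "arcsine_limit \<alpha> \<theta> = sin (pi * \<alpha>) / pi * (LINT x|lborel. indicat_real {0..1} x * (x powr (\<alpha> - 1) * (1 + \<theta> - x) powr (- \<alpha>)))"
    by (simp add: arcsine_limit_def)
  have "(LINT x|stable_potential. test_function \<theta> x)
      = (LINT x|density lborel (\<lambda>r. ennreal (indicator {0<..} r * (r powr (\<alpha> - 1) / (scaling_constant * Gamma \<alpha>)))). test_function \<theta> x)"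
  proof -
    have "(\<lambda>r. indicator {0<..} r * ennreal (r powr (\<alpha> - 1) / (scaling_constant * Gamma \<alpha>)))
        = (\<lambda>r. ennreal (indicator {0<..} r * (r powr (\<alpha> - 1) / (scaling_constant * Gamma \<alpha>))))"
      by (auto simp: fun_eq_iff indicator_def)
    then show ?thesis by (simp only: stable_potential_def)
  qed
  also have "\<dots> = (LINT x|lborel. (indicator {0<..} x * (x powr (\<alpha> - 1) / (scaling_constant * Gamma \<alpha>))) *\<^sub>R test_function \<theta> x)"
    using scaling_constant_pos Gamma_alpha_pos by (intro integral_density) (auto simp: test_function_def[abs_def])
  also have "\<dots> = (LINT x|lborel. sin (pi * \<alpha>) / pi * (indicat_real {0..1} x * (x powr (\<alpha> - 1) * (1 + \<theta> - x) powr (- \<alpha>))))"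
    unfolding scaling_constant_reflection[symmetric]
    by (intro Bochner_Integration.integral_cong) (auto simp: test_function_def indicator_def)
  also have "\<dots> = arcsine_limit \<alpha> \<theta>" unfolding lhs by (rule integral_mult_right_zero)
  finally show ?thesis .
qed

text \<open>
  The test function is discontinuous only at 0 and 1, which the limit measure does not charge.
\<close>

lemma test_function_limit:
  assumes Y: "\<And>n. 0 < Y n" "Y \<longlonglongrightarrow> 0" and \<theta>: "0 < \<theta>"
  shows "(\<lambda>n. LINT x|scaled_potential (Y n). test_function \<theta> x) \<longlonglongrightarrow> arcsine_limit \<alpha> \<theta>"
proof -
  define h where "h x = indicat_real {0..1} x * (exp x * (Gamma (1 + \<alpha>) * (1 + \<theta> - x) powr (- \<alpha>)))" for x
  have h_eq: "exp (- x) * h x = test_function \<theta> x" for x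
    by (simp add: h_def test_function_def indicator_def exp_add[symmetric] mult.assoc[symmetric])
  have "\<bar>h x\<bar> \<le> exp 1 * (Gamma (1 + \<alpha>) * \<theta> powr (- \<alpha>))" for x
  proof (cases "x \<in> {0..1}")
    case True
    have "h x \<le> exp 1 * (Gamma (1 + \<alpha>) * \<theta> powr (- \<alpha>))"
      using True \<theta> alpha unfolding h_def
      by (auto intro!: mult_mono powr_mono2' Gamma_real_nonneg)
    moreover have "0 \<le> h x" using alpha by (simp add: h_def Gamma_real_nonneg)
    ultimately show ?thesis by simp
  qed (use \<theta> alpha in \<open>simp add: h_def Gamma_real_nonneg\<close>)
  moreover have "AE x in stable_potential. isCont h x"
  proof -
    have cont: "isCont h x" if "x \<noteq> 0" "x \<noteq> 1" for x
    proof (cases "x \<in> {0<..<1}")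
      case True
      have "isCont (\<lambda>x. exp x * (Gamma (1 + \<alpha>) * (1 + \<theta> - x) powr (- \<alpha>))) x"
        using True \<theta> by (intro continuous_intros) auto
      moreover have "\<forall>\<^sub>F z in nhds x. h z = exp z * (Gamma (1 + \<alpha>) * (1 + \<theta> - z) powr (- \<alpha>))"
      proof -
        have "\<forall>\<^sub>F z in nhds x. z \<in> {0<..<1}" using True by (intro eventually_nhds_in_open) auto
        then show ?thesis by eventually_elim (simp add: h_def)
      qed
      ultimately show ?thesis by (simp add: isCont_cong)
    next
      case False
      have "\<forall>\<^sub>F z in nhds x. h z = 0"
      proof -
        have "\<forall>\<^sub>F z in nhds x. z \<in> - {0..1}" using False that by (intro eventually_nhds_in_open) auto
        then show ?thesis by eventually_elim (simp add: h_def)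
      qed
      then show ?thesis by (simp add: isCont_cong)
    qed
    have "AE x in lborel. isCont h x"
      using AE_lborel_singleton[of "0::real"] AE_lborel_singleton[of "1::real"]
      by eventually_elim (rule cont)
    then show ?thesis
      unfolding stable_potential_def by (subst AE_density) (auto elim!: eventually_mono)
  qed
  moreover have "h \<in> borel_measurable borel" unfolding h_def[abs_def] by measurable
  ultimately have "(\<lambda>n. LINT x|scaled_potential (Y n). exp (- x) * h x) \<longlonglongrightarrow> (LINT x|stable_potential. exp (- x) * h x)"
    using exponent_limit[OF Y]
    by (intro laplace_continuity[OF laplace_measure_scaled_potential[OF Y(1)] laplace_measure_stable_potential]) auto
  then show ?thesis by (simp add: h_eq arcsine_limit_eq[OF \<theta>])
qed

lemma no_jump_prob_scaled:
  assumes y: "0 < y" and \<theta>: "0 < \<theta>"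
  shows "ennreal (no_jump_prob P N T g y \<theta>) =
    (\<integral>\<^sup>+ x. indicator {0..1} x * (ennreal (y powr \<alpha>) * levy_tail (y * (1 + \<theta> - x))) \<partial>scaled_potential y)"
proof -
  interpret pot: laplace_measure "potential 1" "\<lambda>k. 1 / rest_exponent 0 (real k)"
    by (rule laplace_measure_potential) simp
  have "(\<integral>\<^sup>+ x. indicator {0..1} x * (ennreal (y powr \<alpha>) * levy_tail (y * (1 + \<theta> - x))) \<partial>scaled_potential y)
     = (\<integral>\<^sup>+ r. ennreal (y powr (- \<alpha>)) * (indicator {0..1} (r / y) * (ennreal (y powr \<alpha>) * levy_tail (y * (1 + \<theta> - r / y)))) \<partial>potential 1)"
    by (subst nn_integral_scaled_potential, simp, subst nn_integral_cmult) simp_all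
  also have "\<dots> = (\<integral>\<^sup>+ r. indicator {..y} r * levy_tail (y + \<theta> * y - r) \<partial>potential 1)"
  proof (rule nn_integral_cong_AE)
    show "AE r in potential 1. ennreal (y powr (- \<alpha>)) * (indicator {0..1} (r / y) * (ennreal (y powr \<alpha>) * levy_tail (y * (1 + \<theta> - r / y))))
       = indicator {..y} r * levy_tail (y + \<theta> * y - r)"
      using pot.nonneg_AE
    proof eventually_elim
      case (elim r)
      have "ennreal (y powr (- \<alpha>)) * ennreal (y powr \<alpha>) = 1"
        using y by (simp add: ennreal_mult[symmetric] powr_add[symmetric])
      then have "ennreal (y powr (- \<alpha>)) * (ennreal (y powr \<alpha>) * z) = z" for z
        by (simp add: mult.assoc[symmetric])
      moreover have "y * (1 + \<theta> - r / y) = y + \<theta> * y - r" using y by (simp add: field_simps)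
      ultimately show ?case using y elim by (auto simp: indicator_def)
    qed
  qed
  finally show ?thesis by (simp add: no_jump_prob_eq[OF y \<theta>])
qed

text \<open>
  Uniformly for starting times \<open>x\<close> in \<open>[0,1]\<close>, the rescaled Levy tail is within a factor \<open>1 \<plusminus> e\<close> of
  the test function, because \<open>\<theta> > 0\<close> keeps its argument between \<open>\<theta> y\<close> and \<open>(1 + \<theta>) y\<close>. So the probability
  has the limit of the integrals of the test function.
\<close>

theorem no_jump_prob_limit:
  assumes \<theta>: "0 < \<theta>"
  shows "((\<lambda>t. no_jump_prob P N T g t \<theta>) \<longlongrightarrow> arcsine_limit \<alpha> \<theta>) (at_right 0)"
proof (rule at_right_0_sequentiallyI)
  fix Y :: "nat \<Rightarrow> real" assume Y: "\<And>n. 0 < Y n" "Y \<longlonglongrightarrow> 0"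
  define G where "G = Gamma (1 + \<alpha>)"
  have G: "0 < G" unfolding G_def using alpha by (intro Gamma_real_pos) auto
  define J where "J n = (LINT x|scaled_potential (Y n). test_function \<theta> x)" for n
  have J: "J \<longlonglongrightarrow> arcsine_limit \<alpha> \<theta>" unfolding J_def[abs_def] by (rule test_function_limit[OF Y \<theta>])
  have test_nonneg: "0 \<le> test_function \<theta> x" for x
    using G by (simp add: test_function_def G_def)
  have J_nonneg: "0 \<le> J n" for n unfolding J_def using test_nonneg by (intro Bochner_Integration.integral_nonneg)
  have test_measurable [measurable]: "test_function \<theta> \<in> borel_measurable borel"
    unfolding test_function_def[abs_def] by measurable
  have J_nn: "(\<integral>\<^sup>+ x. ennreal (test_function \<theta> x) \<partial>scaled_potential (Y n)) = ennreal (J n)" for n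
  proof -
    interpret lm: laplace_measure "scaled_potential (Y n)" "\<lambda>k. Y n powr (- \<alpha>) / rest_exponent 0 (real k / Y n)"
      by (rule laplace_measure_scaled_potential[OF Y(1)])
    have le: "test_function \<theta> x \<le> exp 1 * (G * \<theta> powr (- \<alpha>)) * exp (- x)" for x
    proof (cases "x \<in> {0..1}")
      case True
      have "test_function \<theta> x \<le> (G * \<theta> powr (- \<alpha>)) * 1"
        using True \<theta> alpha G unfolding test_function_def G_def[symmetric] by (auto intro!: powr_mono2')
      also have "\<dots> \<le> (G * \<theta> powr (- \<alpha>)) * exp (1 - x)"
        using True G by (intro mult_left_mono) auto
      finally show ?thesis by (simp add: exp_diff exp_minus field_simps)
    qed (use G in \<open>simp add: test_function_def\<close>)
    have "(\<integral>\<^sup>+ x. ennreal (test_function \<theta> x) \<partial>scaled_potential (Y n))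
        \<le> (\<integral>\<^sup>+ x. ennreal (exp 1 * (G * \<theta> powr (- \<alpha>))) * ennreal (exp (- real 1 * x)) \<partial>scaled_potential (Y n))"
      using le G by (intro nn_integral_mono) (auto simp: ennreal_mult[symmetric] intro!: ennreal_leI)
    also have "\<dots> < \<infinity>"
      using lm.laplace[of 1] by (subst nn_integral_cmult) (auto simp: ennreal_mult_less_top)
    finally have "integrable (scaled_potential (Y n)) (test_function \<theta>)"
      using test_nonneg by (intro integrableI_nonneg) auto
    then show ?thesis unfolding J_def using test_nonneg by (intro nn_integral_eq_integral) auto
  qed
  have nonneg: "0 \<le> no_jump_prob P N T g t \<theta>" for t by (simp add: no_jump_prob_def)
  have close: "\<forall>\<^sub>F n in sequentially. \<bar>no_jump_prob P N T g (Y n) \<theta> - J n\<bar> \<le> e * J n" if e: "0 < e" "e < 1" for e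
  proof -
    have "\<forall>\<^sub>F y in at_right 0. ennreal ((1 - e) * G) < ennreal (y powr \<alpha>) * levy_tail y"
      using levy_tail_limit e G by (intro order_tendstoD(1)[where y = "ennreal G"]) (auto simp: G_def[symmetric] ennreal_less_iff)
    moreover have "\<forall>\<^sub>F y in at_right 0. ennreal (y powr \<alpha>) * levy_tail y < ennreal ((1 + e) * G)"
      using levy_tail_limit e G by (intro order_tendstoD(2)[where y = "ennreal G"]) (auto simp: G_def[symmetric] ennreal_less_iff)
    ultimately have "\<forall>\<^sub>F y in at_right 0. ennreal ((1 - e) * G) \<le> ennreal (y powr \<alpha>) * levy_tail y \<and>
        ennreal (y powr \<alpha>) * levy_tail y \<le> ennreal ((1 + e) * G)"
      by eventually_elim (auto intro: less_imp_le)
    then obtain d :: real where d: "0 < d" "\<And>y. 0 < y \<Longrightarrow> y < d \<Longrightarrow> ennreal ((1 - e) * G) \<le> ennreal (y powr \<alpha>) * levy_tail y \<and>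
        ennreal (y powr \<alpha>) * levy_tail y \<le> ennreal ((1 + e) * G)"
      by (auto simp: eventually_at_right_field)
    have "\<forall>\<^sub>F n in sequentially. Y n < d / (1 + \<theta>)"
      using d(1) \<theta> by (intro order_tendstoD(2)[OF Y(2)]) simp
    then show ?thesis
    proof eventually_elim
      case (elim n)
      let ?F = "\<lambda>x. indicator {0..1} x * (ennreal (Y n powr \<alpha>) * levy_tail (Y n * (1 + \<theta> - x)))"
      have sandwich: "ennreal ((1 - e) * test_function \<theta> x) \<le> ?F x \<and> ?F x \<le> ennreal ((1 + e) * test_function \<theta> x)" for x
      proof (cases "x \<in> {0..1}")
        case True
        define u where "u = 1 + \<theta> - x"
        have u: "0 < u" "u \<le> 1 + \<theta>" using True \<theta> by (auto simp: u_def)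
        have "Y n * u \<le> Y n * (1 + \<theta>)" using u Y(1)[of n] by (intro mult_left_mono) auto
        also have "\<dots> < d" using elim \<theta> by (simp add: field_simps)
        finally have bounds: "ennreal ((1 - e) * G) \<le> ennreal ((Y n * u) powr \<alpha>) * levy_tail (Y n * u)"
          "ennreal ((Y n * u) powr \<alpha>) * levy_tail (Y n * u) \<le> ennreal ((1 + e) * G)"
          using d(2)[of "Y n * u"] u Y(1)[of n] by auto
        have "Y n powr \<alpha> = u powr (- \<alpha>) * (Y n * u) powr \<alpha>"
          using u Y(1)[of n] by (simp add: powr_mult powr_minus)
        then have F: "?F x = ennreal (u powr (- \<alpha>)) * (ennreal ((Y n * u) powr \<alpha>) * levy_tail (Y n * u))"
          using True by (simp add: u_def[symmetric] ennreal_mult mult.assoc)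
        have t: "ennreal (c * test_function \<theta> x) = ennreal (u powr (- \<alpha>)) * ennreal (c * G)" if "0 < c" for c
          using True that G by (simp add: test_function_def G_def[symmetric] u_def[symmetric] ennreal_mult[symmetric] mult_ac)
        show ?thesis
          unfolding F using e bounds by (simp add: t mult_left_mono)
      qed (simp add: test_function_def)
      have meas: "test_function \<theta> \<in> borel_measurable (scaled_potential (Y n))"
        by (simp add: scaled_potential_def)
      have scale: "(\<integral>\<^sup>+ x. ennreal (c * test_function \<theta> x) \<partial>scaled_potential (Y n)) = ennreal (c * J n)" if "0 < c" for c
        using that meas J_nonneg test_nonneg by (simp add: ennreal_mult nn_integral_cmult J_nn)
      have "ennreal ((1 - e) * J n) \<le> ennreal (no_jump_prob P N T g (Y n) \<theta>)"
        unfolding no_jump_prob_scaled[OF Y(1) \<theta>] using sandwich e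
        by (subst scale[symmetric]) (auto intro!: nn_integral_mono)
      moreover have "ennreal (no_jump_prob P N T g (Y n) \<theta>) \<le> ennreal ((1 + e) * J n)"
        unfolding no_jump_prob_scaled[OF Y(1) \<theta>] using sandwich e
        by (subst scale[symmetric]) (auto intro!: nn_integral_mono)
      ultimately have "(1 - e) * J n \<le> no_jump_prob P N T g (Y n) \<theta>" "no_jump_prob P N T g (Y n) \<theta> \<le> (1 + e) * J n"
        using e J_nonneg nonneg by (auto simp: ennreal_le_iff)
      then show ?case by (simp add: abs_le_iff algebra_simps)
    qed
  qed
  have "(\<lambda>n. no_jump_prob P N T g (Y n) \<theta> - J n) \<longlonglongrightarrow> 0"
  proof (rule tendstoI)
    fix e :: real assume "0 < e"
    obtain B where B: "0 < B" "\<And>n. norm (J n) \<le> B"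
      using convergent_imp_Bseq[OF convergentI[OF J]] by (auto simp: Bseq_def)
    define d where "d = min (1 / 2) (e / (2 * B))"
    have d: "0 < d" "d < 1" "d * B < e"
    proof -
      have "d * B \<le> e / (2 * B) * B" using B by (intro mult_right_mono) (auto simp: d_def)
      then show "d * B < e" using B \<open>0 < e\<close> by simp
    qed (use B \<open>0 < e\<close> in \<open>auto simp: d_def\<close>)
    show "\<forall>\<^sub>F n in sequentially. dist (no_jump_prob P N T g (Y n) \<theta> - J n) 0 < e"
      using close[OF d(1,2)]
    proof eventually_elim
      case (elim n)
      also have "d * J n \<le> d * B" using B(2)[of n] d by (intro mult_left_mono) auto
      finally show ?case using d(3) by simp
    qed
  qed
  from tendsto_add[OF this J] show "(\<lambda>n. no_jump_prob P N T g (Y n) \<theta>) \<longlonglongrightarrow> arcsine_limit \<alpha> \<theta>"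
    by simp
qed

end

section \<open>Small-time tails of the stable increments\<close>

text \<open>
  The law of an increment over a short time \<open>h\<close>, divided by \<open>h\<close>, approaches the Levy measure away from
  0, but has mass \<open>1/h\<close>. Multiplying by this weight, which vanishes at 0 and is bounded below away from
  0, makes the masses converge. Since the weight is an average of \<open>1 - cos (s v)\<close> over a Gaussian \<open>s\<close>,
  characteristic functions of weighted measures are Gaussian averages of differences.
\<close>

definition gauss_weight :: "real \<Rightarrow> real" where
  "gauss_weight v = 1 - exp (- (v\<^sup>2) / 2)"

lemma measurable_gauss_weight [measurable]: "gauss_weight \<in> borel_measurable borel"
  unfolding gauss_weight_def[abs_def] by measurable

lemma gauss_weight_bounds: "0 \<le> gauss_weight v" "gauss_weight v \<le> 1" "v \<noteq> 0 \<Longrightarrow> 0 < gauss_weight v"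
  by (auto simp: gauss_weight_def)

lemma gauss_weight_mono: "0 \<le> u \<Longrightarrow> u \<le> v \<Longrightarrow> gauss_weight u \<le> gauss_weight v"
  by (auto simp: gauss_weight_def intro!: power_mono)

lemma norm_iexp_diff_le: "norm (iexp a - iexp b) \<le> min 2 \<bar>a - b\<bar>"
proof -
  have "iexp a - iexp b = iexp b * (iexp (a - b) - 1)"
    by (simp add: exp_add[symmetric] algebra_simps)
  then have eq: "norm (iexp a - iexp b) = norm (iexp (a - b) - 1)"
    by (simp add: norm_mult)
  have "norm (iexp (a - b) - 1) \<le> \<bar>a - b\<bar>"
    using iexp_approx1[of "a - b" 0] by simp
  moreover have "norm (iexp (a - b) - 1) \<le> 2"
    using norm_triangle_ineq4[of "iexp (a - b)" 1] by simp
  ultimately show ?thesis by (simp add: eq)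
qed

lemma min_2_mult_le: "min 2 (\<bar>s\<bar> * \<bar>w\<bar>) \<le> 2 * (1 + \<bar>s\<bar>) * min 1 \<bar>w :: real\<bar>"
proof (cases "\<bar>w\<bar> \<le> 1")
  case True
  have "\<bar>s\<bar> * \<bar>w\<bar> \<le> 2 * (1 + \<bar>s\<bar>) * \<bar>w\<bar>" by (intro mult_right_mono) auto
  with True show ?thesis by (simp add: min_le_iff_disj)
qed auto

lemma gaussian_average_iexp: "(CLINT s|std_normal_distribution. iexp (s * w)) = complex_of_real (exp (- (w\<^sup>2) / 2))"
  using fun_cong[OF char_std_normal_distribution, of w] by (simp add: char_def mult.commute)

text \<open>
  Fubini's theorem; the factor \<open>min 1 \<bar>w\<bar>\<close> reflects that the integrand is of order \<open>s w\<close> near \<open>w = 0\<close>, so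
  that the identity covers Levy measures.
\<close>

lemma gaussian_smoothing:
  fixes L :: "real measure" and b :: "real \<Rightarrow> real"
  assumes "sigma_finite_measure L" and sets [measurable_cong]: "sets L = sets borel"
    and b [measurable]: "b \<in> borel_measurable borel" and b_nonneg: "\<And>w. 0 \<le> b w"
    and int: "integrable L (\<lambda>w. min 1 \<bar>w\<bar> * b w)"
  shows "(CLINT w|L. iexp (r * w) * of_real (gauss_weight w * b w))
    = (CLINT s|std_normal_distribution. CLINT w|L. (iexp (r * w) - iexp ((r + s) * w)) * of_real (b w))"
proof -
  let ?G = std_normal_distribution
  interpret G: real_distribution ?G by (rule real_dist_normal_dist)
  interpret L: sigma_finite_measure L by fact
  interpret pair_sigma_finite ?G L ..
  define f where "f s w = (iexp (r * w) - iexp ((r + s) * w)) * of_real (b w)" for s w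
  define B where "B s = 2 * (1 + \<bar>s\<bar>)" for s :: real
  have B [measurable]: "B \<in> borel_measurable borel" "\<And>s. 0 \<le> B s" by (auto simp: B_def[abs_def])
  have f_le: "norm (f s w) \<le> B s * (min 1 \<bar>w\<bar> * b w)" for s w
  proof -
    have "norm (iexp (r * w) - iexp ((r + s) * w)) \<le> min 2 (\<bar>s\<bar> * \<bar>w\<bar>)"
      using norm_iexp_diff_le[of "r * w" "(r + s) * w"] by (simp add: algebra_simps abs_mult)
    also note min_2_mult_le
    finally show ?thesis
      using b_nonneg[of w] by (simp add: f_def B_def norm_mult mult_right_mono mult.assoc[symmetric])
  qed
  have [measurable]: "case_prod f \<in> borel_measurable (?G \<Otimes>\<^sub>M L)"
    unfolding f_def by measurable
  have "integrable (?G \<Otimes>\<^sub>M L) (case_prod f)"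
  proof (rule integrableI_bounded)
    have intB: "integrable ?G B"
      using integrable_std_normal_distribution_moment[of 1] by (auto simp: B_def[abs_def])
    have "(\<integral>\<^sup>+ z. ennreal (norm (case_prod f z)) \<partial>(?G \<Otimes>\<^sub>M L)) = (\<integral>\<^sup>+ s. \<integral>\<^sup>+ w. ennreal (norm (f s w)) \<partial>L \<partial>?G)"
      by (subst L.nn_integral_fst[symmetric]) auto
    also have "\<dots> \<le> (\<integral>\<^sup>+ s. \<integral>\<^sup>+ w. ennreal (B s) * ennreal (min 1 \<bar>w\<bar> * b w) \<partial>L \<partial>?G)"
      using f_le b_nonneg B(2) by (intro nn_integral_mono) (simp add: ennreal_mult[symmetric] ennreal_leI)
    also have "\<dots> = (\<integral>\<^sup>+ s. ennreal (B s) \<partial>?G) * (\<integral>\<^sup>+ w. ennreal (min 1 \<bar>w\<bar> * b w) \<partial>L)"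
      by (simp add: nn_integral_cmult nn_integral_multc)
    also have "\<dots> < \<infinity>"
      using intB int b_nonneg B(2) by (simp add: integrable_iff_bounded ennreal_mult_less_top)
    finally show "(\<integral>\<^sup>+ z. ennreal (norm (case_prod f z)) \<partial>(?G \<Otimes>\<^sub>M L)) < \<infinity>" .
  qed measurable
  then have swap: "(CLINT w|L. CLINT s|?G. f s w) = (CLINT s|?G. CLINT w|L. f s w)"
    by (rule Fubini_integral)
  have inner: "(CLINT s|?G. f s w) = iexp (r * w) * of_real (gauss_weight w * b w)" for w
  proof -
    have i: "integrable ?G (\<lambda>s. iexp (s * w))"
      by (rule G.integrable_const_bound[where B = 1]) auto
    have "f s w = (1 - iexp (s * w)) * (iexp (r * w) * of_real (b w))" for s
      by (simp add: f_def exp_add algebra_simps)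
    then have "(CLINT s|?G. f s w) = (CLINT s|?G. 1 - iexp (s * w)) * (iexp (r * w) * of_real (b w))"
      by simp
    also have "(CLINT s|?G. 1 - iexp (s * w)) = of_real (gauss_weight w)"
      using i G.prob_space gaussian_average_iexp[of w]
      by (subst Bochner_Integration.integral_diff) (simp_all add: gauss_weight_def mult.assoc)
    finally show ?thesis by (simp add: mult_ac)
  qed
  show ?thesis using swap unfolding inner unfolding f_def .
qed

lemma char_gauss_weighted:
  assumes "real_distribution \<mu>"
  shows "(CLINT v|\<mu>. iexp (r * v) * of_real (gauss_weight v)) = (CLINT s|std_normal_distribution. char \<mu> r - char \<mu> (r + s))"
proof -
  interpret real_distribution \<mu> by fact
  have i: "integrable \<mu> (\<lambda>v. iexp (a * v))" for a
    by (rule integrable_const_bound[where B = 1]) auto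
  have "integrable \<mu> (\<lambda>w. min 1 \<bar>w\<bar> * 1)"
    by (rule integrable_const_bound[where B = 1]) auto
  from gaussian_smoothing[OF sigma_finite_measure_axioms _ _ _ this, of r]
  have "(CLINT v|\<mu>. iexp (r * v) * of_real (gauss_weight v)) = (CLINT s|std_normal_distribution. CLINT v|\<mu>. (iexp (r * v) - iexp ((r + s) * v)))"
    by simp
  moreover have "(CLINT v|\<mu>. (iexp (r * v) - iexp ((r + s) * v))) = char \<mu> r - char \<mu> (r + s)" for s
    unfolding char_def by (intro Bochner_Integration.integral_diff i)
  ultimately show ?thesis by simp
qed

text \<open>
  The Levy density of the stable subordinator without its factor \<open>\<alpha>\<close>.
\<close>

definition stable_density :: "real \<Rightarrow> real \<Rightarrow> real" where
  "stable_density \<alpha> w = indicator {0<..} w * w powr (- 1 - \<alpha>)"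

definition stable_exponent :: "real \<Rightarrow> real \<Rightarrow> complex" where
  "stable_exponent \<alpha> r = (CLINT w|lborel. (iexp (r * w) - 1) * of_real (stable_density \<alpha> w))"

lemma measurable_stable_density [measurable]: "stable_density \<alpha> \<in> borel_measurable borel"
  unfolding stable_density_def[abs_def] by measurable

lemma stable_density_nonneg: "0 \<le> stable_density \<alpha> w"
  by (simp add: stable_density_def)

lemma nn_integral_stable_tail:
  assumes "0 < \<alpha>" "0 < u"
  shows "(\<integral>\<^sup>+ w. ennreal (\<alpha> * stable_density \<alpha> w) * indicator {u<..} w \<partial>lborel) = ennreal (u powr (- \<alpha>))"
proof -
  have "(\<integral>\<^sup>+ w. ennreal (\<alpha> * stable_density \<alpha> w) * indicator {u<..} w \<partial>lborel)
      = (\<integral>\<^sup>+ w. ennreal (\<alpha> * w powr (- 1 - \<alpha>)) * indicator {u..} w \<partial>lborel)"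
    using AE_lborel_singleton[of u] assms(2)
    by (intro nn_integral_cong_AE) (auto elim!: eventually_mono simp: stable_density_def indicator_def)
  also have "\<dots> = ennreal (0 - (- (u powr (- \<alpha>))))"
  proof (rule nn_integral_FTC_atLeast)
    show "((\<lambda>w. - (w powr (- \<alpha>))) has_real_derivative \<alpha> * w powr (- 1 - \<alpha>)) (at w)" if "u \<le> w" for w
      using that assms by (auto intro!: derivative_eq_intros simp: powr_diff powr_minus field_simps)
    have "((\<lambda>w. - (w powr (- \<alpha>))) \<longlongrightarrow> - 0) at_top"
      using assms by (intro tendsto_minus tendsto_neg_powr filterlim_ident) simp
    then show "((\<lambda>w. - (w powr (- \<alpha>))) \<longlongrightarrow> 0) at_top" by simp
  qed (use assms in auto)
  finally show ?thesis by simp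
qed

lemma integrable_stable_min:
  assumes "0 < \<alpha>" "\<alpha> < 1"
  shows "integrable lborel (\<lambda>w. min 1 \<bar>w\<bar> * stable_density \<alpha> w)"
proof (rule integrableI_nonneg)
  have le: "ennreal (min 1 \<bar>w\<bar> * stable_density \<alpha> w) \<le> ennreal (exp 1) * (indicator {0<..} w * ennreal (w powr ((1 - \<alpha>) - 1) * exp (- (1 * w))))
       + ennreal (1 / \<alpha>) * (ennreal (\<alpha> * stable_density \<alpha> w) * indicator {1<..} w)" for w :: real
  proof (cases "0 < w \<and> w \<le> 1")
    case True
    then have "w * w powr (- 1 - \<alpha>) = w powr (- \<alpha>)" by (simp add: powr_diff powr_minus field_simps)
    moreover have "w powr (- \<alpha>) * 1 \<le> w powr (- \<alpha>) * (exp 1 * exp (- w))"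
      using True by (intro mult_left_mono) (auto simp: exp_add[symmetric])
    ultimately show ?thesis
      using True by (auto simp: stable_density_def min_def ennreal_mult[symmetric] mult_ac intro!: ennreal_leI)
  next
    case False
    then show ?thesis using assms
      by (auto simp: stable_density_def indicator_def ennreal_mult[symmetric] add_increasing)
  qed
  have "(\<integral>\<^sup>+ w. ennreal (min 1 \<bar>w\<bar> * stable_density \<alpha> w) \<partial>lborel)
    \<le> (\<integral>\<^sup>+ w. ennreal (exp 1) * (indicator {0<..} w * ennreal (w powr ((1 - \<alpha>) - 1) * exp (- (1 * w))))
       + ennreal (1 / \<alpha>) * (ennreal (\<alpha> * stable_density \<alpha> w) * indicator {1<..} w) \<partial>lborel)"
    by (intro nn_integral_mono le)
  also have "\<dots> = ennreal (exp 1) * ennreal (Gamma (1 - \<alpha>) * 1 powr (- (1 - \<alpha>))) + ennreal (1 / \<alpha>) * ennreal (1 powr (- \<alpha>))"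
    using assms nn_integral_Gamma_scaled[of "1 - \<alpha>" 1] nn_integral_stable_tail[of \<alpha> 1]
    by (subst nn_integral_add, measurable, subst (1 2) nn_integral_cmult) auto
  also have "\<dots> < \<infinity>" by (simp add: ennreal_mult_less_top)
  finally show "(\<integral>\<^sup>+ w. ennreal (min 1 \<bar>w\<bar> * stable_density \<alpha> w) \<partial>lborel) < \<infinity>" .
qed (auto simp: stable_density_nonneg)

lemma integrable_stable_iexp:
  assumes "0 < \<alpha>" "\<alpha> < 1"
  shows "integrable lborel (\<lambda>w. (iexp (r * w) - 1) * of_real (stable_density \<alpha> w))"
    and "norm (stable_exponent \<alpha> r) \<le> 2 * (1 + \<bar>r\<bar>) * (LINT w|lborel. min 1 \<bar>w\<bar> * stable_density \<alpha> w)"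
proof -
  have le: "norm ((iexp (r * w) - 1) * of_real (stable_density \<alpha> w)) \<le> 2 * (1 + \<bar>r\<bar>) * (min 1 \<bar>w\<bar> * stable_density \<alpha> w)" for w
  proof -
    have "norm (iexp (r * w) - 1) \<le> min 2 (\<bar>r\<bar> * \<bar>w\<bar>)"
      using norm_iexp_diff_le[of "r * w" 0] by (simp add: abs_mult)
    also note min_2_mult_le
    finally show ?thesis
      using stable_density_nonneg[of \<alpha> w] by (simp add: norm_mult mult_right_mono mult.assoc[symmetric])
  qed
  have int: "integrable lborel (\<lambda>w. 2 * (1 + \<bar>r\<bar>) * (min 1 \<bar>w\<bar> * stable_density \<alpha> w))"
    using integrable_stable_min[OF assms] by (intro integrable_mult_right) auto
  show i: "integrable lborel (\<lambda>w. (iexp (r * w) - 1) * of_real (stable_density \<alpha> w))"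
    by (rule Bochner_Integration.integrable_bound[OF int]) (use le stable_density_nonneg[of \<alpha>] in \<open>auto intro!: AE_I2 simp: abs_mult\<close>)
  have "norm (stable_exponent \<alpha> r) \<le> (LINT w|lborel. 2 * (1 + \<bar>r\<bar>) * (min 1 \<bar>w\<bar> * stable_density \<alpha> w))"
    unfolding stable_exponent_def using le by (intro Bochner_Integration.integral_norm_bound_integral i int)
  then show "norm (stable_exponent \<alpha> r) \<le> 2 * (1 + \<bar>r\<bar>) * (LINT w|lborel. min 1 \<bar>w\<bar> * stable_density \<alpha> w)"
    by simp
qed

lemma stable_gauss_weighted:
  assumes "0 < \<alpha>" "\<alpha> < 1"
  shows "(CLINT w|lborel. iexp (r * w) * of_real (gauss_weight w * stable_density \<alpha> w))
    = (CLINT s|std_normal_distribution. stable_exponent \<alpha> r - stable_exponent \<alpha> (r + s))"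
proof -
  have "(CLINT w|lborel. (iexp (r * w) - iexp ((r + s) * w)) * of_real (stable_density \<alpha> w)) = stable_exponent \<alpha> r - stable_exponent \<alpha> (r + s)" for s
  proof -
    have "(CLINT w|lborel. (iexp (r * w) - iexp ((r + s) * w)) * of_real (stable_density \<alpha> w))
      = (CLINT w|lborel. (iexp (r * w) - 1) * of_real (stable_density \<alpha> w) - (iexp ((r + s) * w) - 1) * of_real (stable_density \<alpha> w))"
      by (intro Bochner_Integration.integral_cong) (auto simp: algebra_simps)
    also have "\<dots> = stable_exponent \<alpha> r - stable_exponent \<alpha> (r + s)"
      unfolding stable_exponent_def by (intro Bochner_Integration.integral_diff integrable_stable_iexp assms)
    finally show ?thesis .
  qed
  with gaussian_smoothing[OF lborel.sigma_finite_measure_axioms _ _ _ integrable_stable_min[OF assms], of r] show ?thesis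
    by (simp add: stable_density_nonneg)
qed

lemma exp_difference_quotient:
  fixes z :: complex and h :: "nat \<Rightarrow> real"
  assumes "\<And>n. 0 < h n" "h \<longlonglongrightarrow> 0"
  shows "(\<lambda>n. (exp (of_real (h n) * z) - 1) / of_real (h n)) \<longlonglongrightarrow> z"
proof (cases "z = 0")
  case False
  have "((\<lambda>w::complex. (exp (0 + w) - exp 0) / w) \<longlongrightarrow> exp 0) (at 0)"
    using DERIV_exp[of "0::complex"] by (simp only: DERIV_def)
  then have lim: "((\<lambda>w::complex. (exp w - 1) / w) \<longlongrightarrow> 1) (at 0)" by simp
  have "filterlim (\<lambda>n. of_real (h n) * z) (at 0) sequentially"
  proof -
    have "(\<lambda>n. of_real (h n) * z) \<longlonglongrightarrow> of_real 0 * z" by (intro tendsto_intros assms)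
    moreover have "of_real (h n) * z \<noteq> 0" for n using assms(1)[of n] False by simp
    ultimately show ?thesis by (simp add: filterlim_at)
  qed
  from filterlim_compose[OF lim this]
  have "(\<lambda>n. z * ((exp (of_real (h n) * z) - 1) / (of_real (h n) * z))) \<longlonglongrightarrow> z * 1"
    by (intro tendsto_mult_left) (simp add: comp_def)
  with False show ?thesis by simp
qed simp

text \<open>The exponential function has derivative bounded by 1 on the left half-plane.\<close>

lemma norm_exp_minus_1_le:
  fixes z :: complex
  assumes "norm (exp z) \<le> 1"
  shows "norm (exp z - 1) \<le> norm z"
proof -
  have re: "Re z \<le> 0" using assms by (simp add: norm_exp)
  have "norm (exp z - exp 0) \<le> 1 * norm (z - 0)"
  proof (rule field_differentiable_bound[of "{w. Re w \<le> 0}" exp exp])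
    show "convex {w. Re w \<le> 0}" by (rule convex_halfspace_Re_le)
    show "(exp has_field_derivative exp w) (at w within {w. Re w \<le> 0})" for w :: complex
      by (rule DERIV_subset[OF DERIV_exp]) simp
    show "norm (exp w) \<le> 1" if "w \<in> {w. Re w \<le> 0}" for w using that by (simp add: norm_exp)
  qed (use re in auto)
  then show ?thesis by simp
qed

text \<open>
  Weighted by \<open>gauss_weight\<close> and normalised, the laws converge by Levy's continuity theorem. The tail
  probability is the integral of the bounded function \<open>indicator {u<..} / gauss_weight\<close>, continuous except
  at \<open>u\<close>, which the limit does not charge.
\<close>

lemma stable_small_time_tail:
  fixes \<mu> :: "nat \<Rightarrow> real measure" and h :: "nat \<Rightarrow> real"
  assumes \<alpha>: "0 < \<alpha>" "\<alpha> < 1" and h: "\<And>n. 0 < h n" "h \<longlonglongrightarrow> 0" and u: "0 < u"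
    and \<mu>: "\<And>n. real_distribution (\<mu> n)"
    and char: "\<And>n r. char (\<mu> n) r = exp (of_real (\<alpha> * h n) * stable_exponent \<alpha> r)"
  shows "(\<lambda>n. measure (\<mu> n) {u<..} / h n) \<longlonglongrightarrow> u powr (- \<alpha>)"
proof -
  let ?G = std_normal_distribution
  let ?q = gauss_weight
  interpret G: real_distribution ?G by (rule real_dist_normal_dist)
  interpret \<mu>: real_distribution "\<mu> n" for n by (rule \<mu>)
  define A where "A n r = (CLINT v|\<mu> n. iexp (r * v) * of_real (?q v)) / of_real (h n)" for n r
  define A' where "A' r = of_real \<alpha> * (CLINT w|lborel. iexp (r * w) * of_real (?q w * stable_density \<alpha> w))" for r
  define c where "c = (LINT w|lborel. min 1 \<bar>w\<bar> * stable_density \<alpha> w)"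
  have c: "norm (stable_exponent \<alpha> r) \<le> 2 * (1 + \<bar>r\<bar>) * c" for r
    unfolding c_def by (rule integrable_stable_iexp(2)[OF \<alpha>])
  have c0: "0 \<le> c" unfolding c_def by (intro Bochner_Integration.integral_nonneg) (simp add: stable_density_nonneg)
  have char_le: "norm (char (\<mu> n) r - 1) \<le> h n * norm (stable_exponent \<alpha> r)" for n r
  proof -
    have "norm (char (\<mu> n) r - 1) \<le> norm (of_real (\<alpha> * h n) * stable_exponent \<alpha> r)"
      unfolding char using \<mu>.cmod_char_le_1[of n r] by (intro norm_exp_minus_1_le) (simp add: char)
    also have "\<dots> = \<alpha> * h n * norm (stable_exponent \<alpha> r)"
      using \<alpha> h(1)[of n] by (simp add: norm_mult)
    also have "\<dots> \<le> 1 * h n * norm (stable_exponent \<alpha> r)"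
      using \<alpha> h(1)[of n] by (intro mult_right_mono) auto
    finally show ?thesis by simp
  qed
  have exponent_measurable: "stable_exponent \<alpha> \<in> borel_measurable borel"
  proof (rule borel_measurable_LIMSEQ_metric)
    show "(\<lambda>n. (char (\<mu> n) r - 1) / of_real (\<alpha> * h n)) \<longlonglongrightarrow> stable_exponent \<alpha> r" for r
    proof -
      have "(\<lambda>n. \<alpha> * h n) \<longlonglongrightarrow> \<alpha> * 0" by (intro tendsto_intros h)
      then show ?thesis unfolding char using \<alpha> h by (intro exp_difference_quotient) auto
    qed
  qed measurable
  \<comment> \<open>Since \<open>(char - 1) / h\<close> converges to the Levy exponent, so do the Gaussian averages of differences.\<close>
  have A_lim: "(\<lambda>n. A n r) \<longlonglongrightarrow> A' r" for r
  proof -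
    have A_eq: "A n r = (CLINT s|?G. (char (\<mu> n) r - char (\<mu> n) (r + s)) / of_real (h n))" for n
      unfolding A_def char_gauss_weighted[OF \<mu>] by simp
    have A'_eq: "A' r = (CLINT s|?G. of_real \<alpha> * (stable_exponent \<alpha> r - stable_exponent \<alpha> (r + s)))"
      unfolding A'_def stable_gauss_weighted[OF \<alpha>] by simp
    show ?thesis
      unfolding A_eq A'_eq
    proof (rule integral_dominated_convergence[where w = "\<lambda>s. 4 * c * (1 + \<bar>r\<bar>) + 2 * c * \<bar>s\<bar>"])
      have [measurable]: "stable_exponent \<alpha> \<in> borel_measurable borel" by (rule exponent_measurable)
      show "(\<lambda>s. of_real \<alpha> * (stable_exponent \<alpha> r - stable_exponent \<alpha> (r + s))) \<in> borel_measurable ?G"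
        by measurable
      show "(\<lambda>s. (char (\<mu> n) r - char (\<mu> n) (r + s)) / of_real (h n)) \<in> borel_measurable ?G" for n
        by measurable
      show "integrable ?G (\<lambda>s. 4 * c * (1 + \<bar>r\<bar>) + 2 * c * \<bar>s\<bar>)"
        using integrable_std_normal_distribution_moment[of 1] by auto
      show "AE s in ?G. (\<lambda>n. (char (\<mu> n) r - char (\<mu> n) (r + s)) / of_real (h n)) \<longlonglongrightarrow>
          of_real \<alpha> * (stable_exponent \<alpha> r - stable_exponent \<alpha> (r + s))"
      proof (intro AE_I2)
        fix s
        have q: "(\<lambda>n. (char (\<mu> n) a - 1) / of_real (h n)) \<longlonglongrightarrow> of_real \<alpha> * stable_exponent \<alpha> a" for a
          using exp_difference_quotient[OF h, of "of_real \<alpha> * stable_exponent \<alpha> a"]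
          by (simp add: char mult_ac)
        from tendsto_diff[OF q[of r] q[of "r + s"]]
        show "(\<lambda>n. (char (\<mu> n) r - char (\<mu> n) (r + s)) / of_real (h n)) \<longlonglongrightarrow>
          of_real \<alpha> * (stable_exponent \<alpha> r - stable_exponent \<alpha> (r + s))"
          by (simp add: diff_divide_distrib[symmetric] right_diff_distrib)
      qed
      show "AE s in ?G. norm ((char (\<mu> n) r - char (\<mu> n) (r + s)) / of_real (h n)) \<le> 4 * c * (1 + \<bar>r\<bar>) + 2 * c * \<bar>s\<bar>" for n
      proof (intro AE_I2)
        fix s
        have "norm (char (\<mu> n) r - char (\<mu> n) (r + s)) \<le> norm (char (\<mu> n) r - 1) + norm (char (\<mu> n) (r + s) - 1)"
          using norm_triangle_ineq4[of "char (\<mu> n) r - 1" "char (\<mu> n) (r + s) - 1"] by simp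
        also have "\<dots> \<le> h n * (2 * (1 + \<bar>r\<bar>) * c) + h n * (2 * (1 + \<bar>r + s\<bar>) * c)"
          using h(1)[of n] by (intro add_mono order_trans[OF char_le] mult_left_mono c) auto
        also have "\<dots> \<le> h n * (2 * (1 + \<bar>r\<bar>) * c) + h n * (2 * (1 + (\<bar>r\<bar> + \<bar>s\<bar>)) * c)"
          using h(1)[of n] c0 by (intro add_left_mono mult_left_mono mult_right_mono) auto
        also have "\<dots> = h n * (4 * c * (1 + \<bar>r\<bar>) + 2 * c * \<bar>s\<bar>)" by (simp add: algebra_simps)
        finally show "norm ((char (\<mu> n) r - char (\<mu> n) (r + s)) / of_real (h n)) \<le> 4 * c * (1 + \<bar>r\<bar>) + 2 * c * \<bar>s\<bar>"
          using h(1)[of n] by (simp add: norm_divide divide_le_eq mult.commute)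
      qed
    qed
  qed
  define m where "m n = (LINT v|\<mu> n. ?q v) / h n" for n
  define m' where "m' = \<alpha> * (LINT w|lborel. ?q w * stable_density \<alpha> w)"
  have q_le: "?q w \<le> min 1 \<bar>w\<bar>" for w
  proof -
    have "1 - exp (- (w\<^sup>2) / 2) \<le> w\<^sup>2 / 2" using exp_ge_add_one_self[of "- (w\<^sup>2) / 2"] by simp
    moreover have "w\<^sup>2 / 2 \<le> \<bar>w\<bar>" if "\<bar>w\<bar> \<le> 1"
      using that mult_left_mono[of "\<bar>w\<bar>" 1 "\<bar>w\<bar>"] by (simp add: power2_eq_square abs_mult_self)
    ultimately show ?thesis
      using gauss_weight_bounds(2)[of w] by (cases "\<bar>w\<bar> \<le> 1") (auto simp: gauss_weight_def)
  qed
  have int_q: "integrable lborel (\<lambda>w. ?q w * stable_density \<alpha> w)"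
    by (rule Bochner_Integration.integrable_bound[OF integrable_stable_min[OF \<alpha>]])
       (use q_le gauss_weight_bounds stable_density_nonneg[of \<alpha>] in \<open>auto simp: abs_mult intro!: mult_right_mono\<close>)
  have A0: "A n 0 = of_real (m n)" "A' 0 = of_real m'" for n
    by (simp_all add: A_def A'_def m_def m'_def of_real_mult[symmetric] del: of_real_mult)
  have "(\<lambda>n. complex_of_real (m n)) \<longlonglongrightarrow> complex_of_real m'" using A_lim[of 0] by (simp add: A0)
  then have m_lim: "m \<longlonglongrightarrow> m'" by (simp only: tendsto_of_real_iff)
  have nn_q: "(\<integral>\<^sup>+ w. ennreal (?q w * (\<alpha> * stable_density \<alpha> w)) \<partial>lborel) = ennreal m'"
    using \<alpha> int_q gauss_weight_bounds stable_density_nonneg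
    by (subst nn_integral_eq_integral) (auto simp: m'_def mult_ac)
  have m': "0 < m'"
  proof -
    have pos: "0 < gauss_weight u * u powr (- \<alpha>)" using u gauss_weight_bounds(3)[of u] by simp
    have "ennreal (gauss_weight u * u powr (- \<alpha>)) = (\<integral>\<^sup>+ w. ennreal (?q u) * (ennreal (\<alpha> * stable_density \<alpha> w) * indicator {u<..} w) \<partial>lborel)"
      using \<alpha> u gauss_weight_bounds(1) by (subst nn_integral_cmult) (auto simp: nn_integral_stable_tail ennreal_mult)
    also have "\<dots> \<le> (\<integral>\<^sup>+ w. ennreal (?q w * (\<alpha> * stable_density \<alpha> w)) \<partial>lborel)"
    proof (rule nn_integral_mono)
      fix w :: real
      show "ennreal (?q u) * (ennreal (\<alpha> * stable_density \<alpha> w) * indicator {u<..} w) \<le> ennreal (?q w * (\<alpha> * stable_density \<alpha> w))"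
      proof (cases "u < w")
        case True
        have "?q u * (\<alpha> * stable_density \<alpha> w) \<le> ?q w * (\<alpha> * stable_density \<alpha> w)"
          using True u \<alpha> gauss_weight_mono[of u w] stable_density_nonneg[of \<alpha> w] by (intro mult_right_mono) auto
        then show ?thesis
          using True \<alpha> gauss_weight_bounds(1) stable_density_nonneg[of \<alpha> w]
          by (simp add: ennreal_mult[symmetric] ennreal_leI)
      qed simp
    qed
    finally have "gauss_weight u * u powr (- \<alpha>) \<le> m'"
      unfolding nn_q using pos by (subst (asm) ennreal_le_iff2) auto
    with pos show ?thesis by linarith
  qed
  define f where "f v = indicat_real {u<..} v / ?q v" for v
  have f_meas [measurable]: "f \<in> borel_measurable borel" unfolding f_def[abs_def] by measurable
  have qu: "0 < ?q u" using u gauss_weight_bounds(3)[of u] by simp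
  have f_bound: "norm (f v) \<le> 1 / ?q u" for v
    using gauss_weight_mono[of u v] u qu by (auto simp: f_def indicator_def intro!: divide_left_mono)
  have f_cont: "isCont f v" if "v \<noteq> u" for v
  proof (cases "u < v")
    case True
    have "isCont (\<lambda>v. 1 / ?q v) v"
      unfolding gauss_weight_def using True u by (intro continuous_intros) auto
    moreover have "\<forall>\<^sub>F z in nhds v. f z = 1 / ?q z"
    proof -
      have "\<forall>\<^sub>F z in nhds v. z \<in> {u<..}" using True by (intro eventually_nhds_in_open) auto
      then show ?thesis by eventually_elim (simp add: f_def)
    qed
    ultimately show ?thesis by (simp add: isCont_cong)
  next
    case False
    have "\<forall>\<^sub>F z in nhds v. f z = 0"
    proof -
      have "\<forall>\<^sub>F z in nhds v. z \<in> {..<u}" using False that by (intro eventually_nhds_in_open) auto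
      then show ?thesis by eventually_elim (simp add: f_def)
    qed
    then show ?thesis by (simp add: isCont_cong)
  qed
  \<comment> \<open>The normalising masses are positive from some \<open>n0\<close> on, so the sequence is shifted by \<open>n0\<close>.\<close>
  have "\<forall>\<^sub>F n in sequentially. 0 < m n" by (rule order_tendstoD(1)[OF m_lim m'])
  then obtain n0 where n0: "\<And>n. n0 \<le> n \<Longrightarrow> 0 < m n" by (auto simp: eventually_sequentially)
  define \<kappa> where "\<kappa> n = density (\<mu> (n + n0)) (\<lambda>v. ennreal (?q v / (h (n + n0) * m (n + n0))))" for n
  define \<kappa>' where "\<kappa>' = density lborel (\<lambda>w. ennreal (?q w * (\<alpha> * stable_density \<alpha> w) / m'))"
  have pos_n: "0 < h (n + n0) * m (n + n0)" for n using h(1) n0 by simp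
  have dist_\<kappa>: "real_distribution (\<kappa> n)" for n
  proof -
    have "(\<integral>\<^sup>+ v. ennreal (?q v / (h (n + n0) * m (n + n0))) \<partial>\<mu> (n + n0)) = ennreal (LINT v|\<mu> (n + n0). ?q v / (h (n + n0) * m (n + n0)))"
      using gauss_weight_bounds pos_n[of n]
      by (intro nn_integral_eq_integral Bochner_Integration.integrable_divide \<mu>.integrable_const_bound[where B = 1]) auto
    also have "(LINT v|\<mu> (n + n0). ?q v / (h (n + n0) * m (n + n0))) = 1"
      using h(1)[of "n + n0"] n0[of "n + n0"] by (auto simp: m_def zero_less_divide_iff)
    finally have "prob_space (\<kappa> n)"
      by (intro prob_spaceI) (simp add: \<kappa>_def emeasure_density)
    then interpret prob_space "\<kappa> n" .
    show ?thesis by unfold_locales (simp_all add: \<kappa>_def)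
  qed
  have dist_\<kappa>': "real_distribution \<kappa>'"
  proof -
    have "(\<integral>\<^sup>+ w. ennreal (?q w * (\<alpha> * stable_density \<alpha> w) / m') \<partial>lborel) = (\<integral>\<^sup>+ w. ennreal (?q w * (\<alpha> * stable_density \<alpha> w)) / ennreal m' \<partial>lborel)"
      using m' \<alpha> gauss_weight_bounds stable_density_nonneg by (simp add: divide_ennreal)
    also have "\<dots> = 1" using m' by (subst nn_integral_divide) (auto simp: nn_q ennreal_divide_self)
    finally have "prob_space \<kappa>'"
      by (intro prob_spaceI) (simp add: \<kappa>'_def emeasure_density)
    then interpret prob_space \<kappa>' .
    show ?thesis by unfold_locales (simp_all add: \<kappa>'_def)
  qed
  have char_\<kappa>: "char (\<kappa> n) r = A (n + n0) r / of_real (m (n + n0))" for n r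
  proof -
    have "char (\<kappa> n) r = (CLINT v|\<mu> (n + n0). (?q v / (h (n + n0) * m (n + n0))) *\<^sub>R iexp (r * v))"
      unfolding char_def \<kappa>_def using pos_n[of n] gauss_weight_bounds
      by (intro integral_density) (auto intro!: AE_I2 divide_nonneg_pos)
    also have "\<dots> = (CLINT v|\<mu> (n + n0). iexp (r * v) * of_real (?q v) / of_real (h (n + n0) * m (n + n0)))"
      by (intro Bochner_Integration.integral_cong) (auto simp: scaleR_conv_of_real)
    also have "\<dots> = A (n + n0) r / of_real (m (n + n0))" by (simp add: A_def)
    finally show ?thesis .
  qed
  have char_\<kappa>': "char \<kappa>' r = A' r / of_real m'" for r
  proof -
    have "char \<kappa>' r = (CLINT w|lborel. (?q w * (\<alpha> * stable_density \<alpha> w) / m') *\<^sub>R iexp (r * w))"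
      unfolding char_def \<kappa>'_def using m' \<alpha> gauss_weight_bounds stable_density_nonneg
      by (intro integral_density) (auto intro!: AE_I2 divide_nonneg_pos mult_nonneg_nonneg)
    also have "\<dots> = (CLINT w|lborel. (of_real \<alpha> / of_real m') * (iexp (r * w) * of_real (?q w * stable_density \<alpha> w)))"
      by (intro Bochner_Integration.integral_cong) (auto simp: scaleR_conv_of_real)
    also have "\<dots> = (of_real \<alpha> / of_real m') * (CLINT w|lborel. iexp (r * w) * of_real (?q w * stable_density \<alpha> w))"
      by (rule integral_mult_right_zero)
    finally show ?thesis by (simp add: A'_def)
  qed
  have "weak_conv_m \<kappa> \<kappa>'"
  proof (rule levy_continuity[OF dist_\<kappa> dist_\<kappa>'])
    show "(\<lambda>n. char (\<kappa> n) t) \<longlonglongrightarrow> char \<kappa>' t" for t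
      unfolding char_\<kappa> char_\<kappa>' using m'
      by (intro tendsto_divide LIMSEQ_ignore_initial_segment A_lim tendsto_of_real m_lim) auto
  qed
  moreover have "emeasure \<kappa>' {v. \<not> isCont f v} = 0"
  proof -
    have "emeasure \<kappa>' {v. \<not> isCont f v} \<le> emeasure \<kappa>' {u}"
      using f_cont by (intro emeasure_mono) (auto simp: \<kappa>'_def)
    also have "\<dots> = 0"
      unfolding \<kappa>'_def using AE_lborel_singleton[of u]
      by (subst emeasure_density) (auto intro!: nn_integral_zero' elim!: eventually_mono)
    finally show ?thesis by simp
  qed
  ultimately have "(\<lambda>n. integral\<^sup>L (\<kappa> n) f) \<longlonglongrightarrow> integral\<^sup>L \<kappa>' f"
    by (intro weak_conv_imp_bdd_ae_continuous_conv[OF dist_\<kappa> dist_\<kappa>' _ _ f_bound f_meas])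
  moreover have "integral\<^sup>L (\<kappa> n) f = measure (\<mu> (n + n0)) {u<..} / h (n + n0) / m (n + n0)" for n
  proof -
    have "integral\<^sup>L (\<kappa> n) f = (LINT v|\<mu> (n + n0). (?q v / (h (n + n0) * m (n + n0))) *\<^sub>R f v)"
      unfolding \<kappa>_def using pos_n[of n] gauss_weight_bounds
      by (intro integral_density) (auto intro!: AE_I2 divide_nonneg_pos)
    also have "\<dots> = (LINT v|\<mu> (n + n0). indicator {u<..} v / (h (n + n0) * m (n + n0)))"
    proof (intro Bochner_Integration.integral_cong refl)
      fix v
      show "(?q v / (h (n + n0) * m (n + n0))) *\<^sub>R f v = indicator {u<..} v / (h (n + n0) * m (n + n0))"
      proof (cases "u < v")
        case True
        with u gauss_weight_bounds(3)[of v] have "?q v \<noteq> 0" by simp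
        with True show ?thesis by (simp add: f_def)
      qed (simp add: f_def)
    qed
    also have "\<dots> = measure (\<mu> (n + n0)) {u<..} / h (n + n0) / m (n + n0)" by simp
    finally show ?thesis .
  qed
  moreover have "integral\<^sup>L \<kappa>' f = u powr (- \<alpha>) / m'"
  proof -
    have "integral\<^sup>L \<kappa>' f = (LINT w|lborel. (?q w * (\<alpha> * stable_density \<alpha> w) / m') *\<^sub>R f w)"
      unfolding \<kappa>'_def using m' \<alpha> gauss_weight_bounds stable_density_nonneg
      by (intro integral_density) (auto intro!: AE_I2 divide_nonneg_pos mult_nonneg_nonneg)
    also have "\<dots> = (LINT w|lborel. (\<alpha> * stable_density \<alpha> w * indicator {u<..} w) / m')"
    proof (intro Bochner_Integration.integral_cong refl)
      fix w
      show "(?q w * (\<alpha> * stable_density \<alpha> w) / m') *\<^sub>R f w = \<alpha> * stable_density \<alpha> w * indicator {u<..} w / m'"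
      proof (cases "u < w")
        case True
        with u gauss_weight_bounds(3)[of w] have "?q w \<noteq> 0" by simp
        with True show ?thesis by (simp add: f_def)
      qed (simp add: f_def)
    qed
    also have "\<dots> = (LINT w|lborel. \<alpha> * stable_density \<alpha> w * indicator {u<..} w) / m'" by simp
    also have "(LINT w|lborel. \<alpha> * stable_density \<alpha> w * indicator {u<..} w) = enn2real (\<integral>\<^sup>+ w. ennreal (\<alpha> * stable_density \<alpha> w * indicator {u<..} w) \<partial>lborel)"
      using \<alpha> stable_density_nonneg by (intro integral_eq_nn_integral) auto
    also have "(\<integral>\<^sup>+ w. ennreal (\<alpha> * stable_density \<alpha> w * indicator {u<..} w) \<partial>lborel) = ennreal (u powr (- \<alpha>))"
      unfolding nn_integral_stable_tail[OF \<alpha>(1) u, symmetric]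
      by (intro nn_integral_cong) (auto simp: indicator_def)
    finally show ?thesis by simp
  qed
  ultimately have "(\<lambda>n. measure (\<mu> (n + n0)) {u<..} / h (n + n0) / m (n + n0)) \<longlonglongrightarrow> u powr (- \<alpha>) / m'" by simp
  from tendsto_mult[OF this LIMSEQ_ignore_initial_segment[OF m_lim, of n0]]
  have "(\<lambda>n. measure (\<mu> (n + n0)) {u<..} / h (n + n0)) \<longlonglongrightarrow> u powr (- \<alpha>)"
    using m' n0 by (simp add: less_imp_neq[symmetric])
  then show ?thesis by (rule LIMSEQ_offset)
qed

section \<open>Atoms and dyadic increments\<close>

definition dyadic :: "nat \<Rightarrow> nat \<Rightarrow> real set" where
  "dyadic m k = {real k / 2 ^ m <.. real (Suc k) / 2 ^ m}"

text \<open>The number of the half-open dyadic interval that contains \<open>z > 0\<close>.\<close>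

definition dyadic_index :: "nat \<Rightarrow> real \<Rightarrow> nat" where
  "dyadic_index m z = nat (\<lceil>z * 2 ^ m\<rceil> - 1)"

lemma dyadic_sets [measurable]: "dyadic m k \<in> sets borel"
  by (simp add: dyadic_def)

lemma mem_dyadic_iff:
  assumes "0 < z" shows "z \<in> dyadic m k \<longleftrightarrow> dyadic_index m z = k"
proof -
  have "0 < z * 2 ^ m" using assms by simp
  then have i: "real (dyadic_index m z) = of_int \<lceil>z * 2 ^ m\<rceil> - 1"
    unfolding dyadic_index_def by (subst of_nat_nat) linarith+
  have "z \<in> dyadic m k \<longleftrightarrow> real k < z * 2 ^ m \<and> z * 2 ^ m \<le> real k + 1"
    by (auto simp: dyadic_def field_simps)
  also have "\<dots> \<longleftrightarrow> \<lceil>z * 2 ^ m\<rceil> = int k + 1"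
    by (auto simp: ceiling_eq_iff)
  also have "\<dots> \<longleftrightarrow> real (dyadic_index m z) = real k"
    unfolding i by linarith
  finally show ?thesis by simp
qed

lemma dyadic_index_less:
  assumes "0 < z" "z \<le> 1" shows "dyadic_index m z < 2 ^ m"
proof -
  have "z \<in> dyadic m (dyadic_index m z)" using assms mem_dyadic_iff by blast
  then have "real (dyadic_index m z) < z * 2 ^ m" by (simp add: dyadic_def field_simps)
  also have "\<dots> \<le> real (2 ^ m)" using assms by simp
  finally show ?thesis by (simp only: of_nat_less_iff)
qed

lemma dyadic_subset: "k < 2 ^ m \<Longrightarrow> dyadic m k \<subseteq> {0<..1}"
proof
  fix z assume k: "k < 2 ^ m" and z: "z \<in> dyadic m k"
  have "0 \<le> real k / 2 ^ m" by simp
  moreover have "real (Suc k) \<le> real (2 ^ m)" using k by (simp only: of_nat_le_iff Suc_le_eq)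
  then have "real (Suc k) / 2 ^ m \<le> 1" by simp
  moreover have "real k / 2 ^ m < z" "z \<le> real (Suc k) / 2 ^ m" using z by (simp_all add: dyadic_def)
  ultimately show "z \<in> {0<..1}" unfolding greaterThanAtMost_iff by linarith
qed

lemma dyadic_dist:
  assumes "y \<in> dyadic m k" "z \<in> dyadic m k" shows "\<bar>y - z\<bar> < 1 / 2 ^ m"
  using assms by (auto simp: dyadic_def field_simps abs_less_iff)

lemma eventually_dyadic_small: "0 < e \<Longrightarrow> \<forall>\<^sub>F m in sequentially. 1 / 2 ^ m < (e :: real)"
proof -
  assume "0 < e"
  have "(\<lambda>m. (1 / 2) ^ m :: real) \<longlonglongrightarrow> 0" by (intro LIMSEQ_realpow_zero) auto
  from order_tendstoD(2)[OF this \<open>0 < e\<close>] show ?thesis by (simp add: power_one_over)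
qed

locale locally_finite_measure =
  fixes \<rho> :: "real measure"
  assumes sets_rho [measurable_cong, simp]: "sets \<rho> = sets borel"
    and finite_unit: "emeasure \<rho> {0..1} < \<infinity>"
begin

definition heavy_increments :: "nat \<Rightarrow> real \<Rightarrow> nat" where
  "heavy_increments m u = card {k. k < 2 ^ m \<and> u < measure \<rho> (dyadic m k)}"

lemma fmeasurable_unit: "A \<in> sets borel \<Longrightarrow> A \<subseteq> {0..1} \<Longrightarrow> A \<in> fmeasurable \<rho>"
proof -
  have "{0..1} \<in> fmeasurable \<rho>" using finite_unit by (intro fmeasurableI) auto
  then show "A \<in> sets borel \<Longrightarrow> A \<subseteq> {0..1} \<Longrightarrow> A \<in> fmeasurable \<rho>" by (rule fmeasurableI2) simp_all
qed

lemma finite_heavy_atoms: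
  assumes "0 < u" shows "finite {z \<in> {0..1}. u \<le> measure \<rho> {z}}"
proof (rule finite_if_finite_subsets_card_bdd[THEN conjunct1])
  fix F assume F: "F \<subseteq> {z \<in> {0..1}. u \<le> measure \<rho> {z}}" "finite F"
  have "real (card F) * u \<le> (\<Sum>z\<in>F. measure \<rho> {z})"
    using F(1) by (intro sum_bounded_below[where K = u, simplified]) auto
  also have "\<dots> = measure \<rho> (\<Union>z\<in>F. {z})"
    using F by (intro measure_finite_Union[symmetric]) (auto simp: disjoint_family_on_def fmeasurable_unit[THEN fmeasurableD2])
  also have "\<dots> \<le> measure \<rho> {0..1}"
    using F by (intro measure_mono_fmeasurable fmeasurable_unit) (auto intro!: finite_imp_closed borel_closed)
  finally have "real (card F) \<le> measure \<rho> {0..1} / u" using assms by (simp add: field_simps)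
  then show "card F \<le> nat \<lceil>measure \<rho> {0..1} / u\<rceil>" by linarith
qed

text \<open>On a fine grid finitely many atoms lie in different intervals.\<close>

lemma atoms_le_heavy_increments:
  assumes u: "0 < u"
  shows "\<forall>\<^sub>F m in sequentially. card {z \<in> {0<..1}. u < measure \<rho> {z}} \<le> heavy_increments m u"
proof -
  let ?F = "{z \<in> {0<..1}. u < measure \<rho> {z}}"
  have fin: "finite ?F" by (rule finite_subset[OF _ finite_heavy_atoms[OF u]]) auto
  have "\<forall>\<^sub>F m in sequentially. \<forall>y\<in>?F. \<forall>z\<in>?F. y \<noteq> z \<longrightarrow> 1 / 2 ^ m < \<bar>y - z\<bar>"
    using fin by (intro eventually_ball_finite ballI) (auto intro: eventually_dyadic_small eventually_mono)
  then show ?thesis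
  proof eventually_elim
    case (elim m)
    have "inj_on (dyadic_index m) ?F"
    proof (rule inj_onI, rule ccontr)
      fix y z assume yz: "y \<in> ?F" "z \<in> ?F" "dyadic_index m y = dyadic_index m z" "y \<noteq> z"
      then have "\<bar>y - z\<bar> < 1 / 2 ^ m"
        using mem_dyadic_iff[of y m "dyadic_index m z"] mem_dyadic_iff[of z m "dyadic_index m z"]
        by (intro dyadic_dist) auto
      with elim yz show False by force
    qed
    moreover have "dyadic_index m ` ?F \<subseteq> {k. k < 2 ^ m \<and> u < measure \<rho> (dyadic m k)}"
    proof clarify
      fix z assume z: "z \<in> {0<..1}" "u < measure \<rho> {z}"
      have "z \<in> dyadic m (dyadic_index m z)" using z mem_dyadic_iff[of z] by auto
      moreover have lt: "dyadic_index m z < 2 ^ m" using z by (intro dyadic_index_less) auto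
      ultimately have "measure \<rho> {z} \<le> measure \<rho> (dyadic m (dyadic_index m z))"
        using dyadic_subset[OF lt] by (intro measure_mono_fmeasurable fmeasurable_unit) auto
      with z lt show "dyadic_index m z < 2 ^ m \<and> u < measure \<rho> (dyadic m (dyadic_index m z))" by simp
    qed
    ultimately show ?case
      unfolding heavy_increments_def by (intro card_inj_on_le[of "dyadic_index m"]) auto
  qed
qed

text \<open>
  Every point has a neighbourhood whose mass in \<open>(0,1]\<close>, apart from atoms of mass at least \<open>u\<close>, is
  below \<open>u\<close>. By compactness every short interval without such an atom has mass below \<open>u\<close>, so on a
  fine grid each heavy interval contains one of these atoms.
\<close>

lemma heavy_increments_le_atoms:
  assumes u: "0 < u"
  shows "\<forall>\<^sub>F m in sequentially. heavy_increments m u \<le> card {z \<in> {0<..1}. u \<le> measure \<rho> {z}}"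
proof -
  let ?Z = "{z \<in> {0<..1}. u \<le> measure \<rho> {z}}"
  have fin: "finite ?Z" by (rule finite_subset[OF _ finite_heavy_atoms[OF u]]) auto
  then have Z: "closed ?Z" "?Z \<in> sets borel" by (auto intro: finite_imp_closed borel_closed)
  have "\<exists>e>0. measure \<rho> (ball z e \<inter> {0<..1} - ?Z) < u" for z
  proof -
    define A where "A n = ball z (inverse (real (Suc n))) \<inter> {0<..1} - ?Z" for n :: nat
    have fm: "A n \<in> fmeasurable \<rho>" for n unfolding A_def using Z by (intro fmeasurable_unit) auto
    have inv: "inverse (real (Suc (Suc n))) \<le> inverse (real (Suc n))" for n
      by (intro le_imp_inverse_le) auto
    then have dec: "decseq A"
      unfolding A_def by (intro decseq_SucI Diff_mono Int_mono subset_ball) auto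
    have "range A \<subseteq> sets \<rho>" using fm by blast
    from Lim_emeasure_decseq[OF this dec fmeasurableD2[OF fm, unfolded infinity_ennreal_def[symmetric]]]
    have lim': "(\<lambda>n. emeasure \<rho> (A n)) \<longlonglongrightarrow> emeasure \<rho> (\<Inter>n. A n)" .
    have "emeasure \<rho> (\<Inter>n. A n) \<le> emeasure \<rho> (A 0)" using fmeasurableD[OF fm[of 0]] by (intro emeasure_mono) auto
    then have "emeasure \<rho> (\<Inter>n. A n) < \<top>" using fmeasurableD2[OF fm[of 0]] by (simp add: le_less_trans less_top)
    with lim' have lim: "(\<lambda>n. measure \<rho> (A n)) \<longlonglongrightarrow> measure \<rho> (\<Inter>n. A n)"
      unfolding measure_def by (intro tendsto_enn2real) (simp_all add: ennreal_enn2real)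
    have "(\<Inter>n. A n) \<subseteq> {z} \<inter> {0<..1} - ?Z"
    proof
      fix y assume y: "y \<in> (\<Inter>n. A n)"
      have "y = z"
      proof (rule ccontr)
        assume "y \<noteq> z"
        then obtain n where "inverse (real (Suc n)) < dist z y" using reals_Archimedean[of "dist z y"] by auto
        moreover have "y \<in> A n" using y by blast
        ultimately show False by (auto simp: A_def)
      qed
      with y show "y \<in> {z} \<inter> {0<..1} - ?Z" by (auto simp: A_def)
    qed
    moreover have "measure \<rho> B < u" if "B \<subseteq> {z} \<inter> {0<..1} - ?Z" for B
    proof (cases "B = {}")
      case False
      with that have "B = {z}" "z \<in> {0<..1}" "z \<notin> ?Z" by auto
      then show ?thesis by auto
    qed (use u in simp)
    ultimately have "measure \<rho> (\<Inter>n. A n) < u" by blast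
    from order_tendstoD(2)[OF lim this] obtain n where "measure \<rho> (A n) < u"
      by (auto simp: eventually_sequentially)
    then show ?thesis unfolding A_def by (intro exI[of _ "inverse (real (Suc n))"]) auto
  qed
  then obtain e where e: "\<And>z. 0 < e z" "\<And>z. measure \<rho> (ball z (e z) \<inter> {0<..1} - ?Z) < u" by metis
  obtain d where d: "0 < d" "\<And>x. x \<in> {0..1} \<Longrightarrow> \<exists>G \<in> (\<lambda>z. ball z (e z)) ` UNIV. ball x d \<subseteq> G"
  proof (rule Heine_Borel_lemma[of "{0..1::real}" "(\<lambda>z. ball z (e z)) ` UNIV"])
    show "{0..1} \<subseteq> (\<Union>z. ball z (e z))" using e(1) centre_in_ball by blast
  qed (use that in auto)
  from eventually_dyadic_small[OF d(1)] show ?thesis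
  proof eventually_elim
    case (elim m)
    have meet: "dyadic m k \<inter> ?Z \<noteq> {}" if k: "k < 2 ^ m" "u < measure \<rho> (dyadic m k)" for k
    proof
      assume disj: "dyadic m k \<inter> ?Z = {}"
      define x where "x = real (Suc k) / 2 ^ m"
      have x: "x \<in> dyadic m k" by (simp add: x_def dyadic_def divide_strict_right_mono)
      with dyadic_subset[OF k(1)] have "x \<in> {0..1}" by auto
      from d(2)[OF this] obtain z where z: "ball x d \<subseteq> ball z (e z)" by auto
      have "dyadic m k \<subseteq> ball x d"
        using dyadic_dist[OF x] elim by (fastforce simp: dist_real_def)
      with z disj dyadic_subset[OF k(1)] have "dyadic m k \<subseteq> ball z (e z) \<inter> {0<..1} - ?Z" by blast
      then have "measure \<rho> (dyadic m k) \<le> measure \<rho> (ball z (e z) \<inter> {0<..1} - ?Z)"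
        using Z by (intro measure_mono_fmeasurable fmeasurable_unit) auto
      with e(2)[of z] k(2) show False by simp
    qed
    have "{k. k < 2 ^ m \<and> u < measure \<rho> (dyadic m k)} \<subseteq> dyadic_index m ` ?Z"
    proof
      fix k assume "k \<in> {k. k < 2 ^ m \<and> u < measure \<rho> (dyadic m k)}"
      then obtain z where "z \<in> dyadic m k" "z \<in> ?Z" using meet[of k] by blast
      then show "k \<in> dyadic_index m ` ?Z" using mem_dyadic_iff[of z m k] by auto
    qed
    then show ?case
      unfolding heavy_increments_def using fin by (meson card_image_le card_mono finite_imageI order_trans)
  qed
qed

end

section \<open>The number of large jumps of the subordinator\<close>

text \<open>
  Chebyshev's inequality for a binomial variable, whose variance is at most its mean.
\<close>

lemma (in prob_space) prob_heavy_count_deviates: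
  fixes X :: "nat \<Rightarrow> 'a \<Rightarrow> real"
  assumes indep: "indep_vars (\<lambda>_. borel) X UNIV"
    and p: "\<And>k. k < n \<Longrightarrow> prob {\<omega>\<in>space M. u < X k \<omega>} = p" and a: "0 < a"
  shows "prob {\<omega>\<in>space M. a \<le> \<bar>real (card {k. k < n \<and> u < X k \<omega>}) - real n * p\<bar>} \<le> real n * p / a\<^sup>2"
proof -
  have X [measurable]: "X k \<in> borel_measurable M" for k
    using indep by (simp add: indep_vars_def)
  define Y where "Y k \<omega> = indicat_real {u<..} (X k \<omega>)" for k \<omega>
  have Y [measurable]: "Y k \<in> borel_measurable M" for k unfolding Y_def[abs_def] by measurable
  have intI: "integrable M f" if "f \<in> borel_measurable M" "\<And>\<omega>. \<bar>f \<omega>\<bar> \<le> B" for f :: "'a \<Rightarrow> real" and B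
    using that by (intro integrable_const_bound[where B = B]) auto
  have intY: "integrable M (Y k)" for k by (rule intI[of _ 1]) (auto simp: Y_def indicator_def)
  have EY: "expectation (Y k) = p" if "k < n" for k
  proof -
    have "expectation (Y k) = expectation (indicator {\<omega>\<in>space M. u < X k \<omega>})"
      by (intro Bochner_Integration.integral_cong) (auto simp: Y_def indicator_def)
    then show ?thesis using p[OF that] by simp
  qed
  have p01: "0 \<le> p" "p \<le> 1" if "k < n" for k using p[OF that] by (auto intro: prob_le_1)
  have cov: "expectation (\<lambda>\<omega>. (Y i \<omega> - p) * (Y j \<omega> - p)) \<le> (if i = j then p else 0)" if ij: "i < n" "j < n" for i j
  proof (cases "i = j")
    case True
    have "expectation (\<lambda>\<omega>. (Y i \<omega> - p) * (Y i \<omega> - p)) = expectation (\<lambda>\<omega>. Y i \<omega> * (1 - 2 * p) + p\<^sup>2)"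
      by (intro Bochner_Integration.integral_cong) (auto simp: Y_def indicator_def power2_eq_square algebra_simps)
    also have "\<dots> = p * (1 - 2 * p) + p\<^sup>2"
      using EY[OF ij(1)] intY[of i] by (subst Bochner_Integration.integral_add) (auto simp: prob_space)
    also have "\<dots> \<le> p" using p01[OF ij(1)] by (simp add: power2_eq_square algebra_simps)
    finally show ?thesis using True by simp
  next
    case False
    have "indep_vars (\<lambda>_. borel) (\<lambda>k \<omega>. indicat_real {u<..} (X k \<omega>) - p) UNIV"
      by (rule indep_vars_compose2[OF indep]) measurable
    then have "indep_vars (\<lambda>_. borel) (\<lambda>k \<omega>. Y k \<omega> - p) {i, j}"
      unfolding Y_def by (rule indep_vars_subset) simp
    then have "expectation (\<lambda>\<omega>. \<Prod>k\<in>{i, j}. Y k \<omega> - p) = (\<Prod>k\<in>{i, j}. expectation (\<lambda>\<omega>. Y k \<omega> - p))"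
      using p01[OF ij(1)] by (intro indep_vars_lebesgue_integral) (auto intro!: intI[of _ 1] simp: Y_def indicator_def)
    also have "\<dots> = 0"
    proof -
      have "expectation (\<lambda>\<omega>. Y i \<omega> - p) = 0"
        using EY[OF ij(1)] intY[of i] by (subst Bochner_Integration.integral_diff) (auto simp: prob_space)
      then show ?thesis using False by simp
    qed
    finally show ?thesis using False by simp
  qed
  define S where "S \<omega> = (\<Sum>k<n. Y k \<omega>)" for \<omega>
  have [measurable]: "S \<in> borel_measurable M" unfolding S_def[abs_def] by measurable
  have S_eq: "S \<omega> = real (card {k. k < n \<and> u < X k \<omega>})" for \<omega>
  proof -
    have "S \<omega> = (\<Sum>k\<in>{k. k < n \<and> u < X k \<omega>}. 1)"
      unfolding S_def Y_def by (intro sum.mono_neutral_cong_right) (auto simp: indicator_def)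
    then show ?thesis by simp
  qed
  have S_bound: "\<bar>S \<omega>\<bar> \<le> real n" for \<omega>
    using card_mono[of "{..<n}" "{k. k < n \<and> u < X k \<omega>}"] by (auto simp: S_eq)
  have ES: "expectation S = real n * p"
    unfolding S_def using EY intY by (subst Bochner_Integration.integral_sum) auto
  have "variance S = expectation (\<lambda>\<omega>. \<Sum>i<n. \<Sum>j<n. (Y i \<omega> - p) * (Y j \<omega> - p))"
  proof (intro Bochner_Integration.integral_cong refl)
    fix \<omega>
    have "S \<omega> - expectation S = (\<Sum>i<n. Y i \<omega> - p)" by (simp add: ES S_def sum_subtractf)
    then show "(S \<omega> - expectation S)\<^sup>2 = (\<Sum>i<n. \<Sum>j<n. (Y i \<omega> - p) * (Y j \<omega> - p))"
      by (simp add: power2_eq_square sum_product)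
  qed
  also have "\<dots> = (\<Sum>i<n. \<Sum>j<n. expectation (\<lambda>\<omega>. (Y i \<omega> - p) * (Y j \<omega> - p)))"
  proof -
    have int: "integrable M (\<lambda>\<omega>. (Y i \<omega> - p) * (Y j \<omega> - p))" for i j
    proof (rule intI[of _ "(1 + \<bar>p\<bar>) * (1 + \<bar>p\<bar>)"])
      have "\<bar>Y k \<omega> - p\<bar> \<le> 1 + \<bar>p\<bar>" for k \<omega> by (auto simp: Y_def indicator_def)
      then show "\<bar>(Y i \<omega> - p) * (Y j \<omega> - p)\<bar> \<le> (1 + \<bar>p\<bar>) * (1 + \<bar>p\<bar>)" for \<omega>
        unfolding abs_mult by (intro mult_mono) auto
    qed measurable
    show ?thesis
      by (subst Bochner_Integration.integral_sum, intro Bochner_Integration.integrable_sum int)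
         (intro sum.cong refl Bochner_Integration.integral_sum int)
  qed
  also have "\<dots> \<le> (\<Sum>i<n. \<Sum>j<n. if i = j then p else 0)"
    using cov by (intro sum_mono) auto
  also have "\<dots> = real n * p" by simp
  finally have var: "variance S \<le> real n * p" .
  have "prob {\<omega>\<in>space M. a \<le> \<bar>S \<omega> - expectation S\<bar>} \<le> variance S / a\<^sup>2"
  proof (rule Chebyshev_inequality)
    show "integrable M (\<lambda>\<omega>. (S \<omega>)\<^sup>2)"
      using S_bound by (intro intI[of _ "(real n)\<^sup>2"]) (auto simp: abs_le_square_iff[symmetric])
  qed (use a in auto)
  also have "\<dots> \<le> real n * p / a\<^sup>2" using var a by (intro divide_right_mono) auto
  finally show ?thesis by (simp add: ES S_eq)
qed

locale stable_environment = prob_space M for M :: "'a measure" +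
  fixes \<alpha> :: real and V :: "real \<Rightarrow> 'a \<Rightarrow> real"
  assumes alpha: "0 < \<alpha>" "\<alpha> < 1" and stable: "stable_subordinator M \<alpha> V"
begin

definition increment :: "nat \<Rightarrow> nat \<Rightarrow> 'a \<Rightarrow> real" where
  "increment m k \<omega> = V (real (Suc k) / 2 ^ m) \<omega> - V (real k / 2 ^ m) \<omega>"

definition increment_count :: "nat \<Rightarrow> real \<Rightarrow> 'a \<Rightarrow> nat" where
  "increment_count m u \<omega> = card {k. k < 2 ^ m \<and> u < increment m k \<omega>}"

lemma measurable_V [measurable]: "V x \<in> borel_measurable M"
  using stable by (simp add: stable_subordinator_def)

lemma measurable_increment [measurable]: "increment m k \<in> borel_measurable M"
  unfolding increment_def[abs_def] by measurable

lemma increments_indep: "indep_vars (\<lambda>_. borel) (increment m) UNIV"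
proof -
  have "mono (\<lambda>k. real k / 2 ^ m)" by (auto simp: mono_def divide_right_mono)
  then show ?thesis
    using stable unfolding stable_subordinator_def increment_def[abs_def] by blast
qed

lemma char_increment: "char (distr M borel (increment m k)) r = exp (of_real (\<alpha> * (1 / 2 ^ m)) * stable_exponent \<alpha> r)"
proof -
  have "char (distr M borel (\<lambda>\<omega>. V (1 / 2 ^ m + real k / 2 ^ m) \<omega> - V (real k / 2 ^ m) \<omega>)) r
      = exp (complex_of_real (\<alpha> * (1 / 2 ^ m)) * (LINT w:{0<..}|lborel. (iexp (r * w) - 1) * complex_of_real (w powr (- 1 - \<alpha>))))"
    using stable unfolding stable_subordinator_def by simp
  moreover have "(LINT w:{0<..}|lborel. (iexp (r * w) - 1) * complex_of_real (w powr (- 1 - \<alpha>))) = stable_exponent \<alpha> r"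
    unfolding stable_exponent_def set_lebesgue_integral_def
    by (intro Bochner_Integration.integral_cong) (auto simp: stable_density_def indicator_def)
  moreover have "1 / 2 ^ m + real k / 2 ^ m = real (Suc k) / 2 ^ m" by (simp add: add_divide_distrib)
  ultimately show ?thesis by (simp add: increment_def[abs_def])
qed

definition heavy_prob :: "nat \<Rightarrow> real \<Rightarrow> real" where
  "heavy_prob m u = prob {\<omega>\<in>space M. u < increment m 0 \<omega>}"

lemma heavy_prob_eq: "prob {\<omega>\<in>space M. u < increment m k \<omega>} = heavy_prob m u"
proof -
  have "distr M borel (increment m k) = distr M borel (increment m 0)"
    by (intro Levy_uniqueness real_distribution_distr) (auto simp: fun_eq_iff char_increment)
  then have "measure (distr M borel (increment m k)) {u<..} = measure (distr M borel (increment m 0)) {u<..}" by simp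
  then show ?thesis by (simp add: heavy_prob_def measure_distr vimage_def Int_def conj_commute)
qed

lemma heavy_prob_limit: "0 < u \<Longrightarrow> (\<lambda>m. 2 ^ m * heavy_prob m u) \<longlonglongrightarrow> u powr (- \<alpha>)"
proof -
  assume u: "0 < u"
  have "(\<lambda>m. measure (distr M borel (increment m 0)) {u<..} / (1 / 2 ^ m)) \<longlonglongrightarrow> u powr (- \<alpha>)"
  proof (rule stable_small_time_tail[OF alpha])
    have "(\<lambda>m. (1 / 2) ^ m :: real) \<longlonglongrightarrow> 0" by (intro LIMSEQ_realpow_zero) auto
    then show "(\<lambda>m. 1 / 2 ^ m :: real) \<longlonglongrightarrow> 0" by (simp add: power_one_over)
  qed (auto simp: u char_increment)
  moreover have "measure (distr M borel (increment m 0)) {u<..} = heavy_prob m u" for m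
    by (simp add: heavy_prob_def measure_distr vimage_def Int_def conj_commute)
  ultimately show ?thesis by (simp add: mult.commute)
qed

lemma measurable_increment_count [measurable]: "increment_count m u \<in> measurable M (count_space UNIV)"
proof -
  have "increment_count m u = (\<lambda>\<omega>. \<Sum>k<2 ^ m. if u < increment m k \<omega> then 1 else 0)"
  proof
    fix \<omega>
    have "(\<Sum>k<2 ^ m. if u < increment m k \<omega> then 1 else 0) = (\<Sum>k\<in>{k. k < 2 ^ m \<and> u < increment m k \<omega>}. 1 :: nat)"
      by (intro sum.mono_neutral_cong_right) auto
    then show "increment_count m u \<omega> = (\<Sum>k<2 ^ m. if u < increment m k \<omega> then 1 else 0)"
      by (simp add: increment_count_def)
  qed
  then show ?thesis by simp
qed

text \<open>
  Deviation at all fine levels, so that Fatou's argument bounds the probability by that at a single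
  level. Off this event some arbitrarily fine levels have nearly the right count, which suffices since
  every fine level compares with the number of atoms.
\<close>

definition deviation :: "real \<Rightarrow> real \<Rightarrow> 'a set" where
  "deviation e u = {\<omega>\<in>space M. \<forall>\<^sub>F m in sequentially. e * u powr (- \<alpha>) < \<bar>real (increment_count m u \<omega>) - u powr (- \<alpha>)\<bar>}"

lemma deviation_sets [measurable]: "deviation e u \<in> sets M"
  unfolding deviation_def eventually_sequentially by measurable

text \<open>
  The mean number of increments above \<open>u\<close> tends to \<open>u powr (-\<alpha>)\<close>, and its variance is of the same order.
\<close>

lemma prob_deviation:
  assumes e: "0 < e" and u: "0 < u"
  shows "prob (deviation e u) \<le> 8 / (e\<^sup>2 * u powr (- \<alpha>))"
proof -
  define l where "l = u powr (- \<alpha>)"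
  have l: "0 < l" using u by (simp add: l_def)
  define B where "B m = {\<omega>\<in>space M. e * l < \<bar>real (increment_count m u \<omega>) - l\<bar>}" for m
  have B [measurable]: "B m \<in> sets M" for m unfolding B_def by measurable
  have lim: "(\<lambda>m. 2 ^ m * heavy_prob m u) \<longlonglongrightarrow> l" unfolding l_def by (rule heavy_prob_limit[OF u])
  have "\<forall>\<^sub>F m in sequentially. prob (B m) \<le> 8 / (e\<^sup>2 * l)"
  proof -
    have "\<forall>\<^sub>F m in sequentially. \<bar>2 ^ m * heavy_prob m u - l\<bar> < e * l / 2"
      using tendstoD[OF lim, of "e * l / 2"] e l by (simp add: dist_real_def)
    moreover have "\<forall>\<^sub>F m in sequentially. 2 ^ m * heavy_prob m u < 2 * l"
      using l by (intro order_tendstoD(2)[OF lim]) simp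
    ultimately show ?thesis
    proof eventually_elim
      case (elim m)
      have "prob (B m) \<le> prob {\<omega>\<in>space M. e * l / 2 \<le> \<bar>real (increment_count m u \<omega>) - real (2 ^ m) * heavy_prob m u\<bar>}"
      proof (rule finite_measure_mono)
        have "e * l / 2 \<le> \<bar>x - real (2 ^ m) * heavy_prob m u\<bar>" if "e * l < \<bar>x - l\<bar>" for x
          using that elim(1) by (simp add: abs_if split: if_splits)
        then show "B m \<subseteq> {\<omega>\<in>space M. e * l / 2 \<le> \<bar>real (increment_count m u \<omega>) - real (2 ^ m) * heavy_prob m u\<bar>}"
          unfolding B_def by blast
      qed measurable
      also have "\<dots> \<le> real (2 ^ m) * heavy_prob m u / (e * l / 2)\<^sup>2"
        unfolding increment_count_def using e l
        by (intro prob_heavy_count_deviates[OF increments_indep heavy_prob_eq]) auto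
      also have "\<dots> \<le> (2 * l) / (e * l / 2)\<^sup>2"
        using elim(2) by (intro divide_right_mono) auto
      also have "\<dots> = 8 / (e\<^sup>2 * l)" using e l by (simp add: power2_eq_square field_simps)
      finally show ?case .
    qed
  qed
  then obtain n0 where n0: "\<And>m. n0 \<le> m \<Longrightarrow> prob (B m) \<le> 8 / (e\<^sup>2 * l)" by (auto simp: eventually_sequentially)
  define D where "D n = {\<omega>\<in>space M. \<forall>m\<ge>n. \<omega> \<in> B m}" for n
  have D [measurable]: "D n \<in> sets M" for n unfolding D_def by measurable
  have "(\<lambda>n. prob (D n)) \<longlonglongrightarrow> prob (\<Union>n. D n)"
    by (intro finite_Lim_measure_incseq) (auto simp: incseq_def D_def)
  moreover have "prob (D n) \<le> 8 / (e\<^sup>2 * l)" for n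
  proof -
    have "prob (D n) \<le> prob (B (max n n0))" by (intro finite_measure_mono) (auto simp: D_def)
    also have "\<dots> \<le> 8 / (e\<^sup>2 * l)" by (rule n0) simp
    finally show ?thesis .
  qed
  moreover have "(\<Union>n. D n) = deviation e u"
    by (auto simp: D_def B_def deviation_def eventually_sequentially l_def)
  ultimately show ?thesis unfolding l_def by (intro LIMSEQ_le_const2) auto
qed

text \<open>
  With \<open>(k + 1)^2\<close> expected jumps above the \<open>k\<close>-th threshold, the deviation probabilities are summable
  in \<open>k\<close>, and the ratio of consecutive means tends to 1.
\<close>

definition threshold :: "nat \<Rightarrow> real" where
  "threshold k = (real (Suc k) ^ 2) powr (- 1 / \<alpha>)"

lemma threshold: "0 < threshold k" "threshold k powr (- \<alpha>) = (real (Suc k))\<^sup>2"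
  using alpha by (auto simp: threshold_def powr_powr)

lemma AE_increment_count_close:
  assumes e: "0 < e"
  shows "AE \<omega> in M. \<forall>\<^sub>F k in sequentially. \<exists>\<^sub>F m in sequentially.
    \<bar>real (increment_count m (threshold k) \<omega>) - (real (Suc k))\<^sup>2\<bar> \<le> e * (real (Suc k))\<^sup>2"
proof -
  have "AE \<omega> in M. \<forall>\<^sub>F k in sequentially. \<omega> \<in> space M - deviation e (threshold k)"
  proof (rule borel_cantelli_AE1)
    have "summable (\<lambda>k. 8 / e\<^sup>2 * (1 / (real (Suc k))\<^sup>2))"
      using inverse_squares_sums by (intro summable_mult) (simp add: sums_iff)
    then show "summable (\<lambda>k. prob (deviation e (threshold k)))"
    proof (rule summable_comparison_test'[where N = 0])
      show "norm (prob (deviation e (threshold k))) \<le> 8 / e\<^sup>2 * (1 / (real (Suc k))\<^sup>2)" for k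
        using prob_deviation[OF e threshold(1), of k] by (simp add: threshold)
    qed
  qed (auto simp: less_top[symmetric])
  then show ?thesis
    by eventually_elim
       (auto simp: deviation_def threshold frequently_def not_le elim!: eventually_mono)
qed

end

section \<open>The weights of the environment vary regularly\<close>

text \<open>
  Pick a heaviest element that is left, again and again. An element that is never picked would be
  preceded by infinitely many elements of at least its weight.
\<close>

lemma exists_decreasing_listing:
  fixes w :: "'z \<Rightarrow> real"
  assumes inf: "infinite S" and pos: "\<And>z. z \<in> S \<Longrightarrow> 0 < w z"
    and fin: "\<And>u. 0 < u \<Longrightarrow> finite {z \<in> S. u \<le> w z}"
  shows "\<exists>a. bij_betw a {1::nat..} S \<and> antimono_on {1..} (\<lambda>i. w (a i))"
proof -
  have step: "\<exists>z. z \<in> S - F \<and> (\<forall>y\<in>S - F. w y \<le> w z)" if "finite F" for F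
  proof -
    have "infinite (S - F)" using inf that by simp
    then obtain y where y: "y \<in> S - F" using infinite_imp_nonempty by blast
    let ?H = "{z \<in> S - F. w y \<le> w z}"
    have H: "finite ?H" "y \<in> ?H"
      using y pos[of y] by (auto intro: finite_subset[OF _ fin[of "w y"]])
    then have "Max (w ` ?H) \<in> w ` ?H" by (intro Max_in) auto
    then obtain z where z: "z \<in> ?H" "w z = Max (w ` ?H)" by auto
    have "w x \<le> w z" if x: "x \<in> S - F" for x
    proof (cases "w y \<le> w x")
      case True with x H show ?thesis unfolding z(2) by (intro Max_ge) auto
    next
      case False with z(1) show ?thesis by auto
    qed
    with z(1) show ?thesis by blast
  qed
  have "\<exists>b. \<forall>n::nat. b n \<in> S - b ` {..<n} \<and> (\<forall>y\<in>S - b ` {..<n}. w y \<le> w (b n))"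
  proof -
    define R where "R f n z \<longleftrightarrow> z \<in> S - f ` {..<n} \<and> (\<forall>y\<in>S - f ` {..<n}. w y \<le> w z)" for f :: "nat \<Rightarrow> 'z" and n z
    have "\<exists>b. \<forall>n. R b n (b n)"
    proof (rule dependent_wellorder_choice)
      show "R f n z = R f' n z" if "\<And>m. m < n \<Longrightarrow> f m = f' m" for f f' n z
      proof -
        have "f ` {..<n} = f' ` {..<n}" using that by (intro image_cong) auto
        then show ?thesis by (simp add: R_def)
      qed
      show "\<exists>z. R f n z" for f n using step[of "f ` {..<n}"] by (auto simp: R_def)
    qed
    then show ?thesis by (simp add: R_def)
  qed
  then obtain b :: "nat \<Rightarrow> 'z" where choice: "\<forall>n. b n \<in> S - b ` {..<n} \<and> (\<forall>y\<in>S - b ` {..<n}. w y \<le> w (b n))" ..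
  have b: "b n \<in> S - b ` {..<n}" "y \<in> S - b ` {..<n} \<Longrightarrow> w y \<le> w (b n)" for n y
    using spec[OF choice, of n] by simp_all
  have anti: "w (b n) \<le> w (b m)" if "m \<le> n" for m n
    using b(1)[of n] that by (intro b(2)) auto
  have inj: "inj b"
  proof (rule linorder_injI)
    fix m n :: nat assume "m < n"
    then show "b m \<noteq> b n" using b(1)[of n] by (metis DiffE imageI lessThan_iff)
  qed
  have surj: "range b = S"
  proof (intro equalityI subsetI)
    fix z assume z: "z \<in> S"
    show "z \<in> range b"
    proof (rule ccontr)
      assume "z \<notin> range b"
      with z have "w z \<le> w (b n)" for n by (intro b(2)) auto
      then have "range b \<subseteq> {y \<in> S. w z \<le> w y}" using b(1) by auto
      then have "finite (range b)" using fin[OF pos[OF z]] by (rule finite_subset)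
      with inj show False by (simp add: finite_image_iff)
    qed
  qed (use b(1) in auto)
  have "bij_betw (\<lambda>i. i - 1) {1::nat..} UNIV"
    by (rule bij_betw_byWitness[where f' = Suc]) auto
  then have "bij_betw (b \<circ> (\<lambda>i. i - 1)) {1::nat..} S"
    by (rule bij_betw_trans) (use inj surj in \<open>simp add: bij_betw_def\<close>)
  moreover have "antimono_on {1..} (\<lambda>i. w ((b \<circ> (\<lambda>i. i - 1)) i))"
    by (auto intro!: monotone_onI anti)
  ultimately show ?thesis by blast
qed

text \<open>
  Any \<open>u\<close> lies between two consecutive thresholds, where the count is bounded by monotonicity. In terms
  of \<open>x = u powr (-\<alpha>/2)\<close> the bounds are close to \<open>(x - 1)^2\<close> and \<open>(x + 1)^2\<close>.
\<close>

lemma count_limit_from_squares: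
  fixes A B :: "real \<Rightarrow> nat" and thr :: "nat \<Rightarrow> real"
  assumes \<alpha>: "0 < \<alpha>" and thr: "\<And>k. thr k = (real (Suc k) ^ 2) powr (- 1 / \<alpha>)"
    and mono: "\<And>u v. 0 < u \<Longrightarrow> u \<le> v \<Longrightarrow> A v \<le> A u" "\<And>u v. 0 < u \<Longrightarrow> u < v \<Longrightarrow> B v \<le> A u"
    and upper: "\<And>e. 0 < e \<Longrightarrow> \<forall>\<^sub>F k in sequentially. real (A (thr k)) \<le> (1 + e) * (real (Suc k))\<^sup>2"
    and lower: "\<And>e. 0 < e \<Longrightarrow> \<forall>\<^sub>F k in sequentially. (1 - e) * (real (Suc k))\<^sup>2 \<le> real (B (thr k))"
  shows "((\<lambda>u. u powr \<alpha> * real (A u)) \<longlongrightarrow> 1) (at_right 0)"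
proof (rule tendstoI)
  fix d :: real assume d: "0 < d"
  define e where "e = min (1 / 2) (d / 4)"
  have e: "0 < e" "e < 1" "3 * e < d" using d by (auto simp: e_def)
  obtain k0 where k0: "\<And>k. k0 \<le> k \<Longrightarrow> real (A (thr k)) \<le> (1 + e) * (real (Suc k))\<^sup>2"
    "\<And>k. k0 \<le> k \<Longrightarrow> (1 - e) * (real (Suc k))\<^sup>2 \<le> real (B (thr k))"
    using eventually_conj[OF upper[OF e(1)] lower[OF e(1)]] by (auto simp: eventually_sequentially)
  define x where "x u = u powr (- \<alpha> / 2)" for u :: real
  have x_lim: "filterlim x at_top (at_right 0)"
    unfolding x_def using \<alpha> by real_asymp
  have inv: "((\<lambda>u. 1 / x u) \<longlongrightarrow> 0) (at_right 0)"
    by (intro tendsto_divide_0[OF tendsto_const] filterlim_at_top_imp_at_infinity x_lim)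
  have "((\<lambda>u. (1 + 1 / x u)\<^sup>2) \<longlongrightarrow> (1 + 0)\<^sup>2) (at_right 0)" by (intro tendsto_intros inv)
  then have ev1: "\<forall>\<^sub>F u in at_right 0. (1 + 1 / x u)\<^sup>2 < 1 + e" using e by (intro order_tendstoD(2)[where y = "(1 + 0)\<^sup>2"]) auto
  have "((\<lambda>u. (1 - 1 / x u)\<^sup>2) \<longlongrightarrow> (1 - 0)\<^sup>2) (at_right 0)" by (intro tendsto_intros inv)
  then have ev2: "\<forall>\<^sub>F u in at_right 0. 1 - e < (1 - 1 / x u)\<^sup>2" using e by (intro order_tendstoD(1)[where y = "(1 - 0)\<^sup>2"]) auto
  have ev3: "\<forall>\<^sub>F u in at_right 0. real k0 + 2 < x u" using x_lim by (simp add: filterlim_at_top_dense)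
  have ev4: "\<forall>\<^sub>F u in at_right 0. (0::real) < u" by (simp add: eventually_at_right_less)
  show "\<forall>\<^sub>F u in at_right 0. dist (u powr \<alpha> * real (A u)) 1 < d"
    using ev1 ev2 ev3 ev4
  proof eventually_elim
    case (elim u)
    \<comment> \<open>The index with \<open>threshold (k + 1) \<le> u < threshold k\<close>.\<close>
    define k where "k = nat (\<lceil>x u\<rceil> - 2)"
    have "real k = of_int \<lceil>x u\<rceil> - 2" unfolding k_def using elim(3) by (subst of_nat_nat) linarith+
    then have k: "real k + 1 < x u" "x u \<le> real k + 2" by linarith+
    have kk0: "k0 \<le> k" using k elim(3) by linarith
    have x0: "0 < x u" using elim(3) by linarith
    have u_eq: "u = ((x u)\<^sup>2) powr (- 1 / \<alpha>)"
    proof -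
      have "(x u)\<^sup>2 = u powr (- \<alpha>)" using elim(4) by (simp add: x_def power2_eq_square powr_add[symmetric])
      then show ?thesis using \<alpha> elim(4) by (simp add: powr_powr)
    qed
    have u_pow: "u powr \<alpha> = 1 / (x u)\<^sup>2"
      using elim(4) by (simp add: x_def power2_eq_square powr_add[symmetric] powr_minus_divide)
    have thr_pos: "0 < thr j" for j by (simp add: thr)
    have "thr (Suc k) \<le> ((x u)\<^sup>2) powr (- 1 / \<alpha>)"
      unfolding thr by (rule powr_mono2') (use k x0 \<alpha> in \<open>auto intro!: power_mono\<close>)
    then have "thr (Suc k) \<le> u" using u_eq by linarith
    then have "real (A u) \<le> real (A (thr (Suc k)))" using mono(1) thr_pos by simp
    also have "\<dots> \<le> (1 + e) * (real (Suc (Suc k)))\<^sup>2" using kk0 by (intro k0) simp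
    also have "\<dots> \<le> (1 + e) * (x u + 1)\<^sup>2" using k e by (intro mult_left_mono power_mono) auto
    finally have up: "real (A u) \<le> (1 + e) * (x u + 1)\<^sup>2" .
    have "((x u)\<^sup>2) powr (- 1 / \<alpha>) < thr k"
      unfolding thr by (rule powr_less_mono2_neg) (use k x0 \<alpha> in \<open>auto intro!: power_strict_mono\<close>)
    then have "u < thr k" using u_eq by linarith
    then have lo': "real (B (thr k)) \<le> real (A u)" using mono(2) elim(4) by simp
    have "(1 - e) * (x u - 1)\<^sup>2 \<le> (1 - e) * (real (Suc k))\<^sup>2" using k e elim(3) by (intro mult_left_mono power_mono) auto
    also have "\<dots> \<le> real (B (thr k))" using kk0 by (intro k0)
    finally have lo: "(1 - e) * (x u - 1)\<^sup>2 \<le> real (A u)" using lo' by linarith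
    have "u powr \<alpha> * real (A u) \<le> (1 / (x u)\<^sup>2) * ((1 + e) * (x u + 1)\<^sup>2)"
      unfolding u_pow using up by (intro mult_left_mono) auto
    also have "\<dots> = (1 + e) * (1 + 1 / x u)\<^sup>2" using x0 by (simp add: power2_eq_square field_simps)
    also have "\<dots> \<le> (1 + e) * (1 + e)" using elim(1) e by (intro mult_left_mono) auto
    also have "\<dots> \<le> 1 + 3 * e" using e mult_left_mono[of e 1 e] by (simp add: algebra_simps)
    finally have 1: "u powr \<alpha> * real (A u) \<le> 1 + 3 * e" .
    have "1 - 3 * e \<le> (1 - e) * (1 - e)" using e by (simp add: algebra_simps)
    also have "\<dots> \<le> (1 - e) * (1 - 1 / x u)\<^sup>2" using elim(2) e by (intro mult_left_mono) auto
    also have "\<dots> = (1 / (x u)\<^sup>2) * ((1 - e) * (x u - 1)\<^sup>2)" using x0 by (simp add: power2_eq_square field_simps)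
    also have "\<dots> \<le> u powr \<alpha> * real (A u)"
      unfolding u_pow using lo by (intro mult_left_mono) auto
    finally have "1 - 3 * e \<le> u powr \<alpha> * real (A u)" .
    with 1 e(3) show ?case by (simp add: dist_real_def abs_less_iff)
  qed
qed

context locally_finite_measure begin

text \<open>An atom at 0 changes the count by at most 1.\<close>

lemma count_limit_unit_interval:
  assumes lim: "((\<lambda>u. u powr \<alpha> * real (card {z \<in> {0<..1}. u < measure \<rho> {z}})) \<longlongrightarrow> 1) (at_right 0)" and \<alpha>: "0 < \<alpha>"
  shows "((\<lambda>u. u powr \<alpha> * real (card {z \<in> {0..1}. u < measure \<rho> {z}})) \<longlongrightarrow> 1) (at_right 0)"
proof -
  let ?A = "\<lambda>u. card {z \<in> {0<..1}. u < measure \<rho> {z}}" and ?A' = "\<lambda>u. card {z \<in> {0..1}. u < measure \<rho> {z}}"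
  have bounds: "?A u \<le> ?A' u" "?A' u \<le> ?A u + 1" if "0 < u" for u
  proof -
    have fin: "finite {z \<in> {0..1}. u < measure \<rho> {z}}"
      by (rule finite_subset[OF _ finite_heavy_atoms[OF that]]) auto
    then show "?A u \<le> ?A' u" by (intro card_mono) auto
    have fin': "finite {z \<in> {0<..1}. u < measure \<rho> {z}}" by (rule finite_subset[OF _ fin]) auto
    have "?A' u \<le> card (insert 0 {z \<in> {0<..1}. u < measure \<rho> {z}})"
      using fin' by (intro card_mono) auto
    also have "\<dots> \<le> ?A u + 1" using fin' by (simp add: card_insert_if)
    finally show "?A' u \<le> ?A u + 1" .
  qed
  have pow: "((\<lambda>u. u powr \<alpha>) \<longlongrightarrow> 0) (at_right (0::real))" using \<alpha> by real_asymp
  have "((\<lambda>u. u powr \<alpha> * real (?A u) + u powr \<alpha>) \<longlongrightarrow> 1 + 0) (at_right 0)"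
    by (intro tendsto_add lim pow)
  then have up: "((\<lambda>u. u powr \<alpha> * real (?A u) + u powr \<alpha>) \<longlongrightarrow> 1) (at_right 0)" by simp
  have ev: "\<forall>\<^sub>F u in at_right 0. (0::real) < u" by (simp add: eventually_at_right_less)
  show ?thesis
  proof (rule tendsto_sandwich[OF _ _ lim up])
    show "\<forall>\<^sub>F u in at_right 0. u powr \<alpha> * real (?A u) \<le> u powr \<alpha> * real (?A' u)"
      using ev by eventually_elim (use bounds(1) in \<open>simp add: mult_left_mono\<close>)
    show "\<forall>\<^sub>F u in at_right 0. u powr \<alpha> * real (?A' u) \<le> u powr \<alpha> * real (?A u) + u powr \<alpha>"
      using ev
    proof eventually_elim
      case (elim u)
      have "u powr \<alpha> * real (?A' u) \<le> u powr \<alpha> * (real (?A u) + 1)"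
        using bounds(2)[OF elim] by (intro mult_left_mono) auto
      then show ?case by (simp add: algebra_simps)
    qed
  qed
qed

lemma exists_decreasing_atom_weights:
  assumes lim: "((\<lambda>u. u powr \<alpha> * real (card {z \<in> {0..1}. u < measure \<rho> {z}})) \<longlongrightarrow> 1) (at_right 0)" and \<alpha>: "0 < \<alpha>"
  shows "\<exists>g. decreasing_atom_weights \<rho> g"
proof -
  let ?S = "{z \<in> {0..1}. 0 < measure \<rho> {z}}"
  have inf: "infinite ?S"
  proof
    assume fin: "finite ?S"
    have pow: "((\<lambda>u. u powr \<alpha>) \<longlongrightarrow> 0) (at_right (0::real))" using \<alpha> by real_asymp
    then have z: "((\<lambda>u. u powr \<alpha> * real (card ?S)) \<longlongrightarrow> 0 * real (card ?S)) (at_right 0)"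
      by (intro tendsto_mult tendsto_const)
    have ev: "\<forall>\<^sub>F u in at_right 0. (0::real) < u" by (simp add: eventually_at_right_less)
    then have "\<forall>\<^sub>F u in at_right 0. u powr \<alpha> * real (card {z \<in> {0..1}. u < measure \<rho> {z}}) \<le> u powr \<alpha> * real (card ?S)"
      by eventually_elim (use fin in \<open>auto intro!: mult_left_mono card_mono\<close>)
    from tendsto_le[OF _ z lim this] show False by simp
  qed
  have fin: "finite {z \<in> ?S. u \<le> measure \<rho> {z}}" if "0 < u" for u
    by (rule finite_subset[OF _ finite_heavy_atoms[OF that]]) auto
  have "\<exists>a. bij_betw a {1::nat..} ?S \<and> antimono_on {1..} (\<lambda>i. measure \<rho> {a i})"
    by (rule exists_decreasing_listing) (fact inf, simp, fact fin)
  then obtain a where "bij_betw a {1::nat..} ?S" "antimono_on {1..} (\<lambda>i. measure \<rho> {a i})"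
    by blast
  then show ?thesis
    unfolding decreasing_atom_weights_def by (intro exI[of _ "\<lambda>i. measure \<rho> {a i}"]) auto
qed

lemma regular_weights_decreasing_atom_weights:
  assumes lim: "((\<lambda>u. u powr \<alpha> * real (card {z \<in> {0..1}. u < measure \<rho> {z}})) \<longlongrightarrow> 1) (at_right 0)"
    and \<alpha>: "0 < \<alpha>" "\<alpha> < 1" and g: "decreasing_atom_weights \<rho> g"
  shows "regular_weights g \<alpha>"
proof -
  obtain a where a: "bij_betw a {1..} {z \<in> {0..1}. 0 < measure \<rho> {z}}" "\<And>i. 1 \<le> i \<Longrightarrow> g i = measure \<rho> {a i}"
    using g by (auto simp: decreasing_atom_weights_def)
  have a_mem: "a i \<in> {0..1}" "0 < measure \<rho> {a i}" if "1 \<le> i" for i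
    using bij_betwE[OF a(1)] that by auto
  have inj: "inj_on a {1..}" using a(1) by (rule bij_betw_imp_inj_on)
  have bij: "bij_betw a {i. 1 \<le> i \<and> u < g i} {z \<in> {0..1}. u < measure \<rho> {z}}" if "0 < u" for u
  proof (rule bij_betw_imageI)
    show "inj_on a {i. 1 \<le> i \<and> u < g i}" by (rule inj_on_subset[OF inj]) auto
    show "a ` {i. 1 \<le> i \<and> u < g i} = {z \<in> {0..1}. u < measure \<rho> {z}}"
    proof (intro equalityI subsetI)
      fix z assume z: "z \<in> {z \<in> {0..1}. u < measure \<rho> {z}}"
      then have "z \<in> a ` {1..}" using that bij_betw_imp_surj_on[OF a(1)] by auto
      with z a(2) show "z \<in> a ` {i. 1 \<le> i \<and> u < g i}" by auto
    qed (use a_mem(1) a(2) in auto)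
  qed
  show ?thesis
  proof
    show "0 < g i" if "1 \<le> i" for i using a_mem(2) a(2) that by simp
    show "summable (\<lambda>i. g (Suc i))"
    proof (rule summableI_nonneg_bounded)
      show "0 \<le> g (Suc i)" for i using a(2)[of "Suc i"] by simp
      show "(\<Sum>i<n. g (Suc i)) \<le> measure \<rho> {0..1}" for n
      proof -
        have fm: "{a (Suc i)} \<in> fmeasurable \<rho>" for i
          using a_mem(1)[of "Suc i"] by (intro fmeasurable_unit) auto
        have "(\<Sum>i<n. g (Suc i)) = (\<Sum>i<n. measure \<rho> {a (Suc i)})" using a(2) by simp
        also have "\<dots> = measure \<rho> (\<Union>i<n. {a (Suc i)})"
          using inj by (intro measure_finite_Union[symmetric])
            (auto simp: disjoint_family_on_def inj_on_def fmeasurableD2[OF fm])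
        also have "\<dots> \<le> measure \<rho> {0..1}"
          using a_mem(1) by (intro measure_mono_fmeasurable fmeasurable_unit) auto
        finally show ?thesis .
      qed
    qed
    show "finite {i. 1 \<le> i \<and> u < g i}" if "0 < u" for u
      using bij_betw_finite[OF bij[OF that]] finite_subset[OF _ finite_heavy_atoms[OF that]] by (auto simp: subset_eq)
    have ev: "\<forall>\<^sub>F u in at_right 0. (0::real) < u" by (simp add: eventually_at_right_less)
    then have "\<forall>\<^sub>F u in at_right 0. u powr \<alpha> * real (card {z \<in> {0..1}. u < measure \<rho> {z}}) = u powr \<alpha> * real (card {i. 1 \<le> i \<and> u < g i})"
      by eventually_elim (use bij_betw_same_card[OF bij] in simp)
    with lim show "((\<lambda>u. u powr \<alpha> * card {i. 1 \<le> i \<and> u < g i}) \<longlongrightarrow> 1) (at_right 0)"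
      by (rule Lim_transform_eventually)
  qed (use \<alpha> in auto)
qed

end

context stable_environment begin

text \<open>
  On an increasing right-continuous path, counts of large dyadic increments and of large jumps
  agree up to replacing strict by weak inequality. The law of large numbers along the thresholds is
  applied with every tolerance \<open>1 / (j + 1)\<close>.
\<close>

lemma AE_atom_count_limit:
  "AE \<omega> in M. locally_finite_measure (env_measure V \<omega>) \<and>
     ((\<lambda>u. u powr \<alpha> * real (card {z \<in> {0..1}. u < measure (env_measure V \<omega>) {z}})) \<longlongrightarrow> 1) (at_right 0)"
proof -
  have "AE \<omega> in M. mono (\<lambda>x. V x \<omega>) \<and> (\<forall>x. continuous (at_right x) (\<lambda>y. V y \<omega>))"
    using stable by (auto simp: stable_subordinator_def elim!: eventually_mono)
  moreover have "AE \<omega> in M. \<forall>j::nat. \<forall>\<^sub>F k in sequentially. \<exists>\<^sub>F m in sequentially.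
    \<bar>real (increment_count m (threshold k) \<omega>) - (real (Suc k))\<^sup>2\<bar> \<le> inverse (real (Suc j)) * (real (Suc k))\<^sup>2"
    unfolding AE_all_countable by (intro allI AE_increment_count_close) simp
  ultimately show ?thesis
  proof eventually_elim
    case (elim \<omega>)
    define \<rho> where "\<rho> = env_measure V \<omega>"
    have Ioc: "emeasure \<rho> {a<..b} = ennreal (V b \<omega> - V a \<omega>)" if "a \<le> b" for a b
      unfolding \<rho>_def env_measure_def using elim(1) that
      by (intro emeasure_interval_measure_Ioc) (auto simp: mono_def)
    interpret locally_finite_measure \<rho>
    proof
      show sets: "sets \<rho> = sets borel" by (simp add: \<rho>_def env_measure_def)
      have "emeasure \<rho> {0..1} \<le> emeasure \<rho> {-1<..1}" by (intro emeasure_mono) (auto simp: sets)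
      then show "emeasure \<rho> {0..1} < \<infinity>" using Ioc[of "-1" 1] by (auto intro: le_less_trans)
    qed
    have "measure \<rho> (dyadic m k) = increment m k \<omega>" for m k
    proof -
      have le: "real k / 2 ^ m \<le> real (Suc k) / 2 ^ m" by (intro divide_right_mono) auto
      with elim(1) have "V (real k / 2 ^ m) \<omega> \<le> V (real (Suc k) / 2 ^ m) \<omega>" by (auto simp: mono_def)
      with Ioc[OF le] show ?thesis by (simp add: dyadic_def increment_def measure_def)
    qed
    then have count: "heavy_increments m u = increment_count m u \<omega>" for m u
      by (simp add: heavy_increments_def increment_count_def)
    let ?A = "\<lambda>u. card {z \<in> {0<..1}. u < measure \<rho> {z}}" and ?B = "\<lambda>u. card {z \<in> {0<..1}. u \<le> measure \<rho> {z}}"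
    have fin: "finite {z \<in> {0<..1}. u \<le> measure \<rho> {z}}" "finite {z \<in> {0<..1}. u < measure \<rho> {z}}" if "0 < u" for u
      by (rule finite_subset[OF _ finite_heavy_atoms[OF that]], force)+
    have both: "\<forall>\<^sub>F k in sequentially. real (?A (threshold k)) \<le> (1 + e) * (real (Suc k))\<^sup>2 \<and>
        (1 - e) * (real (Suc k))\<^sup>2 \<le> real (?B (threshold k))" if e: "0 < e" for e
    proof -
      obtain j where j: "inverse (real (Suc j)) < e" using reals_Archimedean[OF e] by auto
      from elim(2)[rule_format, of j] show ?thesis
      proof eventually_elim
        case (elim k)
        have "\<forall>\<^sub>F m in sequentially. ?A (threshold k) \<le> increment_count m (threshold k) \<omega> \<and> increment_count m (threshold k) \<omega> \<le> ?B (threshold k)"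
          using eventually_conj[OF atoms_le_heavy_increments[OF threshold(1)] heavy_increments_le_atoms[OF threshold(1)], of k k]
          by (simp only: count)
        from frequently_ex[OF frequently_eventually_frequently[OF elim this]]
        obtain m where m: "\<bar>real (increment_count m (threshold k) \<omega>) - (real (Suc k))\<^sup>2\<bar> \<le> inverse (real (Suc j)) * (real (Suc k))\<^sup>2"
          "?A (threshold k) \<le> increment_count m (threshold k) \<omega>" "increment_count m (threshold k) \<omega> \<le> ?B (threshold k)" by auto
        have "inverse (real (Suc j)) * (real (Suc k))\<^sup>2 \<le> e * (real (Suc k))\<^sup>2"
          using j by (intro mult_right_mono) auto
        with m(1) have "\<bar>real (increment_count m (threshold k) \<omega>) - (real (Suc k))\<^sup>2\<bar> \<le> e * (real (Suc k))\<^sup>2" by linarith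
        then have "real (increment_count m (threshold k) \<omega>) \<le> (1 + e) * (real (Suc k))\<^sup>2"
          "(1 - e) * (real (Suc k))\<^sup>2 \<le> real (increment_count m (threshold k) \<omega>)"
          unfolding distrib_right left_diff_distrib by linarith+
        with m(2,3) show ?case by linarith
      qed
    qed
    have "((\<lambda>u. u powr \<alpha> * real (?A u)) \<longlongrightarrow> 1) (at_right 0)"
    proof (rule count_limit_from_squares[OF alpha(1) threshold_def])
      show "?A v \<le> ?A u" if "0 < u" "u \<le> v" for u v using fin(2)[OF that(1)] that by (intro card_mono) auto
      show "?B v \<le> ?A u" if "0 < u" "u < v" for u v using fin(2)[OF that(1)] that by (intro card_mono) auto
      show "\<forall>\<^sub>F k in sequentially. real (?A (threshold k)) \<le> (1 + e) * (real (Suc k))\<^sup>2" if "0 < e" for e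
        using both[OF that] by eventually_elim simp
      show "\<forall>\<^sub>F k in sequentially. (1 - e) * (real (Suc k))\<^sup>2 \<le> real (?B (threshold k))" if "0 < e" for e
        using both[OF that] by eventually_elim simp
    qed
    from count_limit_unit_interval[OF this alpha(1)] show ?case
      unfolding \<rho>_def[symmetric] using locally_finite_measure_axioms by simp
  qed
qed

lemma AE_regular_weights: "AE \<omega> in M. regular_weights (env_weights V \<omega>) \<alpha>"
  using AE_atom_count_limit
proof eventually_elim
  case (elim \<omega>)
  then interpret locally_finite_measure "env_measure V \<omega>" by simp
  have lim: "((\<lambda>u. u powr \<alpha> * real (card {z \<in> {0..1}. u < measure (env_measure V \<omega>) {z}})) \<longlongrightarrow> 1) (at_right 0)"
    using elim by simp
  have "decreasing_atom_weights (env_measure V \<omega>) (env_weights V \<omega>)"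
    unfolding env_weights_def using exists_decreasing_atom_weights[OF lim alpha(1)] by (rule someI_ex)
  then show ?case by (rule regular_weights_decreasing_atom_weights[OF lim alpha])
qed

end

section \<open>The limit for almost every environment\<close>

theorem theorem5p8:
  fixes \<alpha> :: real
    and M :: "'a measure" and V :: "real \<Rightarrow> 'a \<Rightarrow> real"
    and P :: "'b measure" and N :: "nat \<Rightarrow> real \<Rightarrow> 'b \<Rightarrow> nat" and T :: "nat \<Rightarrow> nat \<Rightarrow> 'b \<Rightarrow> real"
  assumes "0 < \<alpha>" and "\<alpha> < 1"
    and "stable_subordinator M \<alpha> V"
    and "k_process_driver P N T"
  shows "AE \<omega> in M. \<forall>\<theta>>0.
           ((\<lambda>t. no_jump_prob P N T (env_weights V \<omega>) t \<theta>) \<longlongrightarrow> arcsine_limit \<alpha> \<theta>) (at_right 0)"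
proof -
  have "prob_space M" using assms(3) by (simp add: stable_subordinator_def)
  then interpret env: stable_environment M \<alpha> V
    using assms(1-3) by (intro stable_environment.intro stable_environment_axioms.intro)
  show ?thesis using env.AE_regular_weights
  proof eventually_elim
    case (elim \<omega>)
    interpret k_setup P N T "env_weights V \<omega>" \<alpha>
      by (intro k_setup.intro driver.intro elim assms(4))
    show ?case using no_jump_prob_limit by blast
  qed
qed

end
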